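(* Let $N,m\in\mathbb{N}\setminus\{0\}$. There exists a positive constant $C$ depending only on $N+m$ such that, for every open bounded convex domain $\Omega\subset\mathbb{R}^N$ with diameter $D_\Omega$ and every positive $\frac1m$-concave weight $\phi$ on $\Omega$, any first eigenfunction $\overline u$ associated with the weighted Neumann eigenvalue $\mu_1(\Omega,\phi)$ satisfies $$\|\overline u\|_{L^\infty(\Omega)}\ \le\ C\,\mu_1(\Omega,\phi)^{\frac{N+m}{2}}\,\frac{D_\Omega^{N+m}}{\big(\int_\Omega\phi\,dx\big)^{1/2}}\,\|\overline u\|_{L^2(\Omega,\phi)} .$$
   Context: A positive weight $\phi$ is $\frac1m$-concave if $\phi^{1/m}$ is concave on $\Omega$. The weighted Neumann eigenvalue is $$\mu_1(\Omega,\phi):=\inf\Big\{\frac{\int_\Omega|\nabla u|^2\phi\,dx}{\int_\Omega u^2\phi\,dx}: u\in H^1_{\rm loc}(\Omega)\cap L^2(\Omega,\phi\,dx),\ u\neq0,\ \int_\Omega u\,\phi\,dx=0\Big\},$$ and a first eigenfunction is a function attaining this infimum. $\|u\|_{L^2(\Omega,\phi)}=(\int_\Omega u^2\phi\,dx)^{1/2}$. *)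

theory Defs
  imports "HOL-Analysis.Analysis" "HOL-Probability.Essential_Supremum"
begin

text \<open>
  The constant in the theorem depends only on the sum of the dimension and the concavity
  exponent, so the dimension has to be quantified inside the statement and cannot be a type.
  Points of the space of dimension \<open>N\<close> are therefore functions \<open>nat \<Rightarrow> real\<close> that are
  extensional on \<open>{..<N}\<close>. This is the carrier used by \<^const>\<open>PiM\<close> and
  \<^const>\<open>product_topology\<close>.
\<close>

subsection \<open>Euclidean space of dimension \<open>N\<close>\<close>

definition Rn :: "nat \<Rightarrow> (nat \<Rightarrow> real) set" where
  "Rn N = ({..<N} \<rightarrow>\<^sub>E UNIV)"

definition Rn_top :: "nat \<Rightarrow> (nat \<Rightarrow> real) topology" where
  "Rn_top N = product_topology (\<lambda>_. euclideanreal) {..<N}"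

definition Rn_dist :: "nat \<Rightarrow> (nat \<Rightarrow> real) \<Rightarrow> (nat \<Rightarrow> real) \<Rightarrow> real" where
  "Rn_dist N x y = L2_set (\<lambda>i. x i - y i) {..<N}"

definition Rn_lebesgue :: "nat \<Rightarrow> (nat \<Rightarrow> real) measure" where
  "Rn_lebesgue N = completion (PiM {..<N} (\<lambda>_. lborel))"

lemma topspace_Rn_top [simp]: "topspace (Rn_top N) = Rn N"
  by (simp add: Rn_top_def Rn_def)

lemma space_Rn_lebesgue [simp]: "space (Rn_lebesgue N) = Rn N"
  by (simp add: Rn_lebesgue_def Rn_def space_PiM)

definition Rn_segment_point :: "nat \<Rightarrow> real \<Rightarrow> (nat \<Rightarrow> real) \<Rightarrow> (nat \<Rightarrow> real) \<Rightarrow> (nat \<Rightarrow> real)" where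
  "Rn_segment_point N t x y = (\<lambda>i\<in>{..<N}. (1 - t) * x i + t * y i)"

definition Rn_convex :: "nat \<Rightarrow> (nat \<Rightarrow> real) set \<Rightarrow> bool" where
  "Rn_convex N S \<longleftrightarrow> S \<subseteq> Rn N \<and> (\<forall>x\<in>S. \<forall>y\<in>S. \<forall>t\<in>{0..1}. Rn_segment_point N t x y \<in> S)"

definition Rn_concave_on :: "nat \<Rightarrow> (nat \<Rightarrow> real) set \<Rightarrow> ((nat \<Rightarrow> real) \<Rightarrow> real) \<Rightarrow> bool" where
  "Rn_concave_on N S f \<longleftrightarrow> Rn_convex N S \<and>
     (\<forall>x\<in>S. \<forall>y\<in>S. \<forall>t\<in>{0..1}.
        (1 - t) * f x + t * f y \<le> f (Rn_segment_point N t x y))"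

definition Rn_bounded :: "nat \<Rightarrow> (nat \<Rightarrow> real) set \<Rightarrow> bool" where
  "Rn_bounded N S \<longleftrightarrow> S \<subseteq> Rn N \<and> (\<exists>B. \<forall>x\<in>S. \<forall>y\<in>S. Rn_dist N x y \<le> B)"

definition Rn_diameter :: "nat \<Rightarrow> (nat \<Rightarrow> real) set \<Rightarrow> real" where
  "Rn_diameter N S = (if S = {} then 0 else SUP (x, y)\<in>S \<times> S. Rn_dist N x y)"

text \<open>A domain is nonempty; its connectedness follows from convexity.\<close>

definition bounded_convex_domain :: "nat \<Rightarrow> (nat \<Rightarrow> real) set \<Rightarrow> bool" where
  "bounded_convex_domain N \<Omega> \<longleftrightarrow>
     \<Omega> \<noteq> {} \<and> openin (Rn_top N) \<Omega> \<and> Rn_bounded N \<Omega> \<and> Rn_convex N \<Omega>"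

definition root_concave_weight ::
  "nat \<Rightarrow> nat \<Rightarrow> (nat \<Rightarrow> real) set \<Rightarrow> ((nat \<Rightarrow> real) \<Rightarrow> real) \<Rightarrow> bool" where
  "root_concave_weight N m \<Omega> \<phi> \<longleftrightarrow>
     (\<forall>x\<in>\<Omega>. 0 < \<phi> x) \<and> Rn_concave_on N \<Omega> (\<lambda>x. \<phi> x powr (1 / real m))"


subsection \<open>Test functions and weak gradients\<close>

definition partial_deriv :: "nat \<Rightarrow> ((nat \<Rightarrow> real) \<Rightarrow> real) \<Rightarrow> (nat \<Rightarrow> real) \<Rightarrow> real" where
  "partial_deriv i f x = deriv (\<lambda>t. f (x(i := t))) (x i)"

primrec Ck :: "nat \<Rightarrow> nat \<Rightarrow> ((nat \<Rightarrow> real) \<Rightarrow> real) \<Rightarrow> bool" where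
  "Ck N 0 f \<longleftrightarrow> continuous_map (Rn_top N) euclideanreal f"
| "Ck N (Suc k) f \<longleftrightarrow> continuous_map (Rn_top N) euclideanreal f \<and>
     (\<forall>i<N. (\<forall>x\<in>Rn N. (\<lambda>t. f (x(i := t))) differentiable (at (x i))) \<and>
            Ck N k (partial_deriv i f))"

definition test_function :: "nat \<Rightarrow> (nat \<Rightarrow> real) set \<Rightarrow> ((nat \<Rightarrow> real) \<Rightarrow> real) \<Rightarrow> bool" where
  "test_function N \<Omega> \<psi> \<longleftrightarrow> (\<forall>k. Ck N k \<psi>) \<and>
     (\<exists>K\<subseteq>\<Omega>. compactin (Rn_top N) K \<and> (\<forall>x\<in>Rn N - K. \<psi> x = 0))"

definition L2_loc :: "nat \<Rightarrow> (nat \<Rightarrow> real) set \<Rightarrow> ((nat \<Rightarrow> real) \<Rightarrow> real) \<Rightarrow> bool" where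
  "L2_loc N \<Omega> f \<longleftrightarrow> set_borel_measurable (Rn_lebesgue N) \<Omega> f \<and>
     (\<forall>K\<subseteq>\<Omega>. compactin (Rn_top N) K \<longrightarrow> set_integrable (Rn_lebesgue N) K (\<lambda>x. (f x)\<^sup>2))"

definition weak_partial ::
  "nat \<Rightarrow> (nat \<Rightarrow> real) set \<Rightarrow> nat \<Rightarrow> ((nat \<Rightarrow> real) \<Rightarrow> real) \<Rightarrow> ((nat \<Rightarrow> real) \<Rightarrow> real) \<Rightarrow> bool" where
  "weak_partial N \<Omega> i u g \<longleftrightarrow> (\<forall>\<psi>. test_function N \<Omega> \<psi> \<longrightarrow>
     (LINT x:\<Omega>|Rn_lebesgue N. u x * partial_deriv i \<psi> x)
       = - (LINT x:\<Omega>|Rn_lebesgue N. g x * \<psi> x))"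

definition is_weak_gradient ::
  "nat \<Rightarrow> (nat \<Rightarrow> real) set \<Rightarrow> ((nat \<Rightarrow> real) \<Rightarrow> real) \<Rightarrow> (nat \<Rightarrow> (nat \<Rightarrow> real) \<Rightarrow> real) \<Rightarrow> bool" where
  "is_weak_gradient N \<Omega> u G \<longleftrightarrow> (\<forall>i<N. L2_loc N \<Omega> (G i) \<and> weak_partial N \<Omega> i u (G i))"

definition H1_loc :: "nat \<Rightarrow> (nat \<Rightarrow> real) set \<Rightarrow> ((nat \<Rightarrow> real) \<Rightarrow> real) \<Rightarrow> bool" where
  "H1_loc N \<Omega> u \<longleftrightarrow> L2_loc N \<Omega> u \<and> (\<exists>G. is_weak_gradient N \<Omega> u G)"

text \<open>
  The weak gradient is unique up to null sets, so integrals of its norm do not depend on the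
  representative that is chosen.
\<close>

definition weak_gradient ::
  "nat \<Rightarrow> (nat \<Rightarrow> real) set \<Rightarrow> ((nat \<Rightarrow> real) \<Rightarrow> real) \<Rightarrow> nat \<Rightarrow> (nat \<Rightarrow> real) \<Rightarrow> real" where
  "weak_gradient N \<Omega> u = (SOME G. is_weak_gradient N \<Omega> u G)"


subsection \<open>The weighted Neumann eigenvalue\<close>

definition L2_weighted ::
  "nat \<Rightarrow> (nat \<Rightarrow> real) set \<Rightarrow> ((nat \<Rightarrow> real) \<Rightarrow> real) \<Rightarrow> ((nat \<Rightarrow> real) \<Rightarrow> real) \<Rightarrow> bool" where
  "L2_weighted N \<Omega> \<phi> u \<longleftrightarrow> set_borel_measurable (Rn_lebesgue N) \<Omega> u \<and>
     set_integrable (Rn_lebesgue N) \<Omega> (\<lambda>x. (u x)\<^sup>2 * \<phi> x)"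

definition L2_weighted_norm ::
  "nat \<Rightarrow> (nat \<Rightarrow> real) set \<Rightarrow> ((nat \<Rightarrow> real) \<Rightarrow> real) \<Rightarrow> ((nat \<Rightarrow> real) \<Rightarrow> real) \<Rightarrow> real" where
  "L2_weighted_norm N \<Omega> \<phi> u = sqrt (LINT x:\<Omega>|Rn_lebesgue N. (u x)\<^sup>2 * \<phi> x)"

definition Linf_norm :: "nat \<Rightarrow> (nat \<Rightarrow> real) set \<Rightarrow> ((nat \<Rightarrow> real) \<Rightarrow> real) \<Rightarrow> ereal" where
  "Linf_norm N \<Omega> u = esssup (restrict_space (Rn_lebesgue N) \<Omega>) (\<lambda>x. ereal \<bar>u x\<bar>)"

definition admissible ::
  "nat \<Rightarrow> (nat \<Rightarrow> real) set \<Rightarrow> ((nat \<Rightarrow> real) \<Rightarrow> real) \<Rightarrow> ((nat \<Rightarrow> real) \<Rightarrow> real) \<Rightarrow> bool" where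
  "admissible N \<Omega> \<phi> u \<longleftrightarrow> H1_loc N \<Omega> u \<and> L2_weighted N \<Omega> \<phi> u \<and>
     \<not> (AE x\<in>\<Omega> in Rn_lebesgue N. u x = 0) \<and>
     (LINT x:\<Omega>|Rn_lebesgue N. u x * \<phi> x) = 0"

text \<open>
  An admissible function need not have finite energy, so the quotient takes values in
  \<^typ>\<open>ennreal\<close>. On admissible functions its denominator is positive and finite.
\<close>

definition rayleigh ::
  "nat \<Rightarrow> (nat \<Rightarrow> real) set \<Rightarrow> ((nat \<Rightarrow> real) \<Rightarrow> real) \<Rightarrow> ((nat \<Rightarrow> real) \<Rightarrow> real) \<Rightarrow> ennreal" where
  "rayleigh N \<Omega> \<phi> u =
     (\<integral>\<^sup>+x\<in>\<Omega>. ennreal ((\<Sum>i<N. (weak_gradient N \<Omega> u i x)\<^sup>2) * \<phi> x) \<partial>Rn_lebesgue N)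
       / (\<integral>\<^sup>+x\<in>\<Omega>. ennreal ((u x)\<^sup>2 * \<phi> x) \<partial>Rn_lebesgue N)"

definition neumann_mu1 ::
  "nat \<Rightarrow> (nat \<Rightarrow> real) set \<Rightarrow> ((nat \<Rightarrow> real) \<Rightarrow> real) \<Rightarrow> ennreal" where
  "neumann_mu1 N \<Omega> \<phi> = (INF u\<in>Collect (admissible N \<Omega> \<phi>). rayleigh N \<Omega> \<phi> u)"

definition first_eigenfunction ::
  "nat \<Rightarrow> (nat \<Rightarrow> real) set \<Rightarrow> ((nat \<Rightarrow> real) \<Rightarrow> real) \<Rightarrow> ((nat \<Rightarrow> real) \<Rightarrow> real) \<Rightarrow> bool" where
  "first_eigenfunction N \<Omega> \<phi> u \<longleftrightarrow>
     admissible N \<Omega> \<phi> u \<and> rayleigh N \<Omega> \<phi> u = neumann_mu1 N \<Omega> \<phi>"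

end

theory Submission
  imports Defs "HOL-Probability.Probability_Measure"
begin

text \<open>
  Root-concavity makes the weighted measure \<open>\<nu> = \<phi> dx\<close> on \<open>\<Omega>\<close> behave like Lebesgue measure in
  dimension \<open>n = N + m\<close>. Along the contraction \<open>x \<mapsto> z = (1 - s) x + s y\<close> towards a point \<open>y\<close> of
  \<open>\<Omega>\<close> one has \<open>\<phi>(z) \<ge> (1 - s)\<^sup>m \<phi>(x)\<close>, while \<open>dz = (1 - s)\<^sup>N dx\<close>; hence
  \<open>(1 - s)\<^sup>n \<integral> f(z) d\<nu>(x) \<le> \<integral> f d\<nu>\<close> for every \<open>f \<ge> 0\<close> (lemma \<open>contraction\<close>). The integral
  inequalities below use the concavity of the weight only in this form.

  Writing \<open>v((1 - t) x + t y) - v(x)\<close> as the integral of the gradient over the segment and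
  integrating its square over \<open>x\<close> and \<open>y\<close> gives
  \<open>\<integral>\<integral> (v((1 - t) x + t y) - v(x))\<^sup>2 d\<nu>(y) d\<nu>(x) \<le> t\<^sup>2 D\<^sup>2 2\<^sup>n \<nu>(\<Omega>) \<integral> |\<nabla>v|\<^sup>2 d\<nu>\<close>
  for \<open>0 < t \<le> 1\<close> (\<open>segment_inequality\<close>). For \<open>t = 1\<close> and \<open>v\<close> of mean zero this is a Poincare inequality, so that
  \<open>D\<^sup>2 \<mu>\<close> is bounded below, where \<open>\<mu>\<close> is the first eigenvalue. For small \<open>t\<close> it says that \<open>v\<close> is
  close to its average over the copy of \<open>\<Omega>\<close> scaled by \<open>t\<close> about \<open>x\<close>, and by \<open>contraction\<close> that
  average is at most \<open>t\<^sup>-\<^sup>n\<close> times the mean of \<open>|v|\<close> over \<open>\<Omega>\<close>. Together these bounds are an inequality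
  of Nash type (\<open>nash\<close>).

  Comparing an eigenfunction \<open>u\<close> in the Rayleigh quotient with \<open>u - \<psi>(u)\<close>, where \<open>\<psi>\<close> is a smoothed
  version of \<open>s \<mapsto> max 0 (s - k)\<close>, gives \<open>\<integral> |\<nabla>\<psi>(u)|\<^sup>2 d\<nu> \<le> 2 \<mu> \<integral> u \<psi>(u) d\<nu>\<close> (\<open>truncation_energy\<close>).
  With the Nash inequality the mass of \<open>{u > k}\<close> then decays along a De Giorgi sequence of levels
  \<open>k\<close> (\<open>de_giorgi_step\<close>) and vanishes beyond a multiple of
  \<open>(D\<^sup>2 \<mu>)\<^bsup>n/2\<^esup>\<close> times the root mean square of \<open>u\<close> (\<open>de_giorgi_bound\<close>). The same holds for \<open>-u\<close>.

  Weak gradients are accessible only by testing, so that three facts about them have to be derived: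
  they are unique almost everywhere (\<open>fundamental_lemma\<close>), the fundamental theorem of calculus
  holds on almost every segment (\<open>sobolev_FTC\<close>), and there is a chain rule for functions with
  Lipschitz derivative (\<open>sobolev_chain_rule\<close>). The last two are obtained by duality: translations are
  moved onto the test function, where classical calculus applies. The eigenvalue is finite because a
  coordinate function has finite energy (\<open>neumann_mu1_finite\<close>).
\<close>

section \<open>Boxes, open sets and compact sets in coordinate space\<close>

text \<open>
  Integrals are computed for Borel representatives with respect to the uncompleted product
  measure, because Fubini's theorem and measurability under affine maps are available there.
\<close>

definition LB :: "nat \<Rightarrow> (nat \<Rightarrow> real) measure" where
  "LB N = PiM {..<N} (\<lambda>_. lborel)"

text \<open>
  Points are functions that are \<^const>\<open>undefined\<close> outside
  \<open>{..<N}\<close>, so every linear combination has to be cut down to the first \<open>N\<close> coordinates. Segments,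
  translations and dilations are all instances.
\<close>

definition lc :: "nat \<Rightarrow> real \<Rightarrow> (nat \<Rightarrow> real) \<Rightarrow> real \<Rightarrow> (nat \<Rightarrow> real) \<Rightarrow> nat \<Rightarrow> real" where
  "lc N a x b y = (\<lambda>i\<in>{..<N}. a * x i + b * y i)"

definition open_box :: "nat \<Rightarrow> (nat \<Rightarrow> real) \<Rightarrow> (nat \<Rightarrow> real) \<Rightarrow> (nat \<Rightarrow> real) set" where
  "open_box N a b = (\<Pi>\<^sub>E i\<in>{..<N}. {a i<..<b i})"

definition closed_box :: "nat \<Rightarrow> (nat \<Rightarrow> real) \<Rightarrow> (nat \<Rightarrow> real) \<Rightarrow> (nat \<Rightarrow> real) set" where
  "closed_box N a b = (\<Pi>\<^sub>E i\<in>{..<N}. {a i..b i})"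

lemma mem_open_box: "x \<in> open_box N a b \<longleftrightarrow> x \<in> Rn N \<and> (\<forall>i<N. a i < x i \<and> x i < b i)"
  by (auto simp: open_box_def Rn_def PiE_iff)

lemma mem_closed_box: "x \<in> closed_box N a b \<longleftrightarrow> x \<in> Rn N \<and> (\<forall>i<N. a i \<le> x i \<and> x i \<le> b i)"
  by (auto simp: closed_box_def Rn_def PiE_iff)

lemma not_mem_closed_box: "x \<in> Rn N - closed_box N a b \<Longrightarrow> \<exists>i<N. x i \<notin> {a i..b i}"
  by (auto simp: mem_closed_box)

lemma space_LB [simp]: "space (LB N) = Rn N"
  by (simp add: LB_def Rn_def space_PiM)

lemma Rn_lebesgue_LB: "Rn_lebesgue N = completion (LB N)"
  by (simp add: Rn_lebesgue_def LB_def)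

lemma sigma_finite_LB: "sigma_finite_measure (LB N)"
proof -
  interpret product_sigma_finite "\<lambda>_::nat. lborel :: real measure" ..
  interpret finite_product_sigma_finite "\<lambda>_::nat. lborel :: real measure" "{..<N}"
    by standard auto
  show ?thesis unfolding LB_def by (rule sigma_finite_measure_axioms)
qed

interpretation LB: sigma_finite_measure "LB N" for N
  by (rule sigma_finite_LB)

interpretation LBLB: pair_sigma_finite "LB N" "LB K" for N K ..

lemma lc_in_Rn [simp]: "lc N a x b y \<in> Rn N"
  by (simp add: lc_def Rn_def)

lemma lc_apply [simp]: "i < N \<Longrightarrow> lc N a x b y i = a * x i + b * y i"
  by (simp add: lc_def)

lemma Rn_eqI: "x \<in> Rn N \<Longrightarrow> y \<in> Rn N \<Longrightarrow> (\<And>i. i < N \<Longrightarrow> x i = y i) \<Longrightarrow> x = y"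
  unfolding Rn_def by (auto intro: PiE_ext)

lemma segment_point_eq_lc: "Rn_segment_point N t x y = lc N (1 - t) x t y"
  by (simp add: Rn_segment_point_def lc_def)

lemma lc_swap: "lc N a x b y = lc N b y a x"
  by (rule Rn_eqI[of _ N]) auto

lemma measurable_component_LB: "i < N \<Longrightarrow> (\<lambda>x. x i) \<in> borel_measurable (LB N)"
  unfolding LB_def using measurable_component_singleton[of i "{..<N}" "\<lambda>_. lborel :: real measure"]
  by simp

lemma measurable_lc [measurable (raw)]:
  assumes "f \<in> borel_measurable M" "g \<in> borel_measurable M"
    and X: "X \<in> measurable M (LB N)" and Y: "Y \<in> measurable M (LB N)"
  shows "(\<lambda>p. lc N (f p) (X p) (g p) (Y p)) \<in> measurable M (LB N)"
proof -
  have "(\<lambda>p. X p i) \<in> borel_measurable M" "(\<lambda>p. Y p i) \<in> borel_measurable M" if "i < N" for i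
    using measurable_compose[OF X measurable_component_LB[OF that]]
          measurable_compose[OF Y measurable_component_LB[OF that]] by auto
  then show ?thesis
    using assms(1,2) unfolding lc_def LB_def by (intro measurable_restrict) (auto simp: measurable_lborel1)
qed

lemma measurable_lc_const [measurable (raw)]:
  assumes "f \<in> borel_measurable M" "g \<in> borel_measurable M"
    and X: "X \<in> measurable M (LB N)"
  shows "(\<lambda>p. lc N (f p) (X p) (g p) h) \<in> measurable M (LB N)"
proof -
  have "(\<lambda>p. X p i) \<in> borel_measurable M" if "i < N" for i
    using measurable_compose[OF X measurable_component_LB[OF that]] by auto
  then show ?thesis
    using assms(1,2) unfolding lc_def LB_def by (intro measurable_restrict) (auto simp: measurable_lborel1)
qed

lemma measurable_lc_const_left [measurable (raw)]:
  assumes "f \<in> borel_measurable M" "g \<in> borel_measurable M"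
    and Y: "Y \<in> measurable M (LB N)"
  shows "(\<lambda>p. lc N (f p) x (g p) (Y p)) \<in> measurable M (LB N)"
proof -
  have "(\<lambda>p. lc N (f p) x (g p) (Y p)) = (\<lambda>p. lc N (g p) (Y p) (f p) x)"
    by (intro ext Rn_eqI[of _ N]) auto
  then show ?thesis using measurable_lc_const[OF assms(2,1) Y, of x] by simp
qed

lemma open_box_in_sets [measurable]: "open_box N a b \<in> sets (LB N)"
  unfolding open_box_def LB_def by (intro sets_PiM_I_finite) auto

lemma closed_box_in_sets [measurable]: "closed_box N a b \<in> sets (LB N)"
  unfolding closed_box_def LB_def by (intro sets_PiM_I_finite) auto

lemma emeasure_LB_PiE:
  assumes "\<And>i. i < N \<Longrightarrow> A i \<in> sets borel"
  shows "emeasure (LB N) (Pi\<^sub>E {..<N} A) = (\<Prod>i<N. emeasure lborel (A i))"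
proof -
  interpret product_sigma_finite "\<lambda>_::nat. lborel :: real measure" ..
  show ?thesis unfolding LB_def using assms by (subst emeasure_PiM) auto
qed

lemma emeasure_closed_box_finite: "emeasure (LB N) (closed_box N a b) < \<infinity>"
proof -
  have "emeasure lborel {a i..b i} < \<infinity>" for i
    by (metis emeasure_lborel_cbox_finite box_real(2) top.not_eq_extremum infinity_ennreal_def)
  then show ?thesis
    unfolding closed_box_def by (subst emeasure_LB_PiE) (auto simp: ennreal_prod_eq_top simp flip: less_top)
qed

lemma emeasure_open_box_pos:
  assumes "\<And>i. i < N \<Longrightarrow> a i < b i"
  shows "emeasure (LB N) (open_box N a b) > 0"
proof -
  have "emeasure lborel {a i<..<b i} \<noteq> 0" if "i < N" for i
    using assms[OF that] by simp
  then have "(\<Prod>i<N. emeasure lborel {a i<..<b i}) \<noteq> 0"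
    by auto
  then show ?thesis unfolding open_box_def by (subst emeasure_LB_PiE) (auto simp: zero_less_iff_neq_zero)
qed

lemma emeasure_coordinate_hyperplane:
  assumes "0 < N"
  shows "emeasure (LB N) {x \<in> Rn N. x 0 = c} = 0"
proof -
  have eq: "{x \<in> Rn N. x 0 = c} = (\<Pi>\<^sub>E i\<in>{..<N}. if i = 0 then {c} else UNIV)"
    (is "_ = ?P")
  proof (intro set_eqI iffI)
    fix x assume "x \<in> ?P"
    then have "x \<in> Rn N" "x 0 \<in> {c}" using assms PiE_mem[of x "{..<N}" _ 0] by (auto simp: Rn_def PiE_iff Ball_def split: if_splits)
    then show "x \<in> {x \<in> Rn N. x 0 = c}" by simp
  qed (simp add: Rn_def PiE_iff)
  show ?thesis unfolding eq
    by (subst emeasure_LB_PiE) (use assms in \<open>auto intro!: prod_zero\<close>)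
qed

text \<open>
  There are only finitely many coordinates, so a basic open box around a point contains a cube.
\<close>

lemma openin_Rn_iff:
  "openin (Rn_top N) S \<longleftrightarrow> S \<subseteq> Rn N \<and>
     (\<forall>x\<in>S. \<exists>r>0. \<forall>y\<in>Rn N. (\<forall>i<N. \<bar>y i - x i\<bar> \<le> r) \<longrightarrow> y \<in> S)"
proof (intro iffI conjI ballI)
  assume S: "openin (Rn_top N) S"
  then show "S \<subseteq> Rn N" using openin_subset by fastforce
  fix x assume "x \<in> S"
  then obtain U where U: "\<And>i. i < N \<Longrightarrow> open (U i)" "x \<in> Pi\<^sub>E {..<N} U" "Pi\<^sub>E {..<N} U \<subseteq> S"
    using S unfolding Rn_top_def openin_product_topology_alt by (force simp: Ball_def)
  have "\<exists>e. \<forall>i<N. 0 < e i \<and> (\<forall>z. \<bar>z - x i\<bar> \<le> e i \<longrightarrow> z \<in> U i)"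
  proof (rule choice, intro allI)
    fix i
    show "\<exists>e. i < N \<longrightarrow> 0 < e \<and> (\<forall>z. \<bar>z - x i\<bar> \<le> e \<longrightarrow> z \<in> U i)"
    proof (cases "i < N")
      case True
      then obtain e where "e > 0" "cball (x i) e \<subseteq> U i"
        using U by (metis PiE_mem lessThan_iff open_contains_cball)
      then show ?thesis by (auto simp: subset_iff dist_real_def abs_minus_commute)
    qed auto
  qed
  then obtain e where e: "\<And>i. i < N \<Longrightarrow> 0 < e i" "\<And>i z. i < N \<Longrightarrow> \<bar>z - x i\<bar> \<le> e i \<Longrightarrow> z \<in> U i"
    by blast
  define r where "r = Min (insert 1 (e ` {..<N}))"
  have "r > 0" unfolding r_def using e by (subst Min_gr_iff) auto
  moreover have re: "r \<le> e i" if "i < N" for i unfolding r_def using that by (intro Min_le) auto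
  have "y \<in> S" if "y \<in> Rn N" "\<forall>i<N. \<bar>y i - x i\<bar> \<le> r" for y
  proof (rule subsetD[OF U(3)])
    have "y i \<in> U i" if "i < N" for i
      using \<open>\<forall>i<N. \<bar>y i - x i\<bar> \<le> r\<close> re[OF that] that by (intro e(2)) force+
    then show "y \<in> Pi\<^sub>E {..<N} U" using \<open>y \<in> Rn N\<close> by (auto simp: Rn_def PiE_iff)
  qed
  ultimately show "\<exists>r>0. \<forall>y\<in>Rn N. (\<forall>i<N. \<bar>y i - x i\<bar> \<le> r) \<longrightarrow> y \<in> S" by blast
next
  assume S: "S \<subseteq> Rn N \<and> (\<forall>x\<in>S. \<exists>r>0. \<forall>y\<in>Rn N. (\<forall>i<N. \<bar>y i - x i\<bar> \<le> r) \<longrightarrow> y \<in> S)"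
  show "openin (Rn_top N) S"
    unfolding Rn_top_def openin_product_topology_alt
  proof (intro ballI)
    fix x assume "x \<in> S"
    then obtain r where r: "r > 0" "\<And>y. y \<in> Rn N \<Longrightarrow> (\<forall>i<N. \<bar>y i - x i\<bar> \<le> r) \<Longrightarrow> y \<in> S"
      using S by blast
    have "x \<in> Rn N" using S \<open>x \<in> S\<close> by auto
    show "\<exists>U. finite {i \<in> {..<N}. U i \<noteq> topspace euclideanreal} \<and>
             (\<forall>i\<in>{..<N}. openin euclideanreal (U i)) \<and> x \<in> Pi\<^sub>E {..<N} U \<and> Pi\<^sub>E {..<N} U \<subseteq> S"
    proof (intro exI[of _ "\<lambda>i. ball (x i) r"] conjI)
      show "x \<in> (\<Pi>\<^sub>E i\<in>{..<N}. ball (x i) r)" using \<open>x \<in> Rn N\<close> r by (auto simp: Rn_def PiE_iff)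
      show "(\<Pi>\<^sub>E i\<in>{..<N}. ball (x i) r) \<subseteq> S"
      proof
        fix y assume y: "y \<in> (\<Pi>\<^sub>E i\<in>{..<N}. ball (x i) r)"
        then have "dist (x i) (y i) < r" if "i < N" for i using that by (auto simp: PiE_iff)
        then show "y \<in> S" using y
          by (intro r(2)) (auto simp: Rn_def PiE_iff dist_real_def abs_minus_commute less_imp_le)
      qed
    qed auto
  qed
qed

lemma openin_Rn_nbhd:
  assumes "openin (Rn_top N) S" "x \<in> S"
  obtains r where "r > 0" "\<And>y. y \<in> Rn N \<Longrightarrow> (\<And>i. i < N \<Longrightarrow> \<bar>y i - x i\<bar> \<le> r) \<Longrightarrow> y \<in> S"
  using assms openin_Rn_iff by metis

lemma openin_open_box: "openin (Rn_top N) (open_box N a b)"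
  unfolding open_box_def Rn_top_def by (simp add: openin_PiE_gen)

lemma compactin_closed_box: "compactin (Rn_top N) (closed_box N a b)"
  unfolding closed_box_def Rn_top_def by (auto simp: compactin_PiE)

text \<open>
  Boxes with rational corners suffice. Test functions live on closed boxes, which is why the closed
  boxes are kept inside the open set.
\<close>

lemma open_countable_boxes:
  assumes S: "openin (Rn_top N) S"
  obtains F where "countable F" "\<And>a b. (a, b) \<in> F \<Longrightarrow> closed_box N a b \<subseteq> S"
    "S = (\<Union>(a, b)\<in>F. open_box N a b)"
proof
  define Q :: "(nat \<Rightarrow> real) set" where "Q = (\<Pi>\<^sub>E i\<in>{..<N}. \<rat>)"
  define F where "F = {(a, b) \<in> Q \<times> Q. closed_box N a b \<subseteq> S}"
  have "countable Q" unfolding Q_def by (intro countable_PiE) (auto simp: countable_rat)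
  then show "countable F" unfolding F_def
    by (intro countable_subset[OF _ countable_SIGMA[of Q "\<lambda>_. Q"]]) auto
  show "closed_box N a b \<subseteq> S" if "(a, b) \<in> F" for a b using that by (auto simp: F_def)
  have sub: "open_box N a b \<subseteq> closed_box N a b" for a b
    unfolding open_box_def closed_box_def by (intro PiE_mono) auto
  have ex: "\<exists>a b. (a, b) \<in> F \<and> x \<in> open_box N a b" if "x \<in> S" for x
  proof -
    obtain r where r: "r > 0" "\<And>y. y \<in> Rn N \<Longrightarrow> (\<And>i. i < N \<Longrightarrow> \<bar>y i - x i\<bar> \<le> r) \<Longrightarrow> y \<in> S"
      using openin_Rn_nbhd[OF S \<open>x \<in> S\<close>] by blast
    have x: "x \<in> Rn N" using S \<open>x \<in> S\<close> openin_Rn_iff by auto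
    have "\<forall>i. \<exists>q. q \<in> \<rat> \<and> x i - r < q \<and> q < x i" "\<forall>i. \<exists>q. q \<in> \<rat> \<and> x i < q \<and> q < x i + r"
      using Rats_dense_in_real r by (metis diff_less_eq less_add_same_cancel1)+
    then obtain a b where ab: "\<And>i. a i \<in> \<rat> \<and> x i - r < a i \<and> a i < x i" "\<And>i. b i \<in> \<rat> \<and> x i < b i \<and> b i < x i + r"
      by metis
    define a' where "a' = restrict a {..<N}"
    define b' where "b' = restrict b {..<N}"
    have "x \<in> open_box N a' b'" using ab x by (auto simp: open_box_def a'_def b'_def Rn_def PiE_iff)
    moreover have "closed_box N a' b' \<subseteq> S"
    proof
      fix y assume "y \<in> closed_box N a' b'"
      then have y: "y \<in> Rn N" "\<And>i. i < N \<Longrightarrow> a i \<le> y i \<and> y i \<le> b i"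
        by (auto simp: closed_box_def a'_def b'_def Rn_def PiE_iff)
      show "y \<in> S"
      proof (rule r(2)[OF y(1)])
        fix i assume "i < N"
        then show "\<bar>y i - x i\<bar> \<le> r" using y(2)[of i] ab(1)[of i] ab(2)[of i] by linarith
      qed
    qed
    moreover have "a' \<in> Q" "b' \<in> Q" using ab by (auto simp: Q_def a'_def b'_def)
    ultimately show ?thesis unfolding F_def by blast
  qed
  show "S = (\<Union>(a, b)\<in>F. open_box N a b)"
  proof (intro equalityI subsetI)
    fix x assume "x \<in> S"
    then show "x \<in> (\<Union>(a, b)\<in>F. open_box N a b)" using ex by fast
  next
    fix x assume "x \<in> (\<Union>(a, b)\<in>F. open_box N a b)"
    then obtain a b where "(a, b) \<in> F" "x \<in> open_box N a b" by auto
    then show "x \<in> S" using sub[of a b] unfolding F_def by fast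
  qed
qed

lemma openin_in_sets_LB: "openin (Rn_top N) S \<Longrightarrow> S \<in> sets (LB N)"
  by (erule open_countable_boxes) (auto intro!: sets.countable_UN')

lemma compactin_in_sets_LB:
  assumes "compactin (Rn_top N) K"
  shows "K \<in> sets (LB N)"
proof -
  have "Hausdorff_space (Rn_top N)" unfolding Rn_top_def by (simp add: Hausdorff_space_product_topology)
  then have "closedin (Rn_top N) K" using assms compactin_imp_closedin by blast
  then have "Rn N - K \<in> sets (LB N)" "K \<subseteq> Rn N"
    by (auto intro!: openin_in_sets_LB simp: closedin_def)
  then show ?thesis using sets.compl_sets[of "Rn N - K" "LB N"] by (simp add: double_diff)
qed

lemma compactin_subset_closed_box:
  assumes K: "compactin (Rn_top N) K"
  obtains a b where "K \<subseteq> closed_box N a b"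
proof -
  have "\<exists>B. \<forall>x\<in>K. \<bar>x i\<bar> \<le> B" if "i < N" for i
  proof -
    have "compactin euclideanreal ((\<lambda>x. x i) ` K)"
      using that K unfolding Rn_top_def by (intro image_compactin[OF K[unfolded Rn_top_def]]) (auto intro: continuous_map_product_projection)
    then show ?thesis using compact_imp_bounded[of "(\<lambda>x. x i) ` K"] by (auto simp: bounded_iff)
  qed
  then obtain B where B: "\<And>i x. i < N \<Longrightarrow> x \<in> K \<Longrightarrow> \<bar>x i\<bar> \<le> B i" by metis
  have "K \<subseteq> Rn N" using compactin_subset_topspace[OF K] by simp
  then have "K \<subseteq> closed_box N (\<lambda>i. - B i) B"
    using B by (force simp: closed_box_def Rn_def PiE_iff abs_le_iff)
  then show ?thesis using that by blast
qed

lemma emeasure_compactin_finite: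
  assumes "compactin (Rn_top N) K"
  shows "emeasure (LB N) K < \<infinity>"
proof -
  obtain a b where "K \<subseteq> closed_box N a b" using compactin_subset_closed_box[OF assms] .
  then show ?thesis using emeasure_closed_box_finite[of N a b] emeasure_mono[of K "closed_box N a b" "LB N"]
    by (simp add: order_le_less_trans)
qed

lemma continuous_map_borel_LB:
  assumes "continuous_map (Rn_top N) euclideanreal f"
  shows "f \<in> borel_measurable (LB N)"
proof (rule borel_measurableI)
  fix S :: "real set" assume "open S"
  then have "openin (Rn_top N) {x \<in> Rn N. f x \<in> S}"
    using assms openin_continuous_map_preimage[OF assms, of S] by simp
  then show "f -` S \<inter> space (LB N) \<in> sets (LB N)"
    by (auto dest!: openin_in_sets_LB simp: vimage_def Int_def conj_commute)
qed

text \<open>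
  Room around the support of a test function: after translations by at most \<open>r\<close> it still lies in
  one compact set, where local integrability can be used.
\<close>

lemma compactin_nbhd:
  assumes S: "openin (Rn_top N) S" and K: "compactin (Rn_top N) K" "K \<subseteq> S"
  obtains r L where "r > 0" "compactin (Rn_top N) L" "L \<subseteq> S"
    "\<And>x y. x \<in> K \<Longrightarrow> y \<in> Rn N \<Longrightarrow> (\<And>i. i < N \<Longrightarrow> \<bar>y i - x i\<bar> \<le> r) \<Longrightarrow> y \<in> L"
proof -
  have "\<forall>x\<in>K. \<exists>r>0. \<forall>y\<in>Rn N. (\<forall>i<N. \<bar>y i - x i\<bar> \<le> r) \<longrightarrow> y \<in> S"
    using S K(2) unfolding openin_Rn_iff by blast
  then obtain r where r: "\<And>x. x \<in> K \<Longrightarrow> r x > 0"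
     "\<And>x y. x \<in> K \<Longrightarrow> y \<in> Rn N \<Longrightarrow> (\<forall>i<N. \<bar>y i - x i\<bar> \<le> r x) \<Longrightarrow> y \<in> S" by metis
  define U where "U x = open_box N (\<lambda>i. x i - r x / 2) (\<lambda>i. x i + r x / 2)" for x
  have KR: "K \<subseteq> Rn N" using compactin_subset_topspace[OF K(1)] by simp
  have "\<exists>F. finite F \<and> F \<subseteq> U ` K \<and> K \<subseteq> \<Union>F"
  proof (rule compactinD[OF K(1)])
    show "openin (Rn_top N) W" if "W \<in> U ` K" for W
      using that by (auto simp: U_def openin_open_box)
    have "x \<in> U x" if "x \<in> K" for x
      using that KR r(1)[OF that] by (auto simp: U_def open_box_def Rn_def PiE_iff)
    then show "K \<subseteq> \<Union>(U ` K)" by blast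
  qed
  then obtain F where F: "finite F" "F \<subseteq> U ` K" "K \<subseteq> \<Union>F" by blast
  then obtain C where C: "finite C" "C \<subseteq> K" "K \<subseteq> \<Union>(U ` C)"
    using finite_subset_image[OF F(1,2)] by blast
  define L where "L = (\<Union>x\<in>C. closed_box N (\<lambda>i. x i - r x) (\<lambda>i. x i + r x))"
  define e where "e = Min (insert 1 ((\<lambda>x. r x / 2) ` C))"
  have e: "e > 0" unfolding e_def using C r by (subst Min_gr_iff) auto
  have ee: "e \<le> r x / 2" if "x \<in> C" for x unfolding e_def using that C by (intro Min_le) auto
  show ?thesis
  proof (rule that[OF e, of L])
    show "compactin (Rn_top N) L" unfolding L_def using C(1)
      by (intro compactin_Union) (auto simp: compactin_closed_box)
    show "L \<subseteq> S"
    proof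
      fix y assume "y \<in> L"
      then obtain x where x: "x \<in> C" "y \<in> closed_box N (\<lambda>i. x i - r x) (\<lambda>i. x i + r x)" by (auto simp: L_def)
      then have "\<bar>y i - x i\<bar> \<le> r x" if "i < N" for i using that by (force simp: closed_box_def PiE_iff abs_le_iff)
      then show "y \<in> S" using x C by (intro r(2)[of x]) (auto simp: closed_box_def Rn_def PiE_iff)
    qed
    fix z y assume z: "z \<in> K" "y \<in> Rn N" "\<And>i. i < N \<Longrightarrow> \<bar>y i - z i\<bar> \<le> e"
    then obtain x where x: "x \<in> C" "z \<in> U x" using C by blast
    have "y i \<in> {x i - r x..x i + r x}" if "i < N" for i
    proof -
      have "z i \<in> {x i - r x / 2<..<x i + r x / 2}" using x that by (auto simp: U_def open_box_def PiE_iff)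
      then show ?thesis using z(3)[OF that] ee[OF x(1)] by (simp add: abs_le_iff)
    qed
    then show "y \<in> L" using x z by (auto simp: L_def closed_box_def Rn_def PiE_iff)
  qed
qed

text \<open>
  The region passed over when \<open>K\<close> is translated along \<open>h\<close>; integrability on it allows averaging over
  the translations.
\<close>

lemma compactin_sweep:
  assumes K: "compactin (Rn_top N) K"
  shows "compactin (Rn_top N) ((\<lambda>(x, s). lc N 1 x s h) ` (K \<times> {0..1}))"
proof (rule image_compactin)
  show "compactin (prod_topology (Rn_top N) euclideanreal) (K \<times> {0..1})"
    using K by (simp add: compactin_Times)
  have "continuous_map (prod_topology (Rn_top N) euclideanreal) euclideanreal (\<lambda>p. fst p i + snd p * h i)" if "i < N" for i
    using that unfolding Rn_top_def
    by (intro continuous_intros continuous_map_snd continuous_map_compose[OF continuous_map_fst continuous_map_product_projection, unfolded comp_def]) auto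
  then show "continuous_map (prod_topology (Rn_top N) euclideanreal) (Rn_top N) (\<lambda>(x, s). lc N 1 x s h)"
    unfolding Rn_top_def[of N] continuous_map_componentwise
    by (auto simp: lc_def split_beta)
qed

section \<open>Affine change of variables\<close>

text \<open>
  A product measure is determined by boxes, and on a box the claim is the scaling rule for lengths in
  each coordinate.
\<close>

lemma density_distr_lc:
  assumes a: "a \<noteq> 0"
  shows "density (distr (LB N) (LB N) (\<lambda>x. lc N a x b y)) (\<lambda>_. ennreal (\<bar>a\<bar> ^ N)) = LB N"
proof -
  interpret product_sigma_finite "\<lambda>_::nat. lborel :: real measure" ..
  let ?P = "density (distr (LB N) (LB N) (\<lambda>x. lc N a x b y)) (\<lambda>_. ennreal (\<bar>a\<bar> ^ N))"
  have "?P = PiM {..<N} (\<lambda>_. lborel)"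
  proof (rule PiM_eqI)
    show "sets ?P = sets (PiM {..<N} (\<lambda>_. lborel))" by (simp add: LB_def)
    fix A :: "nat \<Rightarrow> real set" assume A: "\<And>i. i \<in> {..<N} \<Longrightarrow> A i \<in> sets lborel"
    define B where "B i = (\<lambda>z. b * y i + a * z) -` A i" for i
    have B: "B i \<in> sets borel" if "i < N" for i
      unfolding B_def using A that measurable_sets[of "\<lambda>z. b * y i + a * z" borel borel "A i"] by simp
    have pre: "(\<lambda>x. lc N a x b y) -` Pi\<^sub>E {..<N} A \<inter> space (LB N) = Pi\<^sub>E {..<N} B"
    proof (intro set_eqI iffI)
      fix x assume "x \<in> (\<lambda>x. lc N a x b y) -` Pi\<^sub>E {..<N} A \<inter> space (LB N)"
      then have x: "x \<in> Rn N" "lc N a x b y \<in> Pi\<^sub>E {..<N} A" by auto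
      have "b * y i + a * x i \<in> A i" if "i < N" for i
        using PiE_mem[OF x(2), of i] that by (simp add: add.commute)
      then show "x \<in> Pi\<^sub>E {..<N} B" using x(1) by (simp add: Rn_def B_def PiE_iff)
    next
      fix x assume x: "x \<in> Pi\<^sub>E {..<N} B"
      have "lc N a x b y i \<in> A i" if "i < N" for i
        using PiE_mem[OF x, of i] that by (simp add: B_def add.commute)
      then have "lc N a x b y \<in> Pi\<^sub>E {..<N} A"
        using lc_in_Rn[of N a x b y] by (simp add: Rn_def PiE_iff del: lc_in_Rn)
      then show "x \<in> (\<lambda>x. lc N a x b y) -` Pi\<^sub>E {..<N} A \<inter> space (LB N)"
        using x by (simp add: Rn_def PiE_iff)
    qed
    have AA: "Pi\<^sub>E {..<N} A \<in> sets (LB N)" unfolding LB_def using A by (intro sets_PiM_I_finite) auto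
    have one: "emeasure lborel (A i) = ennreal \<bar>a\<bar> * emeasure lborel (B i)" if "i < N" for i
    proof -
      have "emeasure lborel (A i) = emeasure (density (distr lborel borel (\<lambda>x. b * y i + a * x)) (\<lambda>_. ennreal \<bar>a\<bar>)) (A i)"
        using lborel_real_affine[OF a, of "b * y i"] by simp
      also have "\<dots> = ennreal \<bar>a\<bar> * emeasure lborel (B i)"
        using A that by (subst emeasure_density_const) (auto simp: emeasure_distr B_def)
      finally show ?thesis .
    qed
    have "emeasure ?P (Pi\<^sub>E {..<N} A) = ennreal (\<bar>a\<bar> ^ N) * emeasure (LB N) (Pi\<^sub>E {..<N} B)"
      using AA by (subst emeasure_density_const) (auto simp: emeasure_distr pre[unfolded space_LB])
    also have "\<dots> = (\<Prod>i<N. ennreal \<bar>a\<bar>) * (\<Prod>i<N. emeasure lborel (B i))"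
      using B by (simp add: emeasure_LB_PiE ennreal_power)
    also have "\<dots> = (\<Prod>i<N. emeasure lborel (A i))"
      using one by (simp add: prod.distrib)
    finally show "emeasure ?P (Pi\<^sub>E {..<N} A) = (\<Prod>i<N. emeasure lborel (A i))" .
  qed simp
  then show ?thesis by (simp add: LB_def)
qed

lemma nn_integral_lc:
  assumes a: "a \<noteq> 0" and f: "f \<in> borel_measurable (LB N)"
  shows "(\<integral>\<^sup>+x. f x \<partial>LB N) = ennreal (\<bar>a\<bar> ^ N) * (\<integral>\<^sup>+x. f (lc N a x b y) \<partial>LB N)"
proof -
  note [measurable] = f
  have "(\<integral>\<^sup>+x. f x \<partial>LB N) = (\<integral>\<^sup>+x. f x \<partial>density (distr (LB N) (LB N) (\<lambda>x. lc N a x b y)) (\<lambda>_. ennreal (\<bar>a\<bar> ^ N)))"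
    by (simp add: density_distr_lc[OF a])
  also have "\<dots> = ennreal (\<bar>a\<bar> ^ N) * (\<integral>\<^sup>+x. f (lc N a x b y) \<partial>LB N)"
    by (simp add: nn_integral_density nn_integral_cmult nn_integral_distr)
  finally show ?thesis .
qed

lemma AE_lc:
  assumes a: "a \<noteq> 0" and P: "AE x in LB N. P x"
  shows "AE x in LB N. P (lc N a x b y)"
proof -
  have "AE x in density (distr (LB N) (LB N) (\<lambda>x. lc N a x b y)) (\<lambda>_. ennreal (\<bar>a\<bar> ^ N)). P x"
    using P by (subst density_distr_lc[OF a])
  then have "AE x in distr (LB N) (LB N) (\<lambda>x. lc N a x b y). P x"
    using a by (subst (asm) AE_density) auto
  then show ?thesis by (rule AE_distrD[rotated]) simp
qed

lemma distr_shift: "distr (LB N) (LB N) (\<lambda>x. lc N 1 x b y) = LB N"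
  using density_distr_lc[of 1 N b y] by (simp add: density_1)

lemma nn_integral_shift:
  assumes "f \<in> borel_measurable (LB N)"
  shows "(\<integral>\<^sup>+x. f (lc N 1 x b y) \<partial>LB N) = (\<integral>\<^sup>+x. f x \<partial>LB N)"
  using nn_integral_lc[of 1 f N b y] assms by simp

lemma integral_shift:
  fixes f :: "_ \<Rightarrow> real"
  assumes "f \<in> borel_measurable (LB N)"
  shows "(LINT x|LB N. f (lc N 1 x b y)) = (LINT x|LB N. f x)"
  using integral_distr[of "\<lambda>x. lc N 1 x b y" "LB N" "LB N" f] assms by (simp add: distr_shift)

lemma integrable_shift:
  fixes f :: "_ \<Rightarrow> real"
  assumes "integrable (LB N) f"
  shows "integrable (LB N) (\<lambda>x. f (lc N 1 x b y))"
  using integrable_distr[of "\<lambda>x. lc N 1 x b y" "LB N" "LB N" f] assms by (simp add: distr_shift)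

lemma lc_shift_cancel:
  assumes "x \<in> Rn N"
  shows "lc N 1 (lc N 1 x s h) (- s) h = x" "lc N 1 (lc N 1 x (- s) h) s h = x"
  using assms by (auto intro!: Rn_eqI)

section \<open>Smooth bumps of one variable\<close>

primrec smooth_upto :: "nat \<Rightarrow> (real \<Rightarrow> real) \<Rightarrow> bool" where
  "smooth_upto 0 f \<longleftrightarrow> continuous_on UNIV f"
| "smooth_upto (Suc k) f \<longleftrightarrow> (\<forall>x. f differentiable at x) \<and> smooth_upto k (deriv f)"

lemma smooth_upto_continuous: "smooth_upto k f \<Longrightarrow> continuous_on UNIV f"
  by (cases k) (auto intro!: continuous_at_imp_continuous_on differentiable_imp_continuous_within)

lemma smooth_upto_SucD: "smooth_upto (Suc k) f \<Longrightarrow> smooth_upto k f"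
proof (induction k arbitrary: f)
  case 0
  then show ?case using smooth_upto_continuous[OF 0] by simp
qed simp

lemma deriv_real_eqI: "(\<And>x. (f has_real_derivative f' x) (at x)) \<Longrightarrow> deriv f = f'"
  using DERIV_imp_deriv by blast

lemma differentiable_has_deriv: "f differentiable at x \<Longrightarrow> (f has_real_derivative deriv f x) (at x)"
  by (metis DERIV_deriv_iff_real_differentiable)

lemma smooth_upto_Suc_iff:
  assumes "\<And>x. (f has_real_derivative f' x) (at x)"
  shows "smooth_upto (Suc k) f \<longleftrightarrow> smooth_upto k f'"
  using assms deriv_real_eqI[OF assms] real_differentiable_def by auto

lemma smooth_upto_add:
  "smooth_upto k f \<Longrightarrow> smooth_upto k g \<Longrightarrow> smooth_upto k (\<lambda>x. f x + g x)"
proof (induction k arbitrary: f g)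
  case 0
  then show ?case by (auto intro: continuous_intros)
next
  case (Suc k)
  then have "((\<lambda>x. f x + g x) has_real_derivative (deriv f x + deriv g x)) (at x)" for x
    by (intro DERIV_add differentiable_has_deriv) auto
  then show ?case using Suc by (subst smooth_upto_Suc_iff) auto
qed

lemma smooth_upto_mult:
  "smooth_upto k f \<Longrightarrow> smooth_upto k g \<Longrightarrow> smooth_upto k (\<lambda>x. f x * g x)"
proof (induction k arbitrary: f g)
  case 0
  then show ?case by (auto intro: continuous_intros)
next
  case (Suc k)
  then have d: "((\<lambda>x. f x * g x) has_real_derivative (deriv f x * g x + deriv g x * f x)) (at x)" for x
    by (intro DERIV_mult differentiable_has_deriv) auto
  moreover have "smooth_upto k f" "smooth_upto k g" using Suc.prems smooth_upto_SucD by blast+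
  ultimately show ?case
    using Suc.IH[of "deriv f" g] Suc.IH[of "deriv g" f] Suc.prems
    unfolding smooth_upto_Suc_iff[OF d] by (auto intro!: smooth_upto_add)
qed

lemma smooth_upto_const: "smooth_upto k (\<lambda>_. c)"
proof (induction k arbitrary: c)
  case (Suc k)
  then show ?case by (subst smooth_upto_Suc_iff[of _ "\<lambda>_. 0"]) auto
qed auto

lemma smooth_upto_affine:
  "smooth_upto k f \<Longrightarrow> smooth_upto k (\<lambda>x. f (c * x + d))"
proof (induction k arbitrary: f)
  case 0
  then show ?case by (auto intro!: continuous_intros continuous_on_compose2[of UNIV f])
next
  case (Suc k)
  have "((\<lambda>x. f (c * x + d)) has_real_derivative (deriv f (c * x + d) * c)) (at x)" for x
    using Suc.prems by (intro DERIV_chain2[where f = f] differentiable_has_deriv) (auto intro!: derivative_eq_intros)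
  then show ?case using Suc by (subst smooth_upto_Suc_iff) (auto intro!: smooth_upto_mult smooth_upto_const)
qed

text \<open>
  Functions of this form are closed under differentiation, which proves the smoothness of
  \<open>exp (- 1 / t)\<close> at \<open>0\<close> without computing its derivatives.
\<close>

definition flat_exp :: "real poly \<Rightarrow> real \<Rightarrow> real" where
  "flat_exp p t = (if t > 0 then poly p (1 / t) * exp (- (1 / t)) else 0)"

lemma poly_times_exp_tendsto_0: "((\<lambda>s. poly p s * exp (- s)) \<longlongrightarrow> (0::real)) at_top"
proof -
  have "((\<lambda>s. \<Sum>i\<le>degree p. coeff p i * (s ^ i / exp s)) \<longlongrightarrow> (\<Sum>i\<le>degree p. coeff p i * 0)) at_top"
    by (intro tendsto_intros tendsto_power_div_exp_0)
  then show ?thesis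
    by (simp add: poly_altdef sum_divide_distrib exp_minus field_simps)
qed

lemma flat_exp_tendsto_0: "(flat_exp p \<longlongrightarrow> 0) (at 0)"
proof -
  have "((\<lambda>t. poly p (1 / t) * exp (- (1 / t))) \<longlongrightarrow> 0) (at_right (0::real))"
    using filterlim_compose[OF poly_times_exp_tendsto_0[of p] filterlim_inverse_at_top_right]
    by (simp add: divide_inverse)
  then have "(flat_exp p \<longlongrightarrow> 0) (at_right 0)"
    by (rule Lim_transform_eventually) (auto simp: flat_exp_def eventually_at_filter)
  moreover have "(flat_exp p \<longlongrightarrow> 0) (at_left 0)"
    by (rule Lim_transform_eventually[OF tendsto_const]) (auto simp: flat_exp_def eventually_at_filter)
  ultimately show ?thesis by (simp add: filterlim_split_at)
qed

lemma flat_exp_has_derivative: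
  "(flat_exp p has_real_derivative flat_exp ([:0, 0, 1:] * (p - pderiv p)) t) (at t)"
proof -
  consider "t > 0" | "t = 0" | "t < 0" by linarith
  then show ?thesis
  proof cases
    case 1
    have inv: "((\<lambda>t. 1 / t) has_real_derivative (- (1 / t * (1 / t)))) (at t)"
      using 1 by (auto intro!: derivative_eq_intros)
    have "((\<lambda>t. poly p (1 / t) * exp (- (1 / t))) has_real_derivative
        (poly (pderiv p) (1 / t) * (- (1 / t * (1 / t))) * exp (- (1 / t))
          + exp (- (1 / t)) * (- (- (1 / t * (1 / t)))) * poly p (1 / t))) (at t)"
      by (intro DERIV_mult DERIV_chain2[OF poly_DERIV inv] DERIV_chain2[OF DERIV_exp DERIV_minus[OF inv]])
    moreover have "poly (pderiv p) r * (- (r * r)) * e + e * (- (- (r * r))) * poly p r =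
        poly ([:0, 0, 1:] * (p - pderiv p)) r * e" for r e :: real
      by (simp add: algebra_simps)
    ultimately have "((\<lambda>t. poly p (1 / t) * exp (- (1 / t))) has_real_derivative
        poly ([:0, 0, 1:] * (p - pderiv p)) (1 / t) * exp (- (1 / t))) (at t)" by metis
    then have "((\<lambda>t. poly p (1 / t) * exp (- (1 / t))) has_real_derivative
        flat_exp ([:0, 0, 1:] * (p - pderiv p)) t) (at t)"
      using 1 unfolding flat_exp_def by (simp only: if_True)
    then show ?thesis
      by (rule has_field_derivative_transform_within_open[where S = "{0<..}"])
         (use 1 in \<open>simp_all add: flat_exp_def\<close>)
  next
    case 2
    have "((\<lambda>h. (flat_exp p (0 + h) - flat_exp p 0) / h) \<longlongrightarrow> 0) (at 0)"
      by (rule Lim_transform_eventually[OF flat_exp_tendsto_0[of "[:0, 1:] * p"]])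
         (auto simp: flat_exp_def eventually_at_filter)
    then show ?thesis using 2 by (simp add: DERIV_def flat_exp_def)
  next
    case 3
    have "((\<lambda>t. 0) has_real_derivative flat_exp ([:0, 0, 1:] * (p - pderiv p)) t) (at t)"
      using 3 by (auto simp: flat_exp_def)
    then show ?thesis
      by (rule has_field_derivative_transform_within_open[of _ _ _ "{..<0}"]) (use 3 in \<open>auto simp: flat_exp_def\<close>)
  qed
qed

lemma smooth_upto_flat_exp: "smooth_upto k (flat_exp p)"
proof (induction k arbitrary: p)
  case 0
  then show ?case
    using flat_exp_has_derivative by (auto intro!: continuous_at_imp_continuous_on DERIV_isCont)
next
  case (Suc k)
  then show ?case using flat_exp_has_derivative by (subst smooth_upto_Suc_iff) auto
qed

text \<open>
  The sharpness \<open>n\<close> makes these functions converge boundedly to the indicator of the open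
  interval, as dominated convergence requires.
\<close>

definition bump :: "real \<Rightarrow> real \<Rightarrow> nat \<Rightarrow> real \<Rightarrow> real" where
  "bump a b n t = flat_exp 1 (real n * t - real n * a) * flat_exp 1 (real n * b - real n * t)"

lemma smooth_upto_bump: "smooth_upto k (bump a b n)"
  using smooth_upto_mult[OF smooth_upto_affine[OF smooth_upto_flat_exp[of k 1], of "real n" "- real n * a"]
     smooth_upto_affine[OF smooth_upto_flat_exp[of k 1], of "- real n" "real n * b"]]
  by (simp add: bump_def[abs_def] algebra_simps)

lemma bump_bounds: "0 \<le> bump a b n t" "bump a b n t \<le> 1"
  by (auto simp: bump_def flat_exp_def intro!: mult_nonneg_nonneg mult_le_one)

lemma bump_outside: "t \<notin> {a<..<b} \<Longrightarrow> bump a b n t = 0"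
  by (auto simp: bump_def flat_exp_def mult_le_0_iff zero_less_mult_iff simp flip: right_diff_distrib)

lemma bump_tendsto: "(\<lambda>n. bump a b n t) \<longlonglongrightarrow> indicator {a<..<b} t"
proof (cases "t \<in> {a<..<b}")
  case True
  have *: "(\<lambda>n. exp (- (1 / (real n * c)))) \<longlonglongrightarrow> 1" if "c > 0" for c :: real
  proof -
    have "(\<lambda>n. exp (- (inverse (real n) / c))) \<longlonglongrightarrow> exp (- (0 / c))"
      using that by (intro tendsto_intros lim_inverse_n) auto
    then show ?thesis by (simp add: divide_simps)
  qed
  have "(\<lambda>n. exp (- (1 / (real n * (t - a)))) * exp (- (1 / (real n * (b - t))))) \<longlonglongrightarrow> 1 * 1"
    using True by (intro tendsto_mult *) auto
  moreover have "\<forall>\<^sub>F n in sequentially. exp (- (1 / (real n * (t - a)))) * exp (- (1 / (real n * (b - t)))) = bump a b n t"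
    using eventually_gt_at_top[of 0] by eventually_elim
      (use True in \<open>auto simp: bump_def flat_exp_def right_diff_distrib\<close>)
  ultimately show ?thesis using True by (auto intro: Lim_transform_eventually)
qed (simp add: bump_outside)

section \<open>Test functions\<close>

text \<open>
  Products of functions of one variable are rich enough to test against, and the product rule
  differentiates them along any line.
\<close>

definition prod_fun :: "nat \<Rightarrow> (nat \<Rightarrow> real \<Rightarrow> real) \<Rightarrow> (nat \<Rightarrow> real) \<Rightarrow> real" where
  "prod_fun N f x = (\<Prod>i<N. f i (x i))"

lemma prod_fun_upd:
  assumes "i < N"
  shows "prod_fun N f (x(i := t)) = f i t * (\<Prod>j\<in>{..<N} - {i}. f j (x j))"
  unfolding prod_fun_def using assms by (subst prod.remove[of _ i]) (auto intro!: prod.cong)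

lemma prod_fun_upd_has_derivative:
  assumes i: "i < N" and f: "f i differentiable at (x i)"
  shows "((\<lambda>t. prod_fun N f (x(i := t))) has_real_derivative prod_fun N (f(i := deriv (f i))) x) (at (x i))"
proof -
  have "prod_fun N (f(i := deriv (f i))) x = deriv (f i) (x i) * (\<Prod>j\<in>{..<N} - {i}. f j (x j))"
    using prod_fun_upd[OF i, of "f(i := deriv (f i))" x "x i"] by (auto intro!: prod.cong)
  then show ?thesis unfolding prod_fun_upd[OF i]
    using DERIV_cmult_right[OF differentiable_has_deriv[OF f]] by simp
qed

lemma partial_deriv_prod_fun:
  assumes i: "i < N" and f: "\<And>x. f i differentiable at x"
  shows "partial_deriv i (prod_fun N f) = prod_fun N (f(i := deriv (f i)))"
  using DERIV_imp_deriv[OF prod_fun_upd_has_derivative[where f = f, OF i f]] by (auto simp: partial_deriv_def)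

lemma continuous_map_coordinate_fun:
  assumes "i < N" "continuous_on UNIV g"
  shows "continuous_map (Rn_top N) euclideanreal (\<lambda>x. g (x i))"
proof -
  have "continuous_map (Rn_top N) euclideanreal (\<lambda>x. x i)"
    unfolding Rn_top_def using assms by (intro continuous_map_product_projection) auto
  then have "continuous_map (Rn_top N) euclideanreal (g \<circ> (\<lambda>x. x i))"
    using assms by (intro continuous_map_compose[where X' = euclideanreal]) auto
  then show ?thesis by (simp add: comp_def)
qed

lemma continuous_map_prod_fun:
  assumes "\<And>i. i < N \<Longrightarrow> continuous_on UNIV (f i)"
  shows "continuous_map (Rn_top N) euclideanreal (prod_fun N f)"
proof -
  have "continuous_map (Rn_top N) euclideanreal (\<lambda>x. \<Prod>i\<in>I. f i (x i))" if "finite I" "I \<subseteq> {..<N}" for I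
    using that
  proof (induction I rule: finite_induct)
    case (insert i I)
    then show ?case
      using assms by (auto intro!: continuous_map_real_mult continuous_map_coordinate_fun)
  qed auto
  then show ?thesis by (simp add: prod_fun_def[abs_def])
qed

lemma Ck_prod_fun:
  assumes "\<And>i k. i < N \<Longrightarrow> smooth_upto k (f i)"
  shows "Ck N k (prod_fun N f)"
  using assms
proof (induction k arbitrary: f)
  case 0
  then show ?case using continuous_map_prod_fun smooth_upto_continuous by simp
next
  case (Suc k)
  have d: "f i differentiable at x" if "i < N" for i x using Suc.prems[OF that, of "Suc 0"] by simp
  have "Ck N k (partial_deriv i (prod_fun N f))" if "i < N" for i
    unfolding partial_deriv_prod_fun[where f = f, OF that d[OF that]]
  proof (rule Suc.IH)
    fix j l assume "j < N"
    then show "smooth_upto l ((f(i := deriv (f i))) j)"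
      using Suc.prems[of j l] Suc.prems[of i "Suc l"] that by auto
  qed
  moreover have "(\<lambda>t. prod_fun N f (x(i := t))) differentiable (at (x i))" if "i < N" for i x
    using prod_fun_upd_has_derivative[where f = f, OF that d[OF that]] real_differentiable_def by blast
  ultimately show ?case
    using Suc.prems continuous_map_prod_fun[of N f] smooth_upto_continuous by auto
qed

lemma prod_fun_vanishes:
  assumes "\<And>i t. i < N \<Longrightarrow> t \<notin> {a i..b i} \<Longrightarrow> f i t = 0" "x \<in> Rn N - closed_box N a b"
  shows "prod_fun N f x = 0"
proof -
  obtain i where "i < N" "x i \<notin> {a i..b i}" using not_mem_closed_box[OF assms(2)] by blast
  then show ?thesis unfolding prod_fun_def by (intro prod_zero bexI[of _ i] assms(1)) auto
qed

lemma test_function_prod_fun: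
  assumes "\<And>i k. i < N \<Longrightarrow> smooth_upto k (f i)"
    and "\<And>i t. i < N \<Longrightarrow> t \<notin> {a i..b i} \<Longrightarrow> f i t = 0"
    and sub: "closed_box N a b \<subseteq> \<Omega>"
  shows "test_function N \<Omega> (prod_fun N f)"
  unfolding test_function_def
proof (intro conjI allI exI[of _ "closed_box N a b"] ballI)
  show "Ck N k (prod_fun N f)" for k using Ck_prod_fun assms(1) by blast
  show "compactin (Rn_top N) (closed_box N a b)" by (rule compactin_closed_box)
  show "prod_fun N f x = 0" if "x \<in> Rn N - closed_box N a b" for x
    using assms(2) that by (rule prod_fun_vanishes)
qed (use sub in auto)

lemma prod_fun_line_has_derivative:
  assumes "\<And>i x. i < N \<Longrightarrow> f i differentiable at x"
  shows "((\<lambda>s. prod_fun N f (lc N 1 x s h)) has_real_derivative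
           (\<Sum>i<N. h i * partial_deriv i (prod_fun N f) (lc N 1 x s h))) (at s)"
proof -
  have "((\<lambda>s. \<Prod>i<N. f i (x i + s * h i)) has_derivative
      (\<lambda>y. \<Sum>i<N. (deriv (f i) (x i + s * h i) * (y * h i)) * (\<Prod>j\<in>{..<N} - {i}. f j (x j + s * h j)))) (at s)"
  proof (rule has_derivative_prod)
    fix i assume i: "i \<in> {..<N}"
    have "((\<lambda>s. f i (x i + s * h i)) has_real_derivative deriv (f i) (x i + s * h i) * h i) (at s)"
      using i assms by (intro DERIV_chain2[where f = "f i"] differentiable_has_deriv) (auto intro!: derivative_eq_intros)
    then show "((\<lambda>s. f i (x i + s * h i)) has_derivative (\<lambda>y. deriv (f i) (x i + s * h i) * (y * h i))) (at s)"
      by (rule has_derivative_eq_rhs[OF has_field_derivative_imp_has_derivative]) (auto simp: mult_ac)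
  qed
  moreover have "partial_deriv i (prod_fun N f) (lc N 1 x s h) =
      deriv (f i) (x i + s * h i) * (\<Prod>j\<in>{..<N} - {i}. f j (x j + s * h j))" if "i < N" for i
  proof -
    have "partial_deriv i (prod_fun N f) (lc N 1 x s h) = prod_fun N (f(i := deriv (f i))) ((lc N 1 x s h)(i := lc N 1 x s h i))"
      using partial_deriv_prod_fun[where f = f, OF that assms[OF that]] by simp
    also have "\<dots> = deriv (f i) (x i + s * h i) * (\<Prod>j\<in>{..<N} - {i}. f j (x j + s * h j))"
      unfolding prod_fun_upd[OF that] using that by (auto intro!: prod.cong)
    finally show ?thesis .
  qed
  moreover have "(\<lambda>s. prod_fun N f (lc N 1 x s h)) = (\<lambda>s. \<Prod>i<N. f i (x i + s * h i))"
    by (auto simp: prod_fun_def intro!: prod.cong)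
  ultimately show ?thesis
    unfolding has_field_derivative_def
    by (simp only:, elim has_derivative_eq_rhs) (auto simp: sum_distrib_left sum_distrib_right mult_ac intro!: sum.cong)
qed

lemma
  assumes \<psi>: "test_function N \<Omega> \<psi>"
  shows test_function_continuous: "continuous_map (Rn_top N) euclideanreal \<psi>"
    and test_function_measurable: "\<psi> \<in> borel_measurable (LB N)"
    and test_function_bounded: "\<exists>B. \<forall>x\<in>Rn N. \<bar>\<psi> x\<bar> \<le> B"
proof -
  have "Ck N 0 \<psi>" using \<psi> by (simp add: test_function_def del: Ck.simps)
  then show c: "continuous_map (Rn_top N) euclideanreal \<psi>" by simp
  then show "\<psi> \<in> borel_measurable (LB N)" by (rule continuous_map_borel_LB)
  obtain K where K: "compactin (Rn_top N) K" "\<And>x. x \<in> Rn N - K \<Longrightarrow> \<psi> x = 0"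
    using \<psi> unfolding test_function_def by blast
  then have "compact (\<psi> ` K)" using image_compactin[OF K(1) c] by simp
  then obtain B where "\<And>x. x \<in> K \<Longrightarrow> \<bar>\<psi> x\<bar> \<le> B" using compact_imp_bounded[of "\<psi> ` K"] by (auto simp: bounded_iff)
  then have "\<forall>x\<in>Rn N. \<bar>\<psi> x\<bar> \<le> max 0 B" using K(2) by (metis DiffI abs_zero max.cobounded1 max.coboundedI2)
  then show "\<exists>B. \<forall>x\<in>Rn N. \<bar>\<psi> x\<bar> \<le> B" ..
qed

lemma test_function_has_partial:
  assumes "test_function N \<Omega> \<psi>" "i < N" "x \<in> Rn N"
  shows "((\<lambda>t. \<psi> (x(i := t))) has_real_derivative partial_deriv i \<psi> x) (at (x i))"
proof -
  have "Ck N (Suc 0) \<psi>" using assms by (simp add: test_function_def del: Ck.simps)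
  then have "(\<lambda>t. \<psi> (x(i := t))) differentiable (at (x i))" using assms by simp
  then show ?thesis unfolding partial_deriv_def by (rule differentiable_has_deriv)
qed

text \<open>
  The complement of \<open>K\<close> is open, so the function is locally constant along the coordinate line
  through \<open>x\<close>.
\<close>

lemma partial_deriv_vanishes:
  assumes i: "i < N" and K: "compactin (Rn_top N) K" and z: "\<And>x. x \<in> Rn N - K \<Longrightarrow> \<psi> x = 0"
    and x: "x \<in> Rn N - K"
  shows "partial_deriv i \<psi> x = 0"
proof -
  have "Hausdorff_space (Rn_top N)" unfolding Rn_top_def by (simp add: Hausdorff_space_product_topology)
  then have "openin (Rn_top N) (Rn N - K)" using K compactin_imp_closedin[of "Rn_top N" K] by (auto simp: closedin_def)
  then obtain r where r: "r > 0" "\<And>y. y \<in> Rn N \<Longrightarrow> (\<And>i. i < N \<Longrightarrow> \<bar>y i - x i\<bar> \<le> r) \<Longrightarrow> y \<in> Rn N - K"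
    using openin_Rn_nbhd[OF _ x] by blast
  have "\<psi> (x(i := t)) = 0" if "t \<in> ball (x i) r" for t
  proof -
    have "x(i := t) \<in> Rn N" using x i by (auto simp: Rn_def PiE_iff extensional_def)
    moreover have "\<bar>(x(i := t)) j - x j\<bar> \<le> r" if "j < N" for j
      using \<open>t \<in> ball (x i) r\<close> r(1) by (auto simp: dist_real_def abs_minus_commute)
    ultimately show ?thesis using r(2) z by blast
  qed
  then have eq: "(0::real) = \<psi> (x(i := t))" if "t \<in> ball (x i) r" for t using that by metis
  have c: "((\<lambda>t::real. 0::real) has_real_derivative 0) (at (x i))" by (rule DERIV_const)
  have m: "x i \<in> ball (x i) r" using r(1) by (rule centre_in_ball[THEN iffD2])
  have "((\<lambda>t. \<psi> (x(i := t))) has_real_derivative 0) (at (x i))"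
    using c open_ball m eq by (rule has_field_derivative_transform_within_open)
  then show ?thesis unfolding partial_deriv_def by (rule DERIV_imp_deriv)
qed

lemma test_function_partial_deriv:
  assumes \<psi>: "test_function N \<Omega> \<psi>" and i: "i < N"
  shows "test_function N \<Omega> (partial_deriv i \<psi>)"
proof -
  obtain K where K: "compactin (Rn_top N) K" "K \<subseteq> \<Omega>" "\<And>x. x \<in> Rn N - K \<Longrightarrow> \<psi> x = 0"
    using \<psi> unfolding test_function_def by blast
  have "Ck N (Suc k) \<psi>" for k using \<psi> by (simp add: test_function_def del: Ck.simps)
  then have "Ck N k (partial_deriv i \<psi>)" for k using i by simp
  moreover have "\<forall>x\<in>Rn N - K. partial_deriv i \<psi> x = 0"
    by (intro ballI partial_deriv_vanishes[OF i K(1)] K(3))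
  ultimately show ?thesis unfolding test_function_def using K(1,2) by (intro conjI allI exI[of _ K])
qed

section \<open>The fundamental lemma of the calculus of variations\<close>

lemma coordinates_bounded:
  fixes x :: "nat \<Rightarrow> real"
  obtains n :: nat where "\<And>j. j < N \<Longrightarrow> \<bar>x j\<bar> < real n"
proof -
  obtain n :: nat where n: "Max (insert 0 ((\<lambda>j. \<bar>x j\<bar>) ` {..<N})) < real n" using reals_Archimedean2 by blast
  have "\<bar>x j\<bar> < real n" if "j < N" for j
  proof -
    have "\<bar>x j\<bar> \<le> Max (insert 0 ((\<lambda>j. \<bar>x j\<bar>) ` {..<N}))" by (rule Max_ge) (use that in auto)
    then show ?thesis using n by linarith
  qed
  then show ?thesis using that by blast
qed

text \<open>
  A half space \<open>c < x i\<close> is a countable union of open boxes, and half spaces generate.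
\<close>

lemma sigma_sets_open_boxes:
  "sets (LB N) = sigma_sets (Rn N) {open_box N a b | a b. True}"
proof
  let ?E = "{open_box N a b | a b. True}"
  have EP: "?E \<subseteq> Pow (Rn N)" by (auto simp: open_box_def Rn_def PiE_iff)
  show "sigma_sets (Rn N) ?E \<subseteq> sets (LB N)"
  proof -
    have "?E \<subseteq> sets (LB N)" by auto
    from sets.sigma_sets_subset[OF this] show ?thesis by simp
  qed
  have coord: "(\<lambda>x. x i) \<in> borel_measurable (sigma (Rn N) ?E)" if i: "i < N" for i
  proof (rule borel_measurableI_greater)
    fix c :: real
    have "{x \<in> Rn N. c < x i} = (\<Union>n::nat. open_box N (\<lambda>j. if j = i then c else - real n) (\<lambda>_. real n))"
    proof (intro set_eqI iffI)
      fix x assume x: "x \<in> {x \<in> Rn N. c < x i}"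
      obtain n :: nat where "\<And>j. j < N \<Longrightarrow> \<bar>x j\<bar> < real n" using coordinates_bounded[of N x] by blast
      then have "x \<in> open_box N (\<lambda>j. if j = i then c else - real n) (\<lambda>_. real n)"
        using x unfolding mem_open_box by (simp add: abs_less_iff) (metis minus_less_iff)
      then show "x \<in> (\<Union>n::nat. open_box N (\<lambda>j. if j = i then c else - real n) (\<lambda>_. real n))" by blast
    next
      fix x assume "x \<in> (\<Union>n::nat. open_box N (\<lambda>j. if j = i then c else - real n) (\<lambda>_. real n))"
      then obtain n where x: "x \<in> open_box N (\<lambda>j. if j = i then c else - real n) (\<lambda>_. real n)" by blast
      then show "x \<in> {x \<in> Rn N. c < x i}" using i by (simp add: mem_open_box) (metis (full_types))
    qed
    also have "\<dots> \<in> sigma_sets (Rn N) ?E" by (intro sigma_sets.Union sigma_sets.Basic) auto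
    finally show "{x \<in> space (sigma (Rn N) ?E). c < x i} \<in> sets (sigma (Rn N) ?E)" using EP by simp
  qed
  have "(\<lambda>x i. x i) \<in> measurable (sigma (Rn N) ?E) (PiM {..<N} (\<lambda>_. lborel))"
    using coord EP by (intro measurable_PiM_single') (auto simp: measurable_lborel1 Rn_def)
  then have id: "(\<lambda>x. x) \<in> measurable (sigma (Rn N) ?E) (LB N)" by (simp add: LB_def)
  show "sets (LB N) \<subseteq> sigma_sets (Rn N) ?E"
  proof
    fix A assume A: "A \<in> sets (LB N)"
    then have "A \<subseteq> Rn N" using sets.sets_into_space[OF A] by simp
    then show "A \<in> sigma_sets (Rn N) ?E" using measurable_sets[OF id A] EP by (simp add: Int_absorb2)
  qed
qed

lemma open_box_Int:
  "open_box N a b \<inter> open_box N c d = open_box N (\<lambda>i. max (a i) (c i)) (\<lambda>i. min (b i) (d i))"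
  unfolding set_eq_iff Int_iff mem_open_box by auto

lemma prod_fun_bump_tendsto:
  assumes "x \<in> Rn N"
  shows "(\<lambda>n. prod_fun N (\<lambda>i. bump (a i) (b i) n) x) \<longlonglongrightarrow> indicator (open_box N a b) x"
proof -
  have "(\<lambda>n. prod_fun N (\<lambda>i. bump (a i) (b i) n) x) \<longlonglongrightarrow> (\<Prod>i<N. indicator {a i<..<b i} (x i))"
    unfolding prod_fun_def by (intro tendsto_prod bump_tendsto)
  also have "(\<Prod>i<N. indicator {a i<..<b i} (x i)) = (indicator (open_box N a b) x :: real)"
  proof (cases "x \<in> open_box N a b")
    case True
    then show ?thesis by (auto simp: mem_open_box intro!: prod.neutral)
  next
    case False
    then obtain i where "i < N" "x i \<notin> {a i<..<b i}" using assms by (auto simp: mem_open_box)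
    then show ?thesis using False by (auto intro!: prod_zero bexI[of _ i])
  qed
  finally show ?thesis .
qed

lemma prod_fun_bump_bounds:
  "0 \<le> prod_fun N (\<lambda>i. bump (a i) (b i) n) x" "prod_fun N (\<lambda>i. bump (a i) (b i) n) x \<le> 1"
  unfolding prod_fun_def by (auto intro!: prod_nonneg prod_le_1 bump_bounds)

text \<open>
  Bumps converge to indicators, so \<open>g\<close> has integral zero over every box with closure in \<open>\<Omega>\<close>. The
  positive and the negative part of \<open>g\<close> are then densities of two measures that agree on a
  generator, and countably many boxes exhaust \<open>\<Omega>\<close>.
\<close>

lemma fundamental_lemma:
  assumes \<Omega>: "openin (Rn_top N) \<Omega>" and g: "g \<in> borel_measurable (LB N)"
    and loc: "\<And>K. compactin (Rn_top N) K \<Longrightarrow> K \<subseteq> \<Omega> \<Longrightarrow> set_integrable (LB N) K g"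
    and zero: "\<And>f a b. (\<And>i k. i < N \<Longrightarrow> smooth_upto k (f i)) \<Longrightarrow>
        (\<And>i t. i < N \<Longrightarrow> t \<notin> {a i..b i} \<Longrightarrow> f i t = 0) \<Longrightarrow> closed_box N a b \<subseteq> \<Omega> \<Longrightarrow>
        (LINT x|LB N. g x * prod_fun N f x) = 0"
  shows "AE x in LB N. x \<in> \<Omega> \<longrightarrow> g x = (0::real)"
proof -
  note [measurable] = g
  have box_sub: "open_box N a b \<subseteq> closed_box N a b" for a b
    unfolding open_box_def closed_box_def by (intro PiE_mono) auto
  have intg: "integrable (LB N) (\<lambda>x. indicator (closed_box N a b) x * g x)" if "closed_box N a b \<subseteq> \<Omega>" for a b
    using loc[OF compactin_closed_box that] by (simp add: set_integrable_def)
  have box0: "(LINT x|LB N. indicator (open_box N a b) x * g x) = 0" if sub: "closed_box N a b \<subseteq> \<Omega>" for a b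
  proof -
    let ?\<psi> = "\<lambda>n. prod_fun N (\<lambda>i. bump (a i) (b i) n)"
    have test: "test_function N \<Omega> (?\<psi> n)" for n
      by (rule test_function_prod_fun[OF _ _ sub]) (auto intro: smooth_upto_bump bump_outside)
    note [measurable] = test_function_measurable[OF test]
    have "(\<lambda>n. LINT x|LB N. g x * ?\<psi> n x) \<longlonglongrightarrow> (LINT x|LB N. g x * indicator (open_box N a b) x)"
    proof (rule integral_dominated_convergence)
      show "integrable (LB N) (\<lambda>x. norm (indicator (closed_box N a b) x * g x))" using intg[OF sub] by (rule integrable_norm)
      show "AE x in LB N. (\<lambda>n. g x * ?\<psi> n x) \<longlonglongrightarrow> g x * indicator (open_box N a b) x"
        by (intro AE_I2 tendsto_intros prod_fun_bump_tendsto) auto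
      show "AE x in LB N. norm (g x * ?\<psi> n x) \<le> norm (indicator (closed_box N a b) x * g x)" for n
      proof (rule AE_I2)
        fix x assume x: "x \<in> space (LB N)"
        show "norm (g x * ?\<psi> n x) \<le> norm (indicator (closed_box N a b) x * g x)"
        proof (cases "x \<in> closed_box N a b")
          case True
          have "\<bar>?\<psi> n x\<bar> \<le> 1" using prod_fun_bump_bounds[of N a b n x] by linarith
          then show ?thesis using True by (simp add: abs_mult mult_left_le)
        next
          case False
          then have "?\<psi> n x = 0" using x by (intro prod_fun_vanishes[of N a b] bump_outside) auto
          then show ?thesis by simp
        qed
      qed
    qed auto
    moreover have "(LINT x|LB N. g x * ?\<psi> n x) = 0" for n
      by (rule zero[OF _ _ sub]) (auto intro: smooth_upto_bump bump_outside)
    ultimately show ?thesis by (simp add: LIMSEQ_const_iff mult.commute)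
  qed
  have box_ae: "AE x in LB N. x \<in> open_box N A B \<longrightarrow> g x = 0" if sub: "closed_box N A B \<subseteq> \<Omega>" for A B
  proof -
    define Q where "Q = open_box N A B"
    have Q [measurable]: "Q \<in> sets (LB N)" by (simp add: Q_def)
    have intQ: "integrable (LB N) (\<lambda>x. indicator Q x * g x)"
      unfolding Q_def by (rule Bochner_Integration.integrable_bound[OF intg[OF sub]])
        (use box_sub[of A B] in \<open>auto simp: indicator_def\<close>)
    define p where "p x = ennreal (indicator Q x * g x)" for x
    define q where "q x = ennreal (- (indicator Q x * g x))" for x
    have [measurable]: "p \<in> borel_measurable (LB N)" "q \<in> borel_measurable (LB N)" by (auto simp: p_def[abs_def] q_def[abs_def])
    have fin: "(\<integral>\<^sup>+x. p x \<partial>LB N) < \<infinity>" "(\<integral>\<^sup>+x. q x \<partial>LB N) < \<infinity>"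
      using intQ unfolding real_integrable_def p_def q_def by (auto simp: less_top)
    have "density (LB N) p = density (LB N) q"
    proof (rule measure_eqI_generator_eq)
      let ?E = "{open_box N a b | a b. True}"
      show "Int_stable ?E" unfolding Int_stable_def using open_box_Int by blast
      show "?E \<subseteq> Pow (Rn N)" by (auto simp: open_box_def Rn_def PiE_iff)
      show "sets (density (LB N) p) = sigma_sets (Rn N) ?E" "sets (density (LB N) q) = sigma_sets (Rn N) ?E"
        using sigma_sets_open_boxes[of N] by auto
      show "range (\<lambda>n::nat. open_box N (\<lambda>_. - real n) (\<lambda>_. real n)) \<subseteq> ?E" by auto
      show "(\<Union>n::nat. open_box N (\<lambda>_. - real n) (\<lambda>_. real n)) = Rn N"
      proof (intro equalityI subsetI)
        fix x assume x: "x \<in> Rn N"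
        obtain n :: nat where "\<And>j. j < N \<Longrightarrow> \<bar>x j\<bar> < real n" using coordinates_bounded[of N x] by blast
        then have "x \<in> open_box N (\<lambda>_. - real n) (\<lambda>_. real n)"
          using x unfolding mem_open_box by (simp add: abs_less_iff) (metis minus_less_iff)
        then show "x \<in> (\<Union>n::nat. open_box N (\<lambda>_. - real n) (\<lambda>_. real n))" by blast
      qed (auto simp: open_box_def Rn_def PiE_iff)
      have "emeasure (density (LB N) p) X \<le> (\<integral>\<^sup>+x. p x \<partial>LB N)" if "X \<in> sets (LB N)" for X
        using that by (subst emeasure_density) (auto intro!: nn_integral_mono simp: indicator_def)
      then show "emeasure (density (LB N) p) (open_box N (\<lambda>_. - real n) (\<lambda>_. real n)) \<noteq> \<infinity>" for n :: nat
        using fin(1) open_box_in_sets by (metis infinity_ennreal_def leD)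
      fix X assume "X \<in> ?E"
      then obtain a b where X: "X = open_box N a b" by blast
      define c where "c = (\<lambda>i. max (A i) (a i))"
      define d where "d = (\<lambda>i. min (B i) (b i))"
      have QX: "Q \<inter> X = open_box N c d" by (simp add: Q_def X open_box_Int c_def d_def)
      have "closed_box N c d \<subseteq> closed_box N A B" unfolding closed_box_def by (intro PiE_mono) (auto simp: c_def d_def)
      then have sub': "closed_box N c d \<subseteq> \<Omega>" using sub by (rule order_trans)
      have int: "integrable (LB N) (\<lambda>x. indicator (open_box N c d) x * g x)"
        by (rule Bochner_Integration.integrable_bound[OF intg[OF sub']])
          (use box_sub[of c d] in \<open>auto simp: indicator_def\<close>)
      have fin2: "(\<integral>\<^sup>+x. ennreal (indicator (open_box N c d) x * g x) \<partial>LB N) \<noteq> \<infinity>"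
        "(\<integral>\<^sup>+x. ennreal (- (indicator (open_box N c d) x * g x)) \<partial>LB N) \<noteq> \<infinity>"
        using int unfolding real_integrable_def by auto
      have "(\<integral>\<^sup>+x. ennreal (indicator (open_box N c d) x * g x) \<partial>LB N) =
            (\<integral>\<^sup>+x. ennreal (- (indicator (open_box N c d) x * g x)) \<partial>LB N)"
      proof -
        have eqI: "p = q" if "0 = enn2real p - enn2real q" "p \<noteq> \<infinity>" "q \<noteq> \<infinity>" for p q
          using that by (metis eq_iff_diff_eq_0 ennreal_enn2real_if infinity_ennreal_def)
        show ?thesis
          by (rule eqI[OF _ fin2]) (rule trans[OF box0[OF sub', symmetric] real_lebesgue_integral_def[OF int]])
      qed
      moreover have "emeasure (density (LB N) p) X = (\<integral>\<^sup>+x. ennreal (indicator (open_box N c d) x * g x) \<partial>LB N)"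
        unfolding QX[symmetric] using X by (subst emeasure_density) (auto simp: p_def indicator_def intro!: nn_integral_cong)
      moreover have "emeasure (density (LB N) q) X = (\<integral>\<^sup>+x. ennreal (- (indicator (open_box N c d) x * g x)) \<partial>LB N)"
        unfolding QX[symmetric] using X by (subst emeasure_density) (auto simp: q_def indicator_def intro!: nn_integral_cong)
      ultimately show "emeasure (density (LB N) p) X = emeasure (density (LB N) q) X" by simp
    qed
    then have "AE x in LB N. p x = q x"
      using fin by (subst (asm) finite_density_unique) auto
    then show ?thesis
    proof eventually_elim
      case (elim x)
      show ?case
      proof
        assume "x \<in> open_box N A B"
        then have "ennreal (g x) = ennreal (- g x)" using elim by (simp add: p_def q_def Q_def)
        then show "g x = 0" by (cases "g x \<ge> 0") (auto simp: ennreal_neg ennreal_eq_0_iff dest: sym)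
      qed
    qed
  qed
  obtain F where F: "countable F" "\<And>a b. (a, b) \<in> F \<Longrightarrow> closed_box N a b \<subseteq> \<Omega>"
    "\<Omega> = (\<Union>(a, b)\<in>F. open_box N a b)" using open_countable_boxes[OF \<Omega>] by blast
  have "AE x in LB N. \<forall>c\<in>F. x \<in> open_box N (fst c) (snd c) \<longrightarrow> g x = 0"
    unfolding AE_ball_countable[OF F(1)]
  proof
    fix c assume "c \<in> F"
    then show "AE x in LB N. x \<in> open_box N (fst c) (snd c) \<longrightarrow> g x = 0"
      by (intro box_ae F(2)) simp
  qed
  then show ?thesis by eventually_elim (use F(3) in \<open>fastforce simp: split_beta\<close>)
qed

section \<open>Averages along segments\<close>

text \<open>
  A probability space, so that averaging over the position on a segment costs no factor.
\<close>

definition U01 :: "real measure" where "U01 = restrict_space lborel {0..1}"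

lemma space_U01 [simp]: "space U01 = {0..1}"
  by (simp add: U01_def space_restrict_space)

lemma prob_space_U01: "prob_space U01"
  by standard (simp add: U01_def emeasure_restrict_space space_restrict_space)

interpretation U01: prob_space U01 by (rule prob_space_U01)

interpretation LBU: pair_sigma_finite "LB N" U01 for N ..

lemma measurable_U01_id [measurable]: "(\<lambda>s. s) \<in> borel_measurable U01"
  unfolding U01_def by (rule measurable_restrict_space1) simp

lemma integral_U01_FTC:
  assumes F: "\<And>x. (F has_real_derivative f x) (at x)" and f: "continuous_on UNIV f"
  shows "(LINT s|U01. f s) = F 1 - F (0::real)"
proof -
  have "(LINT s|U01. f s) = (LINT s|lborel. indicator {0..1} s *\<^sub>R f s)"
    unfolding U01_def by (subst integral_restrict_space) (auto simp: set_lebesgue_integral_def)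
  also have "\<dots> = (LINT s|lborel. f s * indicator {0..1} s)" by (simp add: mult.commute)
  also have "\<dots> = F 1 - F 0"
    using f by (intro integral_FTC_Icc_real F) (auto simp: continuous_on_eq_continuous_at)
  finally show ?thesis .
qed

lemma measurable_shift_U01 [measurable]:
  "(\<lambda>p. lc N 1 (fst p) (snd p) h) \<in> measurable (LB N \<Otimes>\<^sub>M U01) (LB N)"
  "(\<lambda>p. lc N 1 (fst p) (- snd p) h) \<in> measurable (LB N \<Otimes>\<^sub>M U01) (LB N)"
  by measurable

text \<open>
  By translation invariance \<open>H\<close> has the same integral after every shift, so it is integrable jointly
  in the point and the shift.
\<close>

lemma integrable_pair_shift:
  fixes H :: "_ \<Rightarrow> real"
  assumes H: "integrable (LB N) H" and W: "W \<in> borel_measurable (LB N \<Otimes>\<^sub>M U01)"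
    and B: "\<And>x s. x \<in> Rn N \<Longrightarrow> s \<in> {0..1} \<Longrightarrow> \<bar>W (x, s)\<bar> \<le> B"
  shows "integrable (LB N \<Otimes>\<^sub>M U01) (\<lambda>(x, s). W (x, s) * H (lc N 1 x s h))"
    and "integrable (LB N \<Otimes>\<^sub>M U01) (\<lambda>(x, s). W (x, s) * H x)"
proof -
  note [measurable] = borel_measurable_integrable[OF H] W
  have fin: "(\<integral>\<^sup>+x. ennreal (norm (H x)) \<partial>LB N) < \<infinity>" using H by (simp add: integrable_iff_bounded)
  have "integrable (LB N \<Otimes>\<^sub>M U01) (\<lambda>p. H (lc N 1 (fst p) (snd p) h))"
    unfolding integrable_iff_bounded
  proof
    have "(\<integral>\<^sup>+p. ennreal (norm (H (lc N 1 (fst p) (snd p) h))) \<partial>(LB N \<Otimes>\<^sub>M U01)) =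
      (\<integral>\<^sup>+s. \<integral>\<^sup>+x. ennreal (norm (H (lc N 1 x s h))) \<partial>LB N \<partial>U01)"
      by (subst LBU.nn_integral_snd[symmetric]) auto
    also have "\<dots> = (\<integral>\<^sup>+s. (\<integral>\<^sup>+x. ennreal (norm (H x)) \<partial>LB N) \<partial>U01)"
      by (intro nn_integral_cong nn_integral_shift) measurable
    also have "\<dots> < \<infinity>" using fin by (simp add: U01.emeasure_space_1 del: space_U01)
    finally show "(\<integral>\<^sup>+p. ennreal (norm (H (lc N 1 (fst p) (snd p) h))) \<partial>(LB N \<Otimes>\<^sub>M U01)) < \<infinity>" .
  qed measurable
  then have "integrable (LB N \<Otimes>\<^sub>M U01) (\<lambda>p. B * H (lc N 1 (fst p) (snd p) h))" by simp
  then show "integrable (LB N \<Otimes>\<^sub>M U01) (\<lambda>(x, s). W (x, s) * H (lc N 1 x s h))"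
    by (rule Bochner_Integration.integrable_bound)
       (auto simp: space_pair_measure abs_mult split_beta intro!: mult_right_mono order_trans[OF B] AE_I2)
  have "integrable (LB N \<Otimes>\<^sub>M U01) (\<lambda>p. H (fst p))"
    unfolding integrable_iff_bounded
  proof
    have "(\<integral>\<^sup>+p. ennreal (norm (H (fst p))) \<partial>(LB N \<Otimes>\<^sub>M U01)) = (\<integral>\<^sup>+s. (\<integral>\<^sup>+x. ennreal (norm (H x)) \<partial>LB N) \<partial>U01)"
      by (subst LBU.nn_integral_snd[symmetric]) auto
    also have "\<dots> < \<infinity>" using fin by (simp add: U01.emeasure_space_1 del: space_U01)
    finally show "(\<integral>\<^sup>+p. ennreal (norm (H (fst p))) \<partial>(LB N \<Otimes>\<^sub>M U01)) < \<infinity>" .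
  qed measurable
  then have "integrable (LB N \<Otimes>\<^sub>M U01) (\<lambda>p. B * H (fst p))" by simp
  then show "integrable (LB N \<Otimes>\<^sub>M U01) (\<lambda>(x, s). W (x, s) * H x)"
    by (rule Bochner_Integration.integrable_bound)
       (auto simp: space_pair_measure abs_mult split_beta intro!: mult_right_mono order_trans[OF B] AE_I2)
qed

lemma integrable_segment_average:
  fixes H :: "_ \<Rightarrow> real"
  assumes "integrable (LB N) H"
  shows "integrable (LB N) (\<lambda>x. LINT s|U01. H (lc N 1 x s h))"
  using LBU.integrable_fst[OF integrable_pair_shift(1)[OF assms, of "\<lambda>_. 1" 1 h]] by simp

text \<open>
  Fubini's theorem and translation invariance move the shift from \<open>H\<close> to \<open>\<zeta>\<close>.
\<close>

lemma integral_segment_average: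
  fixes H :: "_ \<Rightarrow> real"
  assumes H: "integrable (LB N) H" and \<zeta>: "\<zeta> \<in> borel_measurable (LB N)"
    and B: "\<And>x. x \<in> Rn N \<Longrightarrow> \<bar>\<zeta> x\<bar> \<le> B"
  shows "integrable (LB N) (\<lambda>x. \<zeta> x * (LINT s|U01. H (lc N 1 x s h)))" (is ?A)
    and "(LINT x|LB N. \<zeta> x * (LINT s|U01. H (lc N 1 x s h))) =
         (LINT s|U01. LINT x|LB N. \<zeta> (lc N 1 x (- s) h) * H x)" (is ?B)
proof -
  note [measurable] = borel_measurable_integrable[OF H] \<zeta>
  have W: "(\<lambda>p. \<zeta> (fst p)) \<in> borel_measurable (LB N \<Otimes>\<^sub>M U01)" by measurable
  have int: "integrable (LB N \<Otimes>\<^sub>M U01) (\<lambda>(x, s). \<zeta> x * H (lc N 1 x s h))"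
    using integrable_pair_shift(1)[OF H W, of B h] B by simp
  show ?A using LBU.integrable_fst[OF int] by simp
  have "(LINT x|LB N. \<zeta> x * (LINT s|U01. H (lc N 1 x s h))) = (LINT s|U01. LINT x|LB N. \<zeta> x * H (lc N 1 x s h))"
    using LBU.Fubini_integral[OF int] by simp
  also have "\<dots> = (LINT s|U01. LINT x|LB N. \<zeta> (lc N 1 x (- s) h) * H x)"
  proof (rule Bochner_Integration.integral_cong[OF refl])
    fix s
    have "(LINT x|LB N. \<zeta> (lc N 1 x (- s) h) * H x) =
      (LINT x|LB N. \<zeta> (lc N 1 (lc N 1 x s h) (- s) h) * H (lc N 1 x s h))"
      by (rule integral_shift[symmetric]) measurable
    also have "\<dots> = (LINT x|LB N. \<zeta> x * H (lc N 1 x s h))"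
      by (intro Bochner_Integration.integral_cong refl) (simp add: lc_shift_cancel)
    finally show "(LINT x|LB N. \<zeta> x * H (lc N 1 x s h)) = (LINT x|LB N. \<zeta> (lc N 1 x (- s) h) * H x)" by simp
  qed
  finally show ?B .
qed

section \<open>Weakly differentiable functions along segments\<close>

text \<open>
  A locally square integrable function together with a weak gradient, both represented by Borel
  functions. Carrying the gradient along avoids the choice made by \<^const>\<open>weak_gradient\<close>.
\<close>

definition sobolev_pair ::
  "nat \<Rightarrow> (nat \<Rightarrow> real) set \<Rightarrow> ((nat \<Rightarrow> real) \<Rightarrow> real) \<Rightarrow> (nat \<Rightarrow> (nat \<Rightarrow> real) \<Rightarrow> real) \<Rightarrow> bool" where
  "sobolev_pair N \<Omega> u G \<longleftrightarrow>
     u \<in> borel_measurable (LB N) \<and> (\<forall>i<N. G i \<in> borel_measurable (LB N)) \<and>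
     (\<forall>K\<subseteq>\<Omega>. compactin (Rn_top N) K \<longrightarrow> set_integrable (LB N) K (\<lambda>x. (u x)\<^sup>2) \<and>
        (\<forall>i<N. set_integrable (LB N) K (\<lambda>x. (G i x)\<^sup>2))) \<and>
     (\<forall>i<N. \<forall>\<psi>. test_function N \<Omega> \<psi> \<longrightarrow>
        (LINT x:\<Omega>|LB N. u x * partial_deriv i \<psi> x) = - (LINT x:\<Omega>|LB N. G i x * \<psi> x))"

lemma set_integrable_of_square:
  fixes f :: "'a \<Rightarrow> real"
  assumes [measurable]: "f \<in> borel_measurable M" "K \<in> sets M" and fin: "emeasure M K < \<infinity>"
    and sq: "set_integrable M K (\<lambda>x. (f x)\<^sup>2)"
  shows "set_integrable M K f"
proof -
  have "integrable M (\<lambda>x. indicator K x *\<^sub>R (f x)\<^sup>2 + (indicator K x :: real))"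
    using sq fin unfolding set_integrable_def by (intro Bochner_Integration.integrable_add) auto
  then show ?thesis unfolding set_integrable_def
  proof (rule Bochner_Integration.integrable_bound)
    have "\<bar>t\<bar> \<le> t\<^sup>2 + 1" for t :: real
      using sum_squares_bound[of "\<bar>t\<bar>" 1] power2_abs[of t] zero_le_power2[of t] by (simp only: power_one mult_1_right)
    then show "AE x in M. norm (indicator K x *\<^sub>R f x) \<le> norm (indicator K x *\<^sub>R (f x)\<^sup>2 + (indicator K x :: real))"
      by (auto simp: indicator_def)
  qed measurable
qed

lemma sobolev_pairD:
  assumes "sobolev_pair N \<Omega> u G"
  shows "u \<in> borel_measurable (LB N)" "\<And>i. i < N \<Longrightarrow> G i \<in> borel_measurable (LB N)"
    and "\<And>K. K \<subseteq> \<Omega> \<Longrightarrow> compactin (Rn_top N) K \<Longrightarrow> set_integrable (LB N) K (\<lambda>x. (u x)\<^sup>2)"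
    and "\<And>K i. K \<subseteq> \<Omega> \<Longrightarrow> compactin (Rn_top N) K \<Longrightarrow> i < N \<Longrightarrow> set_integrable (LB N) K (\<lambda>x. (G i x)\<^sup>2)"
    and "\<And>K. K \<subseteq> \<Omega> \<Longrightarrow> compactin (Rn_top N) K \<Longrightarrow> set_integrable (LB N) K u"
    and "\<And>K i. K \<subseteq> \<Omega> \<Longrightarrow> compactin (Rn_top N) K \<Longrightarrow> i < N \<Longrightarrow> set_integrable (LB N) K (G i)"
    and "\<And>i \<psi>. i < N \<Longrightarrow> test_function N \<Omega> \<psi> \<Longrightarrow>
        (LINT x:\<Omega>|LB N. u x * partial_deriv i \<psi> x) = - (LINT x:\<Omega>|LB N. G i x * \<psi> x)"
proof -
  show 1: "u \<in> borel_measurable (LB N)" using assms by (simp add: sobolev_pair_def)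
  show 2: "G i \<in> borel_measurable (LB N)" if "i < N" for i using assms that by (simp add: sobolev_pair_def)
  show 3: "set_integrable (LB N) K (\<lambda>x. (u x)\<^sup>2)" if "K \<subseteq> \<Omega>" "compactin (Rn_top N) K" for K
    using assms that by (simp add: sobolev_pair_def)
  show 4: "set_integrable (LB N) K (\<lambda>x. (G i x)\<^sup>2)" if "K \<subseteq> \<Omega>" "compactin (Rn_top N) K" "i < N" for K i
    using assms that by (simp add: sobolev_pair_def)
  show "set_integrable (LB N) K u" if "K \<subseteq> \<Omega>" "compactin (Rn_top N) K" for K
    by (rule set_integrable_of_square[OF 1 compactin_in_sets_LB[OF that(2)] emeasure_compactin_finite[OF that(2)] 3[OF that]])
  show "set_integrable (LB N) K (G i)" if "K \<subseteq> \<Omega>" "compactin (Rn_top N) K" "i < N" for K i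
    by (rule set_integrable_of_square[OF 2[OF that(3)] compactin_in_sets_LB[OF that(2)] emeasure_compactin_finite[OF that(2)] 4[OF that]])
  show "(LINT x:\<Omega>|LB N. u x * partial_deriv i \<psi> x) = - (LINT x:\<Omega>|LB N. G i x * \<psi> x)"
    if "i < N" "test_function N \<Omega> \<psi>" for i \<psi>
    using assms that by (simp add: sobolev_pair_def)
qed

text \<open>
  The translate by \<open>s h\<close> lies on the segment from \<open>x\<close> to \<open>x + h\<close>.
\<close>

lemma Rn_convex_shift:
  assumes "Rn_convex N \<Omega>" "x \<in> \<Omega>" "lc N 1 x 1 h \<in> \<Omega>" "s \<in> {0..1}"
  shows "lc N 1 x s h \<in> \<Omega>"
proof -
  have "Rn_segment_point N s x (lc N 1 x 1 h) = lc N 1 x s h"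
    unfolding segment_point_eq_lc by (rule Rn_eqI[of _ N]) (auto simp: algebra_simps)
  moreover have "Rn_segment_point N s x (lc N 1 x 1 h) \<in> \<Omega>" using assms unfolding Rn_convex_def by fast
  ultimately show ?thesis by simp
qed

lemma openin_shift_domain:
  assumes \<Omega>: "openin (Rn_top N) \<Omega>"
  shows "openin (Rn_top N) {x \<in> \<Omega>. lc N 1 x b h \<in> \<Omega>}"
  unfolding openin_Rn_iff
proof (intro conjI ballI)
  show "{x \<in> \<Omega>. lc N 1 x b h \<in> \<Omega>} \<subseteq> Rn N" using \<Omega> unfolding openin_Rn_iff by fast
  fix x assume x: "x \<in> {x \<in> \<Omega>. lc N 1 x b h \<in> \<Omega>}"
  then have x\<Omega>: "x \<in> \<Omega>" "lc N 1 x b h \<in> \<Omega>" by auto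
  obtain r where r: "r > 0" "\<And>y. y \<in> Rn N \<Longrightarrow> (\<And>i. i < N \<Longrightarrow> \<bar>y i - x i\<bar> \<le> r) \<Longrightarrow> y \<in> \<Omega>"
    using openin_Rn_nbhd[OF \<Omega> x\<Omega>(1)] by blast
  obtain q where q: "q > 0" "\<And>y. y \<in> Rn N \<Longrightarrow> (\<And>i. i < N \<Longrightarrow> \<bar>y i - lc N 1 x b h i\<bar> \<le> q) \<Longrightarrow> y \<in> \<Omega>"
    using openin_Rn_nbhd[OF \<Omega> x\<Omega>(2)] by blast
  show "\<exists>e>0. \<forall>y\<in>Rn N. (\<forall>i<N. \<bar>y i - x i\<bar> \<le> e) \<longrightarrow> y \<in> {x \<in> \<Omega>. lc N 1 x b h \<in> \<Omega>}"
  proof (intro exI[of _ "min r q"] conjI ballI impI)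
    fix y assume y: "y \<in> Rn N" "\<forall>i<N. \<bar>y i - x i\<bar> \<le> min r q"
    have "y \<in> \<Omega>" using y by (intro r(2)) auto
    moreover have "lc N 1 y b h \<in> \<Omega>" using y by (intro q(2)) auto
    ultimately show "y \<in> {x \<in> \<Omega>. lc N 1 x b h \<in> \<Omega>}" by simp
  qed (use r q in auto)
qed

lemma integrable_bounded_mult:
  fixes H :: "_ \<Rightarrow> real"
  assumes H: "integrable (LB N) H" and [measurable]: "\<zeta> \<in> borel_measurable (LB N)"
    and B: "\<And>x. x \<in> Rn N \<Longrightarrow> \<bar>\<zeta> x\<bar> \<le> B"
  shows "integrable (LB N) (\<lambda>x. \<zeta> x * H x)"
proof -
  have [measurable]: "H \<in> borel_measurable (LB N)" using H by simp
  have "integrable (LB N) (\<lambda>x. B * H x)" using H by simp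
  then show ?thesis
    by (rule Bochner_Integration.integrable_bound)
      (auto simp: abs_mult intro!: mult_right_mono order_trans[OF B] AE_I2)
qed

lemma continuous_on_line:
  assumes "continuous_map (Rn_top N) euclideanreal f"
  shows "continuous_on UNIV (\<lambda>s. f (lc N 1 x s h))"
proof -
  have "continuous_map euclideanreal (Rn_top N) (\<lambda>s. lc N 1 x s h)"
    unfolding Rn_top_def continuous_map_componentwise
    by (auto simp: lc_def intro!: continuous_intros)
  from continuous_map_compose[OF this assms] show ?thesis by (simp add: comp_def)
qed

lemma sweep_mem: "x \<in> K \<Longrightarrow> s \<in> {0..1} \<Longrightarrow> lc N 1 x s h \<in> (\<lambda>(x, s). lc N 1 x s h) ` (K \<times> {0..1})"
  by (rule image_eqI[of _ _ "(x, s)"]) auto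

lemma sweep_self:
  assumes "x \<in> K" "K \<subseteq> Rn N"
  shows "x \<in> (\<lambda>(x, s). lc N 1 x s h) ` (K \<times> {0..1})"
proof -
  have "lc N 1 x 0 h = x" using assms by (intro Rn_eqI) auto
  then show ?thesis using sweep_mem[OF assms(1), of 0] by (metis atLeastAtMost_iff order_refl zero_le_one)
qed

text \<open>
  Both sides are tested against a product bump \<open>\<psi>\<close> that is supported where \<open>x\<close> and \<open>x + h\<close> are in \<open>\<Omega>\<close>.
  Translation moves the increment of \<open>u\<close> to \<open>\<psi>\<close>, where the classical theorem applies; the
  derivative of \<open>\<psi>\<close> is exchanged for \<open>G\<close> by the definition of the weak gradient, and the translation is
  moved back. The fundamental lemma turns the equality of integrals into equality almost
  everywhere.
\<close>

lemma sobolev_FTC: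
  assumes \<Omega>: "openin (Rn_top N) \<Omega>" and conv: "Rn_convex N \<Omega>" and P: "sobolev_pair N \<Omega> u G"
  shows "AE x in LB N. x \<in> \<Omega> \<longrightarrow> lc N 1 x 1 h \<in> \<Omega> \<longrightarrow>
    u (lc N 1 x 1 h) - u x = (LINT s|U01. (\<Sum>i<N. h i * G i (lc N 1 x s h)))"
proof -
  define \<Omega>h where "\<Omega>h = {x \<in> \<Omega>. lc N 1 x 1 h \<in> \<Omega>}"
  define g where "g x = (LINT s|U01. (\<Sum>i<N. h i * G i (lc N 1 x s h))) - u (lc N 1 x 1 h) + u x" for x
  have um [measurable]: "u \<in> borel_measurable (LB N)" and Gm: "\<And>i. i < N \<Longrightarrow> G i \<in> borel_measurable (LB N)"
    using sobolev_pairD[OF P] by auto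
  have Gs [measurable]: "(\<lambda>x. \<Sum>i<N. h i * G i x) \<in> borel_measurable (LB N)"
    using Gm by (intro borel_measurable_sum) auto
  have gm: "g \<in> borel_measurable (LB N)"
  proof -
    have "(\<lambda>p. \<Sum>i<N. h i * G i (lc N 1 (fst p) (snd p) h)) \<in> borel_measurable (LB N \<Otimes>\<^sub>M U01)"
      by (rule measurable_compose[OF measurable_shift_U01(1) Gs])
    then have "(\<lambda>x. LINT s|U01. (\<Sum>i<N. h i * G i (lc N 1 x s h))) \<in> borel_measurable (LB N)"
      by (intro U01.borel_measurable_lebesgue_integral) (simp add: split_beta')
    then show ?thesis unfolding g_def[abs_def] by measurable
  qed
  define S where "S K = (\<lambda>(x, s). lc N 1 x s h) ` (K \<times> {0..1})" for K
  have S: "S K \<subseteq> \<Omega>" "compactin (Rn_top N) (S K)" "S K \<in> sets (LB N)"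
    if "compactin (Rn_top N) K" "K \<subseteq> \<Omega>h" for K
  proof -
    show "S K \<subseteq> \<Omega>" using that(2) Rn_convex_shift[OF conv] unfolding S_def \<Omega>h_def by auto
    show "compactin (Rn_top N) (S K)" unfolding S_def by (rule compactin_sweep[OF that(1)])
    then show "S K \<in> sets (LB N)" by (rule compactin_in_sets_LB)
  qed
  \<comment> \<open>Cut off to the swept region, the functions are integrable, and nothing changes for starting points in \<open>K\<close>.\<close>
  define H where "H K x = indicator (S K) x * (\<Sum>i<N. h i * G i x)" for K x
  define U where "U K x = indicator (S K) x * u x" for K x
  have HU: "integrable (LB N) (H K)" "integrable (LB N) (U K)"
    and iG: "\<And>i. i < N \<Longrightarrow> integrable (LB N) (\<lambda>x. indicator (S K) x * G i x)"
    if "compactin (Rn_top N) K" "K \<subseteq> \<Omega>h" for K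
  proof -
    show 1: "integrable (LB N) (\<lambda>x. indicator (S K) x * G i x)" if "i < N" for i
      using sobolev_pairD(6)[OF P S(1,2)[OF \<open>compactin (Rn_top N) K\<close> \<open>K \<subseteq> \<Omega>h\<close>] that] by (simp add: set_integrable_def)
    have "integrable (LB N) (\<lambda>x. \<Sum>i<N. h i * (indicator (S K) x * G i x))"
      by (intro Bochner_Integration.integrable_sum Bochner_Integration.integrable_mult_right 1) auto
    then show "integrable (LB N) (H K)" unfolding H_def by (simp add: sum_distrib_left mult_ac)
    show "integrable (LB N) (U K)" unfolding U_def
      using sobolev_pairD(5)[OF P S(1,2)[OF that]] by (simp add: set_integrable_def)
  qed
  have g_on: "g x = (LINT s|U01. H K (lc N 1 x s h)) - U K (lc N 1 x 1 h) + U K x"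
    if "x \<in> K" "K \<subseteq> Rn N" for x K
  proof -
    have "(LINT s|U01. H K (lc N 1 x s h)) = (LINT s|U01. (\<Sum>i<N. h i * G i (lc N 1 x s h)))"
      using sweep_mem[OF that(1)] by (intro Bochner_Integration.integral_cong refl) (auto simp: H_def S_def)
    moreover have "U K (lc N 1 x 1 h) = u (lc N 1 x 1 h)" using sweep_mem[OF that(1), of 1] by (simp add: U_def S_def)
    moreover have "U K x = u x" using sweep_self[OF that] by (simp add: U_def S_def)
    ultimately show ?thesis by (simp add: g_def)
  qed
  have "AE x in LB N. x \<in> \<Omega>h \<longrightarrow> g x = 0"
  proof (rule fundamental_lemma)
    show "openin (Rn_top N) \<Omega>h" unfolding \<Omega>h_def by (rule openin_shift_domain[OF \<Omega>])
    show "g \<in> borel_measurable (LB N)" by (rule gm)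
    fix K assume K: "compactin (Rn_top N) K" "K \<subseteq> \<Omega>h"
    have KR: "K \<subseteq> Rn N" using compactin_subset_topspace[OF K(1)] by simp
    have "integrable (LB N) (\<lambda>x. indicator K x *\<^sub>R ((LINT s|U01. H K (lc N 1 x s h)) - U K (lc N 1 x 1 h) + U K x))"
      using HU[OF K] compactin_in_sets_LB[OF K(1)]
      by (intro integrable_mult_indicator Bochner_Integration.integrable_add Bochner_Integration.integrable_diff
          integrable_segment_average integrable_shift)
    also have "(\<lambda>x. indicator K x *\<^sub>R ((LINT s|U01. H K (lc N 1 x s h)) - U K (lc N 1 x 1 h) + U K x)) = (\<lambda>x. indicator K x *\<^sub>R g x)"
      using g_on[OF _ KR] by (auto simp: indicator_def)
    finally show "set_integrable (LB N) K g" unfolding set_integrable_def .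
  next
    fix f a b
    assume sm: "\<And>i k. i < N \<Longrightarrow> smooth_upto k (f i)"
      and supp: "\<And>i t. i < N \<Longrightarrow> t \<notin> {a i..b i} \<Longrightarrow> f i t = 0" and Q: "closed_box N a b \<subseteq> \<Omega>h"
    define K where "K = closed_box N a b"
    define \<psi> where "\<psi> = prod_fun N f"
    have K: "compactin (Rn_top N) K" "K \<subseteq> \<Omega>h" using Q compactin_closed_box by (auto simp: K_def)
    have KR: "K \<subseteq> Rn N" using compactin_subset_topspace[OF K(1)] by simp
    have df: "f i differentiable at t" if "i < N" for i t using sm[OF that, of "Suc 0"] by simp
    have test: "test_function N \<Omega> \<psi>" unfolding \<psi>_def
      by (rule test_function_prod_fun[OF sm supp]) (use Q in \<open>auto simp: \<Omega>h_def\<close>)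
    note [measurable] = test_function_measurable[OF test]
    obtain B where B: "\<And>x. x \<in> Rn N \<Longrightarrow> \<bar>\<psi> x\<bar> \<le> B" using test_function_bounded[OF test] by blast
    have \<psi>0: "\<psi> x = 0" if "x \<in> Rn N - K" for x
      unfolding \<psi>_def using supp that[unfolded K_def] by (rule prod_fun_vanishes)
    define D where "D x = (\<Sum>i<N. h i * partial_deriv i \<psi> x)" for x
    have Dcont: "continuous_map (Rn_top N) euclideanreal D" unfolding D_def
      by (intro continuous_map_sum continuous_map_real_mult test_function_continuous[OF test_function_partial_deriv[OF test]]) auto
    have [measurable]: "D \<in> borel_measurable (LB N)" by (rule continuous_map_borel_LB[OF Dcont])
    have "\<exists>C. \<forall>x\<in>Rn N. \<bar>partial_deriv i \<psi> x\<bar> \<le> C" if "i < N" for i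
      by (rule test_function_bounded[OF test_function_partial_deriv[OF test that]])
    then obtain C where C: "\<And>i x. i < N \<Longrightarrow> x \<in> Rn N \<Longrightarrow> \<bar>partial_deriv i \<psi> x\<bar> \<le> C i" by metis
    have DB: "\<bar>D x\<bar> \<le> (\<Sum>i<N. \<bar>h i\<bar> * C i)" if "x \<in> Rn N" for x
      unfolding D_def using C[OF _ that]
      by (intro order_trans[OF sum_abs] sum_mono) (auto simp: abs_mult intro!: mult_left_mono)
    \<comment> \<open>The classical fundamental theorem for \<open>\<psi>\<close> on the segment from \<open>x\<close> to \<open>x - h\<close>.\<close>
    have line: "\<psi> (lc N 1 x (- 1) h) - \<psi> x = - (LINT s|U01. D (lc N 1 x (- s) h))" if "x \<in> Rn N" for x
    proof -
      have lcm: "lc N 1 x s (\<lambda>i. - h i) = lc N 1 x (- s) h" for s by (rule Rn_eqI[of _ N]) auto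
      have "((\<lambda>s. \<psi> (lc N 1 x (- s) h)) has_real_derivative - D (lc N 1 x (- s) h)) (at s)" for s
        using prod_fun_line_has_derivative[where N = N and f = f and x = x and h = "\<lambda>i. - h i" and s = s, OF df]
        unfolding lcm by (simp add: D_def \<psi>_def sum_negf)
      moreover have "continuous_on UNIV (\<lambda>s. - D (lc N 1 x (- s) h))"
        using continuous_on_line[OF Dcont, of x "\<lambda>i. - h i"] unfolding lcm by (intro continuous_intros)
      ultimately have "(LINT s|U01. - D (lc N 1 x (- s) h)) = \<psi> (lc N 1 x (- 1) h) - \<psi> (lc N 1 x (- 0) h)"
        by (rule integral_U01_FTC)
      moreover have "lc N 1 x (- 0) h = x" using that by (intro Rn_eqI) auto
      ultimately show ?thesis by simp
    qed
    \<comment> \<open>The translated bump is again a test function in \<open>\<Omega>\<close>, since its support stays in the swept region.\<close>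
    have weak: "(LINT x|LB N. D (lc N 1 x (- s) h) * U K x) = - (LINT x|LB N. \<psi> (lc N 1 x (- s) h) * H K x)"
      if s: "s \<in> {0..1}" for s
    proof -
      define fs where "fs i t = f i (1 * t + - s * h i)" for i t
      define as where "as i = a i + s * h i" for i
      define bs where "bs i = b i + s * h i" for i
      have sms: "smooth_upto k (fs i)" if "i < N" for i k
        unfolding fs_def[abs_def] by (rule smooth_upto_affine[OF sm[OF that]])
      have supps: "fs i t = 0" if "i < N" "t \<notin> {as i..bs i}" for i t
        unfolding fs_def by (rule supp[OF that(1)]) (use that(2) in \<open>auto simp: as_def bs_def\<close>)
      have boxS: "closed_box N as bs \<subseteq> S K"
      proof
        fix y assume y: "y \<in> closed_box N as bs"
        have "lc N 1 y (- s) h i \<in> {a i..b i}" if "i < N" for i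
          using y that by (auto simp: mem_closed_box as_def bs_def dest!: spec[of _ i])
        then have "lc N 1 y (- s) h \<in> K" unfolding K_def mem_closed_box by auto
        from sweep_mem[OF this s, of N h] show "y \<in> S K" using y lc_shift_cancel(2)[of y N s h]
          unfolding S_def by (simp add: mem_closed_box)
      qed
      have tests: "test_function N \<Omega> (prod_fun N fs)"
        by (rule test_function_prod_fun[OF sms supps]) (use boxS S(1)[OF K] in auto)
      have e1: "prod_fun N fs x = \<psi> (lc N 1 x (- s) h)" for x
        unfolding \<psi>_def prod_fun_def fs_def by (intro prod.cong) auto
      have dfs: "fs i differentiable at t" if "i < N" for i t using sms[OF that, of "Suc 0"] by simp
      have der: "deriv (fs i) t = deriv (f i) (1 * t + - s * h i)" if "i < N" for i t
      proof -
        have "((\<lambda>t. f i (1 * t + - s * h i)) has_real_derivative deriv (f i) (1 * t + - s * h i) * 1) (at t)"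
          by (intro DERIV_chain2[where f = "f i"] differentiable_has_deriv df that) (auto intro!: derivative_eq_intros)
        then show ?thesis unfolding fs_def[abs_def] by (simp add: DERIV_imp_deriv)
      qed
      have e2: "partial_deriv i (prod_fun N fs) x = partial_deriv i \<psi> (lc N 1 x (- s) h)" if "i < N" for i x
        unfolding \<psi>_def partial_deriv_prod_fun[where f = fs, OF that dfs[OF that]] partial_deriv_prod_fun[where f = f, OF that df[OF that]]
        unfolding prod_fun_def using der[OF that] by (intro prod.cong) (auto simp: fs_def)
      have v1: "prod_fun N fs x = 0" if "x \<in> Rn N - closed_box N as bs" for x
        using supps that by (rule prod_fun_vanishes)
      have v2: "partial_deriv i (prod_fun N fs) x = 0" if "i < N" "x \<in> Rn N - closed_box N as bs" for i x
        by (rule partial_deriv_vanishes[OF that(1) compactin_closed_box v1 that(2)])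
      have one: "(LINT x|LB N. partial_deriv i \<psi> (lc N 1 x (- s) h) * U K x) =
          - (LINT x|LB N. \<psi> (lc N 1 x (- s) h) * (indicator (S K) x * G i x))" if i: "i < N" for i
      proof -
        have "(LINT x|LB N. partial_deriv i \<psi> (lc N 1 x (- s) h) * U K x) = (LINT x:\<Omega>|LB N. u x * partial_deriv i (prod_fun N fs) x)"
          unfolding set_lebesgue_integral_def e2[OF i, symmetric]
        proof (rule Bochner_Integration.integral_cong[OF refl])
          fix x assume x: "x \<in> space (LB N)"
          show "partial_deriv i (prod_fun N fs) x * U K x = indicator \<Omega> x *\<^sub>R (u x * partial_deriv i (prod_fun N fs) x)"
          proof (cases "x \<in> S K")
            case True
            then show ?thesis using S(1)[OF K] by (auto simp: U_def)
          next
            case False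
            then have "x \<in> Rn N - closed_box N as bs" using x boxS by auto
            then show ?thesis using v2[OF i] by simp
          qed
        qed
        also have "\<dots> = - (LINT x:\<Omega>|LB N. G i x * prod_fun N fs x)" by (rule sobolev_pairD(7)[OF P i tests])
        also have "(LINT x:\<Omega>|LB N. G i x * prod_fun N fs x) = (LINT x|LB N. \<psi> (lc N 1 x (- s) h) * (indicator (S K) x * G i x))"
          unfolding set_lebesgue_integral_def e1[symmetric]
        proof (rule Bochner_Integration.integral_cong[OF refl])
          fix x assume x: "x \<in> space (LB N)"
          show "indicator \<Omega> x *\<^sub>R (G i x * prod_fun N fs x) = prod_fun N fs x * (indicator (S K) x * G i x)"
          proof (cases "x \<in> S K")
            case True
            then show ?thesis using S(1)[OF K] by auto
          next
            case False
            then have "x \<in> Rn N - closed_box N as bs" using x boxS by auto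
            then show ?thesis using v1 by simp
          qed
        qed
        finally show ?thesis .
      qed
      have im: "(\<lambda>x. partial_deriv i \<psi> (lc N 1 x (- s) h)) \<in> borel_measurable (LB N)" if "i < N" for i
        using test_function_measurable[OF test_function_partial_deriv[OF test that]] by measurable
      have i1: "integrable (LB N) (\<lambda>x. partial_deriv i \<psi> (lc N 1 x (- s) h) * U K x)" if "i < N" for i
        by (rule integrable_bounded_mult[OF HU(2)[OF K] im[OF that], of "C i"]) (use C[OF that] in auto)
      have i2: "integrable (LB N) (\<lambda>x. \<psi> (lc N 1 x (- s) h) * (indicator (S K) x * G i x))" if "i < N" for i
        by (rule integrable_bounded_mult[OF iG[OF K that], of _ B]) (use B in auto)
      have "(LINT x|LB N. D (lc N 1 x (- s) h) * U K x) = (LINT x|LB N. (\<Sum>i<N. h i * (partial_deriv i \<psi> (lc N 1 x (- s) h) * U K x)))"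
        unfolding D_def by (simp add: sum_distrib_left mult_ac)
      also have "\<dots> = (\<Sum>i<N. h i * (LINT x|LB N. partial_deriv i \<psi> (lc N 1 x (- s) h) * U K x))"
        using i1 by (subst Bochner_Integration.integral_sum) auto
      also have "\<dots> = - (\<Sum>i<N. h i * (LINT x|LB N. \<psi> (lc N 1 x (- s) h) * (indicator (S K) x * G i x)))"
        using one by (simp add: sum_negf)
      also have "(\<Sum>i<N. h i * (LINT x|LB N. \<psi> (lc N 1 x (- s) h) * (indicator (S K) x * G i x))) =
          (LINT x|LB N. (\<Sum>i<N. h i * (\<psi> (lc N 1 x (- s) h) * (indicator (S K) x * G i x))))"
        using i2 by (subst Bochner_Integration.integral_sum) auto
      also have "\<dots> = (LINT x|LB N. \<psi> (lc N 1 x (- s) h) * H K x)"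
        unfolding H_def by (simp add: sum_distrib_left mult_ac)
      finally show ?thesis .
    qed
    have bil: "integrable (LB N) (\<lambda>x. \<psi> x * U K x)" "integrable (LB N) (\<lambda>x. \<psi> x * U K (lc N 1 x 1 h))"
      "integrable (LB N) (\<lambda>x. \<psi> (lc N 1 x (- 1) h) * U K x)"
      by (rule integrable_bounded_mult[of _ _ _ B], use HU[OF K] B in \<open>auto intro: integrable_shift\<close>)+
    have "(LINT x|LB N. g x * \<psi> x) =
      (LINT x|LB N. \<psi> x * (LINT s|U01. H K (lc N 1 x s h)) - \<psi> x * U K (lc N 1 x 1 h) + \<psi> x * U K x)"
    proof (rule Bochner_Integration.integral_cong[OF refl])
      fix x assume "x \<in> space (LB N)"
      then show "g x * \<psi> x = \<psi> x * (LINT s|U01. H K (lc N 1 x s h)) - \<psi> x * U K (lc N 1 x 1 h) + \<psi> x * U K x"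
        by (cases "x \<in> K") (simp_all add: g_on[OF _ KR] \<psi>0 distrib_left right_diff_distrib mult.commute)
    qed
    also have "\<dots> = (LINT x|LB N. \<psi> x * (LINT s|U01. H K (lc N 1 x s h))) -
        (LINT x|LB N. \<psi> x * U K (lc N 1 x 1 h)) + (LINT x|LB N. \<psi> x * U K x)"
      using integral_segment_average(1)[OF HU(1)[OF K], of \<psi> B h] B bil by simp
    also have "(LINT x|LB N. \<psi> x * U K (lc N 1 x 1 h)) = (LINT x|LB N. \<psi> (lc N 1 x (- 1) h) * U K x)"
    proof -
      have [measurable]: "U K \<in> borel_measurable (LB N)" using HU(2)[OF K] by simp
      have "(LINT x|LB N. \<psi> (lc N 1 x (- 1) h) * U K x) =
        (LINT x|LB N. \<psi> (lc N 1 (lc N 1 x 1 h) (- 1) h) * U K (lc N 1 x 1 h))"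
        by (rule integral_shift[symmetric]) measurable
      also have "\<dots> = (LINT x|LB N. \<psi> x * U K (lc N 1 x 1 h))"
        by (rule Bochner_Integration.integral_cong[OF refl]) (simp add: lc_shift_cancel)
      finally show ?thesis by simp
    qed
    also have "(LINT x|LB N. \<psi> x * (LINT s|U01. H K (lc N 1 x s h))) -
        (LINT x|LB N. \<psi> (lc N 1 x (- 1) h) * U K x) + (LINT x|LB N. \<psi> x * U K x) =
        (LINT s|U01. LINT x|LB N. \<psi> (lc N 1 x (- s) h) * H K x) -
        (LINT x|LB N. (\<psi> (lc N 1 x (- 1) h) - \<psi> x) * U K x)"
      using integral_segment_average(2)[OF HU(1)[OF K], of \<psi> B h] B bil by (simp add: left_diff_distrib)
    also have "(LINT x|LB N. (\<psi> (lc N 1 x (- 1) h) - \<psi> x) * U K x) =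
        (LINT x|LB N. - (LINT s|U01. D (lc N 1 x (- s) h) * U K x))"
      by (rule Bochner_Integration.integral_cong[OF refl]) (simp add: line)
    also have "\<dots> = - (LINT s|U01. LINT x|LB N. D (lc N 1 x (- s) h) * U K x)"
    proof -
      have W: "(\<lambda>p. D (lc N 1 (fst p) (- snd p) h)) \<in> borel_measurable (LB N \<Otimes>\<^sub>M U01)" by measurable
      have "integrable (LB N \<Otimes>\<^sub>M U01) (\<lambda>(x, s). D (lc N 1 x (- s) h) * U K x)"
        using integrable_pair_shift(2)[OF HU(2)[OF K] W, of "\<Sum>i<N. \<bar>h i\<bar> * C i"] DB by simp
      from LBU.Fubini_integral[OF this] show ?thesis by simp
    qed
    also have "(LINT s|U01. LINT x|LB N. D (lc N 1 x (- s) h) * U K x) =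
        (LINT s|U01. - (LINT x|LB N. \<psi> (lc N 1 x (- s) h) * H K x))"
      by (rule Bochner_Integration.integral_cong[OF refl]) (simp add: weak)
    finally show "(LINT x|LB N. g x * prod_fun N f x) = 0" by (simp add: \<psi>_def)
  qed
  then show ?thesis by eventually_elim (auto simp: \<Omega>h_def g_def)
qed

section \<open>The chain rule for weak gradients\<close>

definition unit_dir :: "nat \<Rightarrow> nat \<Rightarrow> real" where
  "unit_dir i = (\<lambda>j. if j = i then 1 else 0)"

lemma lc_unit_dir:
  assumes "x \<in> Rn N" "i < N"
  shows "lc N 1 x t (unit_dir i) = x(i := x i + t)"
proof (rule Rn_eqI[of _ N])
  show "x(i := x i + t) \<in> Rn N" using assms by (auto simp: Rn_def PiE_iff extensional_def)
qed (auto simp: unit_dir_def)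

lemma sobolev_FTC_coordinate:
  assumes \<Omega>: "openin (Rn_top N) \<Omega>" and conv: "Rn_convex N \<Omega>" and P: "sobolev_pair N \<Omega> u G" and i: "i < N"
  shows "AE x in LB N. x \<in> \<Omega> \<longrightarrow> lc N 1 x t (unit_dir i) \<in> \<Omega> \<longrightarrow>
    u (lc N 1 x t (unit_dir i)) - u x = t * (LINT s|U01. G i (lc N 1 x (s * t) (unit_dir i)))"
proof -
  define h where "h = (\<lambda>j. t * unit_dir i j)"
  have l: "lc N 1 x s h = lc N 1 x (s * t) (unit_dir i)" for x s
    by (rule Rn_eqI[of _ N]) (auto simp: h_def)
  have "(\<Sum>j<N. h j * G j y) = t * G i y" for y
  proof -
    have "(\<Sum>j<N. h j * G j y) = (\<Sum>j<N. if j = i then t * G j y else 0)"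
      by (intro sum.cong) (auto simp: h_def unit_dir_def)
    then show ?thesis using i by simp
  qed
  then show ?thesis using sobolev_FTC[OF \<Omega> conv P, of h] by (simp add: l)
qed

lemma square_mean_le:
  fixes f :: "real \<Rightarrow> real"
  assumes "integrable U01 (\<lambda>s. (f s)\<^sup>2)" "f \<in> borel_measurable U01"
  shows "(LINT s|U01. f s)\<^sup>2 \<le> (LINT s|U01. (f s)\<^sup>2)"
proof -
  have "integrable U01 f" using U01.square_integrable_imp_integrable assms by auto
  then have "U01.variance f = U01.expectation (\<lambda>s. (f s)\<^sup>2) - (U01.expectation f)\<^sup>2"
    using assms by (intro U01.variance_eq) auto
  then show ?thesis using U01.variance_positive[of f] by simp
qed

text \<open>
  The square of the mean of \<open>G i\<close> along a segment is at most the mean of the square, and averaging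
  over the starting points removes the shift.
\<close>

lemma difference_quotient_bound:
  assumes \<Omega>: "openin (Rn_top N) \<Omega>" and conv: "Rn_convex N \<Omega>" and P: "sobolev_pair N \<Omega> u G" and i: "i < N"
    and K: "compactin (Rn_top N) K" "K \<subseteq> \<Omega>" and L: "compactin (Rn_top N) L" "L \<subseteq> \<Omega>"
    and KL: "\<And>x s. x \<in> K \<Longrightarrow> s \<in> {0..1} \<Longrightarrow> lc N 1 x (s * t) (unit_dir i) \<in> L"
  shows "integrable (LB N) (\<lambda>x. indicator K x * (u (lc N 1 x t (unit_dir i)) - u x)\<^sup>2)" (is "integrable _ ?f")
    and "(LINT x|LB N. indicator K x * (u (lc N 1 x t (unit_dir i)) - u x)\<^sup>2)
      \<le> t\<^sup>2 * (LINT x|LB N. indicator L x * (G i x)\<^sup>2)"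
proof -
  define h where "h = (\<lambda>j. t * unit_dir i j)"
  have l: "lc N 1 x s h = lc N 1 x (s * t) (unit_dir i)" for x s
    by (rule Rn_eqI[of _ N]) (auto simp: h_def)
  have [measurable]: "u \<in> borel_measurable (LB N)" "G i \<in> borel_measurable (LB N)" "K \<in> sets (LB N)" "L \<in> sets (LB N)"
    using sobolev_pairD(1,2)[OF P] i K L compactin_in_sets_LB by auto
  define g2 where "g2 x = indicator L x * (G i x)\<^sup>2" for x
  have g2: "integrable (LB N) g2"
    using sobolev_pairD(4)[OF P L(2,1) i] by (simp add: set_integrable_def g2_def[abs_def])
  have int: "integrable (LB N \<Otimes>\<^sub>M U01) (\<lambda>(x, s). g2 (lc N 1 x s h))"
    using integrable_pair_shift(1)[OF g2, of "\<lambda>_. 1" 1 h] by simp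
  have "AE x in LB N. integrable U01 (\<lambda>s. g2 (lc N 1 x s h))"
    using LBU.AE_integrable_fst[OF int] by simp
  then have "AE x in LB N. ?f x \<le> t\<^sup>2 * (LINT s|U01. g2 (lc N 1 x s h))"
    using sobolev_FTC_coordinate[OF \<Omega> conv P i, of t] AE_space
  proof eventually_elim
    case (elim x)
    have nn: "0 \<le> (LINT s|U01. g2 (lc N 1 x s h))" by (rule Bochner_Integration.integral_nonneg) (simp add: g2_def)
    show ?case
    proof (cases "x \<in> K")
      case True
      have g: "g2 (lc N 1 x s h) = (G i (lc N 1 x (s * t) (unit_dir i)))\<^sup>2" if "s \<in> {0..1}" for s
        using KL[OF True that] by (simp add: g2_def l)
      have "x \<in> \<Omega>" "lc N 1 x t (unit_dir i) \<in> \<Omega>" using True K L KL[OF True, of 1] by auto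
      then have "?f x = t\<^sup>2 * (LINT s|U01. G i (lc N 1 x (s * t) (unit_dir i)))\<^sup>2"
        using elim True by (simp add: power_mult_distrib)
      also have "(LINT s|U01. G i (lc N 1 x (s * t) (unit_dir i)))\<^sup>2 \<le> (LINT s|U01. (G i (lc N 1 x (s * t) (unit_dir i)))\<^sup>2)"
      proof (rule square_mean_le)
        show "integrable U01 (\<lambda>s. (G i (lc N 1 x (s * t) (unit_dir i)))\<^sup>2)"
          using elim(1) by (rule Bochner_Integration.integrable_cong[THEN iffD1, rotated 2]) (auto simp: g)
        show "(\<lambda>s. G i (lc N 1 x (s * t) (unit_dir i))) \<in> borel_measurable U01"
          using elim(3) by measurable
      qed
      also have "(LINT s|U01. (G i (lc N 1 x (s * t) (unit_dir i)))\<^sup>2) = (LINT s|U01. g2 (lc N 1 x s h))"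
        by (rule Bochner_Integration.integral_cong[OF refl]) (simp add: g)
      finally show ?thesis by (simp add: mult_left_mono)
    qed (use nn in simp)
  qed
  note ae = this
  have avg: "integrable (LB N) (\<lambda>x. t\<^sup>2 * (LINT s|U01. g2 (lc N 1 x s h)))"
    using integrable_segment_average[OF g2] by simp
  show int_f: "integrable (LB N) ?f"
    by (rule Bochner_Integration.integrable_bound[OF avg])
       (use ae in \<open>auto elim!: eventually_mono intro: order_trans\<close>)
  have "(LINT x|LB N. ?f x) \<le> (LINT x|LB N. t\<^sup>2 * (LINT s|U01. g2 (lc N 1 x s h)))"
    by (rule integral_mono_AE[OF int_f avg ae])
  also have "\<dots> = t\<^sup>2 * (LINT s|U01. LINT x|LB N. g2 x)"
    using integral_segment_average(2)[OF g2, of "\<lambda>_. 1" 1 h] by simp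
  also have "\<dots> = t\<^sup>2 * (LINT x|LB N. g2 x)" using U01.prob_space by simp
  finally show "(LINT x|LB N. ?f x) \<le> t\<^sup>2 * (LINT x|LB N. indicator L x * (G i x)\<^sup>2)" by (simp add: g2_def)
qed

lemma test_function_lipschitz:
  assumes \<eta>: "test_function N \<Omega> \<eta>" and i: "i < N" and x: "x \<in> Rn N"
    and C: "\<And>y. y \<in> Rn N \<Longrightarrow> \<bar>partial_deriv i \<eta> y\<bar> \<le> C"
  shows "\<bar>\<eta> (lc N 1 x t (unit_dir i)) - \<eta> x\<bar> \<le> C * \<bar>t\<bar>"
proof -
  have upd: "x(i := s) \<in> Rn N" for s using x i by (auto simp: Rn_def PiE_iff extensional_def)
  have d: "((\<lambda>s. \<eta> (x(i := s))) has_real_derivative partial_deriv i \<eta> (x(i := s))) (at s)" for s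
    using test_function_has_partial[OF \<eta> i upd[of s]] by simp
  have "norm ((\<lambda>s. \<eta> (x(i := s))) (x i + t) - (\<lambda>s. \<eta> (x(i := s))) (x i)) \<le> C * norm (x i + t - x i)"
  proof (rule field_differentiable_bound[where S = UNIV and f' = "\<lambda>s. partial_deriv i \<eta> (x(i := s))"])
    show "((\<lambda>s. \<eta> (x(i := s))) has_real_derivative partial_deriv i \<eta> (x(i := z))) (at z)" for z by (rule d)
    show "norm (partial_deriv i \<eta> (x(i := z))) \<le> C" for z using C[OF upd] by simp
  qed auto
  then show ?thesis using x i by (simp add: lc_unit_dir)
qed

text \<open>
  A difference quotient is moved from \<open>f\<close> to the test function, where it converges to the
  classical derivative. Hence the first-order behaviour of the increments of \<open>f\<close>, tested against \<open>\<eta>\<close>,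
  determines the distributional derivative.
\<close>

lemma weak_partial_of_difference_quotients:
  assumes \<Omega>: "openin (Rn_top N) \<Omega>" and \<eta>: "test_function N \<Omega> \<eta>" and i: "i < N"
    and [measurable]: "f \<in> borel_measurable (LB N)"
    and loc: "\<And>K. K \<subseteq> \<Omega> \<Longrightarrow> compactin (Rn_top N) K \<Longrightarrow> set_integrable (LB N) K f"
    and q: "0 < q"
    and quot: "\<And>t. 0 < t \<Longrightarrow> t \<le> q \<Longrightarrow>
      \<bar>(LINT x|LB N. \<eta> x * (f (lc N 1 x t (unit_dir i)) - f x)) - t * J\<bar> \<le> t\<^sup>2 * E"
  shows "(LINT x:\<Omega>|LB N. f x * partial_deriv i \<eta> x) = - J"
proof -
  note [measurable] = test_function_measurable[OF \<eta>] test_function_measurable[OF test_function_partial_deriv[OF \<eta> i]]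
  let ?e = "unit_dir i"
  obtain K where K: "compactin (Rn_top N) K" "K \<subseteq> \<Omega>" and \<eta>0: "\<And>x. x \<in> Rn N - K \<Longrightarrow> \<eta> x = 0"
    using \<eta> unfolding test_function_def by blast
  obtain r1 K1 where K1: "r1 > 0" "compactin (Rn_top N) K1" "K1 \<subseteq> \<Omega>"
    and nb1: "\<And>x y. x \<in> K \<Longrightarrow> y \<in> Rn N \<Longrightarrow> (\<And>i. i < N \<Longrightarrow> \<bar>y i - x i\<bar> \<le> r1) \<Longrightarrow> y \<in> K1"
    using compactin_nbhd[OF \<Omega> K] by blast
  define r where "r = min r1 q"
  have r: "r > 0" "r \<le> q" using K1 q by (auto simp: r_def)
  have [measurable]: "K1 \<in> sets (LB N)" using compactin_in_sets_LB K1 by auto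
  have KR: "K \<subseteq> Rn N" using compactin_subset_topspace[OF K(1)] by simp
  have sh1: "lc N 1 x t ?e \<in> K1" if "x \<in> K" "\<bar>t\<bar> \<le> r" for x t
    using that by (intro nb1[of x]) (auto simp: unit_dir_def r_def)
  have KK: "K \<subseteq> K1"
  proof
    fix x assume x: "x \<in> K"
    have "lc N 1 x 0 ?e = x" using x KR by (intro Rn_eqI[of _ N]) auto
    then show "x \<in> K1" using sh1[OF x, of 0] r by simp
  qed
  obtain B where B: "\<And>x. x \<in> Rn N \<Longrightarrow> \<bar>\<eta> x\<bar> \<le> B" using test_function_bounded[OF \<eta>] by blast
  obtain C where C: "\<And>x. x \<in> Rn N \<Longrightarrow> \<bar>partial_deriv i \<eta> x\<bar> \<le> C"
    using test_function_bounded[OF test_function_partial_deriv[OF \<eta> i]] by blast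
  define FU where "FU x = indicator K1 x * f x" for x
  have [measurable]: "FU \<in> borel_measurable (LB N)" unfolding FU_def[abs_def] by measurable
  have FUi: "integrable (LB N) FU"
    using loc[OF K1(3,2)] by (simp add: set_integrable_def FU_def[abs_def])
  have FUf: "(LINT x|LB N. \<eta> x * (FU (lc N 1 x t ?e) - FU x)) = (LINT x|LB N. \<eta> x * (f (lc N 1 x t ?e) - f x))"
    if "0 < t" "t \<le> r" for t
  proof (rule Bochner_Integration.integral_cong[OF refl])
    fix x assume x: "x \<in> space (LB N)"
    show "\<eta> x * (FU (lc N 1 x t ?e) - FU x) = \<eta> x * (f (lc N 1 x t ?e) - f x)"
    proof (cases "x \<in> K")
      case True
      have "x \<in> K1" "lc N 1 x t ?e \<in> K1" using sh1[OF True, of t] that True KK by auto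
      then show ?thesis by (simp add: FU_def)
    qed (use \<eta>0 x in simp)
  qed
  have main: "\<bar>(LINT x|LB N. \<eta> x * (FU (lc N 1 x t ?e) - FU x)) - t * J\<bar> \<le> t\<^sup>2 * E"
    if "0 < t" "t \<le> r" for t
    unfolding FUf[OF that] using quot[OF that(1)] that(2) r by simp
  define T where "T n = r / real (Suc n)" for n
  have T: "0 < T n" "T n \<le> r" for n using r(1) by (auto simp: T_def field_simps)
  have T0: "T \<longlonglongrightarrow> 0" unfolding T_def[abs_def] using tendsto_mult[OF tendsto_const[of r] LIMSEQ_inverse_real_of_nat] by (simp add: divide_inverse)
  \<comment> \<open>The translation is moved from the function to \<open>\<eta>\<close>.\<close>
  have A: "(LINT x|LB N. \<eta> x * (FU (lc N 1 x t ?e) - FU x)) = (LINT x|LB N. (\<eta> (lc N 1 x (- t) ?e) - \<eta> x) * FU x)" for t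
  proof -
    have i1: "integrable (LB N) (\<lambda>x. \<eta> x * FU (lc N 1 x t ?e))"
      by (rule integrable_bounded_mult[OF integrable_shift[OF FUi]]) (use B in auto)
    have i2: "integrable (LB N) (\<lambda>x. \<eta> x * FU x)"
      by (rule integrable_bounded_mult[OF FUi]) (use B in auto)
    have i3: "integrable (LB N) (\<lambda>x. \<eta> (lc N 1 x (- t) ?e) * FU x)"
      by (rule integrable_bounded_mult[OF FUi, of _ B]) (use B in auto)
    have "(LINT x|LB N. \<eta> (lc N 1 x (- t) ?e) * FU x) =
      (LINT x|LB N. \<eta> (lc N 1 (lc N 1 x t ?e) (- t) ?e) * FU (lc N 1 x t ?e))"
      by (rule integral_shift[symmetric]) measurable
    also have "\<dots> = (LINT x|LB N. \<eta> x * FU (lc N 1 x t ?e))"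
      by (rule Bochner_Integration.integral_cong[OF refl]) (simp add: lc_shift_cancel)
    finally show ?thesis using i1 i2 i3 by (simp add: right_diff_distrib left_diff_distrib)
  qed
  have lim1: "(\<lambda>n. (LINT x|LB N. (\<eta> (lc N 1 x (- T n) ?e) - \<eta> x) / T n * FU x)) \<longlonglongrightarrow> (LINT x|LB N. - partial_deriv i \<eta> x * FU x)"
  proof (rule integral_dominated_convergence)
    show "integrable (LB N) (\<lambda>x. C * \<bar>FU x\<bar>)" using FUi by simp
    show "AE x in LB N. (\<lambda>n. (\<eta> (lc N 1 x (- T n) ?e) - \<eta> x) / T n * FU x) \<longlonglongrightarrow> - partial_deriv i \<eta> x * FU x"
    proof (rule AE_I2, rule tendsto_mult[OF _ tendsto_const])
      fix x assume "x \<in> space (LB N)"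
      then have x: "x \<in> Rn N" by simp
      have "((\<lambda>t. \<eta> (x(i := t))) has_real_derivative partial_deriv i \<eta> x) (at (x i))"
        by (rule test_function_has_partial[OF \<eta> i x])
      then have d: "((\<lambda>d. (\<eta> (x(i := x i + d)) - \<eta> (x(i := x i))) / d) \<longlongrightarrow> partial_deriv i \<eta> x) (at 0)"
        by (simp add: DERIV_def)
      have "filterlim (\<lambda>n. - T n) (at 0) sequentially"
        using tendsto_minus[OF T0] T(1) by (auto simp: filterlim_at less_imp_neq[symmetric])
      from tendsto_minus[OF filterlim_compose[OF d this]]
      show "(\<lambda>n. (\<eta> (lc N 1 x (- T n) ?e) - \<eta> x) / T n) \<longlonglongrightarrow> - partial_deriv i \<eta> x"
        using lc_unit_dir[OF x i] by simp
    qed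
    show "AE x in LB N. norm ((\<eta> (lc N 1 x (- T n) ?e) - \<eta> x) / T n * FU x) \<le> C * \<bar>FU x\<bar>" for n
    proof (rule AE_I2)
      fix x assume "x \<in> space (LB N)"
      then have "\<bar>\<eta> (lc N 1 x (- T n) ?e) - \<eta> x\<bar> \<le> C * \<bar>- T n\<bar>"
        by (intro test_function_lipschitz[OF \<eta> i _ C]) auto
      then have "\<bar>(\<eta> (lc N 1 x (- T n) ?e) - \<eta> x) / T n\<bar> \<le> C"
        using T(1)[of n] by (simp add: divide_simps)
      then show "norm ((\<eta> (lc N 1 x (- T n) ?e) - \<eta> x) / T n * FU x) \<le> C * \<bar>FU x\<bar>"
        unfolding real_norm_def abs_mult by (rule mult_right_mono) simp
    qed
  qed measurable
  have lim2: "(\<lambda>n. (LINT x|LB N. (\<eta> (lc N 1 x (- T n) ?e) - \<eta> x) / T n * FU x)) \<longlonglongrightarrow> J"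
  proof (rule LIM_zero_cancel, rule Lim_null_comparison)
    show "\<forall>\<^sub>F n in sequentially. norm ((LINT x|LB N. (\<eta> (lc N 1 x (- T n) ?e) - \<eta> x) / T n * FU x) - J) \<le> T n * E"
    proof (rule always_eventually, rule allI)
      fix n
      have quot: "(LINT x|LB N. (\<eta> (lc N 1 x (- T n) ?e) - \<eta> x) / T n * FU x) =
        (LINT x|LB N. (\<eta> (lc N 1 x (- T n) ?e) - \<eta> x) * FU x) / T n"
        by (simp add: field_simps)
      have "T n * \<bar>(LINT x|LB N. (\<eta> (lc N 1 x (- T n) ?e) - \<eta> x) / T n * FU x) - J\<bar> =
         \<bar>(LINT x|LB N. (\<eta> (lc N 1 x (- T n) ?e) - \<eta> x) * FU x) - T n * J\<bar>"
      proof -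
        have "c * \<bar>p / c - q\<bar> = \<bar>p - c * q\<bar>" if "c > 0" for c p q :: real
        proof -
          have "\<bar>p - c * q\<bar> = \<bar>c * (p / c - q)\<bar>" using that by (simp add: right_diff_distrib)
          then show ?thesis using that by (simp add: abs_mult)
        qed
        then show ?thesis unfolding quot using T(1)[of n] by simp
      qed
      also have "\<dots> \<le> T n * (T n * E)" using main[OF T] unfolding A by (simp add: power2_eq_square mult.assoc)
      finally show "norm ((LINT x|LB N. (\<eta> (lc N 1 x (- T n) ?e) - \<eta> x) / T n * FU x) - J) \<le> T n * E"
        using T(1)[of n] by simp
    qed
    show "(\<lambda>n. T n * E) \<longlonglongrightarrow> 0" using tendsto_mult[OF T0 tendsto_const[of E]] by simp
  qed
  have "J = (LINT x|LB N. - partial_deriv i \<eta> x * FU x)" by (rule LIMSEQ_unique[OF lim2 lim1])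
  moreover have "(LINT x|LB N. - partial_deriv i \<eta> x * FU x) = - (LINT x:\<Omega>|LB N. f x * partial_deriv i \<eta> x)"
    unfolding set_lebesgue_integral_def Bochner_Integration.integral_minus[symmetric]
  proof (rule Bochner_Integration.integral_cong[OF refl])
    fix x assume x: "x \<in> space (LB N)"
    show "- partial_deriv i \<eta> x * FU x = - (indicator \<Omega> x *\<^sub>R (f x * partial_deriv i \<eta> x))"
    proof (cases "x \<in> K")
      case True
      then have "x \<in> K1" "x \<in> \<Omega>" using KK K(2) by blast+
      then show ?thesis by (simp add: FU_def)
    next
      case False
      then have "partial_deriv i \<eta> x = 0" using x by (intro partial_deriv_vanishes[OF i K(1) \<eta>0]) auto
      then show ?thesis by simp
    qed
  qed
  ultimately show ?thesis by simp
qed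

lemma lipschitz_derivative_taylor:
  fixes F :: "real \<Rightarrow> real"
  assumes F: "\<And>x. (F has_real_derivative F' x) (at x)" and M: "\<And>x y. \<bar>F' x - F' y\<bar> \<le> M * \<bar>x - y\<bar>"
  shows "\<bar>F b - F a - F' a * (b - a)\<bar> \<le> M * (b - a)\<^sup>2"
proof -
  have M0: "0 \<le> M" using M[of 1 0] by (auto intro: order_trans)
  have d: "((\<lambda>s. F s - F' a * s) has_real_derivative F' s - F' a) (at s)" for s
    using F by (auto intro!: derivative_eq_intros)
  have "norm ((F b - F' a * b) - (F a - F' a * a)) \<le> M * \<bar>b - a\<bar> * norm (b - a)"
  proof (rule field_differentiable_bound[where S = "closed_segment a b" and f' = "\<lambda>s. F' s - F' a"])
    fix z assume "z \<in> closed_segment a b"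
    then have "\<bar>z - a\<bar> \<le> \<bar>b - a\<bar>" by (auto simp: closed_segment_eq_real_ivl split: if_splits)
    then show "norm (F' z - F' a) \<le> M * \<bar>b - a\<bar>"
      using M[of z a] mult_left_mono[OF _ M0] by (fastforce intro: order_trans)
    show "((\<lambda>s. F s - F' a * s) has_field_derivative F' z - F' a) (at z within closed_segment a b)"
      using d by (rule has_field_derivative_at_within)
  qed auto
  then show ?thesis by (simp add: algebra_simps power2_eq_square abs_mult_self_eq flip: abs_mult)
qed

text \<open>
  The increment of \<open>F (u x)\<close> over a step \<open>t\<close> is \<open>F' (u x)\<close> times the increment of \<open>u\<close> up to a Taylor
  remainder, and the increment of \<open>u\<close> is \<open>t\<close> times a mean of \<open>G i\<close>. After shifting, the mean is replaced
  by \<open>G i x\<close> itself at the cost of a second increment of \<open>u\<close>. By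
  \<open>difference_quotient_bound\<close> an increment of \<open>u\<close> is of order \<open>t\<close> in \<open>L\<^sup>2\<close> of a compact set, so every
  error is of order \<open>t\<^sup>2\<close>.
\<close>

lemma sobolev_chain_rule:
  assumes \<Omega>: "openin (Rn_top N) \<Omega>" and conv: "Rn_convex N \<Omega>" and P: "sobolev_pair N \<Omega> u G"
    and F: "\<And>x. (F has_real_derivative F' x) (at x)"
    and L: "\<And>x. \<bar>F' x\<bar> \<le> L" and M: "\<And>x y. \<bar>F' x - F' y\<bar> \<le> M * \<bar>x - y\<bar>"
  shows "sobolev_pair N \<Omega> (\<lambda>x. F (u x)) (\<lambda>i x. F' (u x) * G i x)"
proof -
  have M0: "0 \<le> M" using M[of 1 0] by (auto intro: order_trans)
  have L0: "0 \<le> L" using L[of 0] by (auto intro: order_trans)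
  have Fcont: "continuous_on UNIV F" using F by (auto intro!: continuous_at_imp_continuous_on DERIV_isCont)
  have "M-lipschitz_on UNIV F'" using M M0 by (auto simp: lipschitz_on_def dist_real_def)
  then have "continuous_on UNIV F'" by (rule lipschitz_on_continuous_on)
  then have [measurable]: "F \<in> borel_measurable borel" "F' \<in> borel_measurable borel"
    using Fcont by (auto intro: borel_measurable_continuous_onI)
  have [measurable]: "u \<in> borel_measurable (LB N)" and Gm: "\<And>i. i < N \<Longrightarrow> G i \<in> borel_measurable (LB N)"
    using sobolev_pairD(1,2)[OF P] by auto
  have FL: "\<bar>F a - F b\<bar> \<le> L * \<bar>a - b\<bar>" for a b
    using field_differentiable_bound[where S = UNIV and f = F and f' = F' and B = L and x = a and y = b] F L
    by auto
  note taylor = lipschitz_derivative_taylor[OF F M]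
  have sqF: "set_integrable (LB N) K (\<lambda>x. (F (u x))\<^sup>2)" if K: "K \<subseteq> \<Omega>" "compactin (Rn_top N) K" for K
  proof -
    have [measurable]: "K \<in> sets (LB N)" by (rule compactin_in_sets_LB[OF K(2)])
    have "integrable (LB N) (\<lambda>x. 2 * (F 0)\<^sup>2 * indicator K x + 2 * L\<^sup>2 * (indicator K x *\<^sub>R (u x)\<^sup>2))"
      using sobolev_pairD(3)[OF P K] emeasure_compactin_finite[OF K(2)] unfolding set_integrable_def
      by (intro Bochner_Integration.integrable_add integrable_mult_right) auto
    then show ?thesis unfolding set_integrable_def
    proof (rule Bochner_Integration.integrable_bound)
      have "(F a)\<^sup>2 \<le> 2 * (F 0)\<^sup>2 + 2 * L\<^sup>2 * a\<^sup>2" for a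
      proof -
        have "(F a)\<^sup>2 \<le> 2 * (F 0)\<^sup>2 + 2 * (F a - F 0)\<^sup>2"
          using sum_squares_ge_zero[of "F a - 2 * F 0" 0] by (simp add: power2_eq_square algebra_simps)
        also have "(F a - F 0)\<^sup>2 \<le> (L * \<bar>a\<bar>)\<^sup>2" using FL[of a 0] by (intro power2_le_iff_abs_le[THEN iffD2]) (auto simp: L0)
        finally show ?thesis by (simp add: power_mult_distrib)
      qed
      then show "AE x in LB N. norm (indicator K x *\<^sub>R (F (u x))\<^sup>2) \<le> norm (2 * (F 0)\<^sup>2 * indicator K x + 2 * L\<^sup>2 * (indicator K x *\<^sub>R (u x)\<^sup>2))"
        by (auto simp: indicator_def)
    qed measurable
  qed
  have weak: "(LINT x:\<Omega>|LB N. F (u x) * partial_deriv i \<eta> x) = - (LINT x:\<Omega>|LB N. (F' (u x) * G i x) * \<eta> x)"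
    if i: "i < N" and \<eta>: "test_function N \<Omega> \<eta>" for i \<eta>
  proof -
    note [measurable] = Gm[OF i] test_function_measurable[OF \<eta>] test_function_measurable[OF test_function_partial_deriv[OF \<eta> i]]
    let ?e = "unit_dir i"
    obtain K where K: "compactin (Rn_top N) K" "K \<subseteq> \<Omega>" and \<eta>0: "\<And>x. x \<in> Rn N - K \<Longrightarrow> \<eta> x = 0"
      using \<eta> unfolding test_function_def by blast
    obtain r1 K1 where K1: "r1 > 0" "compactin (Rn_top N) K1" "K1 \<subseteq> \<Omega>"
      and nb1: "\<And>x y. x \<in> K \<Longrightarrow> y \<in> Rn N \<Longrightarrow> (\<And>i. i < N \<Longrightarrow> \<bar>y i - x i\<bar> \<le> r1) \<Longrightarrow> y \<in> K1"
      using compactin_nbhd[OF \<Omega> K] by blast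
    obtain r2 K2 where K2: "r2 > 0" "compactin (Rn_top N) K2" "K2 \<subseteq> \<Omega>"
      and nb2: "\<And>x y. x \<in> K1 \<Longrightarrow> y \<in> Rn N \<Longrightarrow> (\<And>i. i < N \<Longrightarrow> \<bar>y i - x i\<bar> \<le> r2) \<Longrightarrow> y \<in> K2"
      using compactin_nbhd[OF \<Omega> K1(2,3)] by blast
    define r where "r = min r1 r2"
    have r: "r > 0" using K1 K2 by (simp add: r_def)
    have [measurable]: "K \<in> sets (LB N)" "K1 \<in> sets (LB N)" "K2 \<in> sets (LB N)"
      using compactin_in_sets_LB K K1 K2 by auto
    have KR: "K \<subseteq> Rn N" "K1 \<subseteq> Rn N" "K2 \<subseteq> Rn N"
      using compactin_subset_topspace[OF K(1)] compactin_subset_topspace[OF K1(2)] compactin_subset_topspace[OF K2(2)] by auto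
    have sh1: "lc N 1 x t ?e \<in> K1" if "x \<in> K" "\<bar>t\<bar> \<le> r" for x t
      using that by (intro nb1[of x]) (auto simp: unit_dir_def r_def)
    have sh2: "lc N 1 x t ?e \<in> K2" if "x \<in> K1" "\<bar>t\<bar> \<le> r" for x t
      using that by (intro nb2[of x]) (auto simp: unit_dir_def r_def)
    have self: "lc N 1 x 0 h = x" if "x \<in> Rn N" for x h using that by (intro Rn_eqI[of _ N]) auto
    have KK: "K \<subseteq> K1" "K1 \<subseteq> K2"
      using sh1[of _ 0] sh2[of _ 0] r KR self by (metis abs_zero less_imp_le subsetD subsetI)+
    obtain B where B: "\<And>x. x \<in> Rn N \<Longrightarrow> \<bar>\<eta> x\<bar> \<le> B" using test_function_bounded[OF \<eta>] by blast
    obtain C where C: "\<And>x. x \<in> Rn N \<Longrightarrow> \<bar>partial_deriv i \<eta> x\<bar> \<le> C"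
      using test_function_bounded[OF test_function_partial_deriv[OF \<eta> i]] by blast
    have B0: "0 \<le> B" using B[of "lc N 1 undefined 1 undefined"] by (auto intro: order_trans)
    have C0: "0 \<le> C" using C[of "lc N 1 undefined 1 undefined"] by (auto intro: order_trans)
    define g where "g x = indicator K2 x * G i x" for x
    define \<zeta> where "\<zeta> x = \<eta> x * F' (u x)" for x
    have [measurable]: "\<zeta> \<in> borel_measurable (LB N)" "g \<in> borel_measurable (LB N)"
      unfolding \<zeta>_def[abs_def] g_def[abs_def] by measurable
    have g: "integrable (LB N) g" "integrable (LB N) (\<lambda>x. (g x)\<^sup>2)"
      using sobolev_pairD(4,6)[OF P K2(3,2) i]
      by (auto simp: set_integrable_def g_def[abs_def] power_mult_distrib power2_eq_square indicator_inter_arith[symmetric] mult_ac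
          cong: Bochner_Integration.integrable_cong simp flip: indicator_times_eq_if)
    define \<Gamma> where "\<Gamma> = (LINT x|LB N. (g x)\<^sup>2)"
    define g1 where "g1 = (LINT x|LB N. \<bar>g x\<bar>)"
    have \<Gamma>': "(LINT x|LB N. indicator K2 x * (G i x)\<^sup>2) = \<Gamma>"
      unfolding \<Gamma>_def g_def by (intro Bochner_Integration.integral_cong refl) (auto simp: indicator_def)
    have \<Gamma>0: "\<Gamma> \<ge> 0" unfolding \<Gamma>_def by simp
    have \<zeta>B: "\<bar>\<zeta> x\<bar> \<le> B * L" if "x \<in> Rn N" for x
      unfolding \<zeta>_def using B[OF that] L[of "u x"] B0 by (simp add: abs_mult mult_mono)
    have \<zeta>0: "\<zeta> x = 0" if "x \<in> Rn N - K" for x using \<eta>0[OF that] by (simp add: \<zeta>_def)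
    define J where "J = (LINT x|LB N. \<zeta> x * g x)"
    define E where "E = B * M * \<Gamma> + (C * L * g1 + B * M * (2 * \<Gamma>))"
    have main: "\<bar>(LINT x|LB N. \<eta> x * (F (u (lc N 1 x t ?e)) - F (u x))) - t * J\<bar> \<le> t\<^sup>2 * E"
      if t: "0 < t" "t \<le> r" for t
    proof -
      define \<Delta> where "\<Delta> x = u (lc N 1 x t ?e) - u x" for x
      define R where "R x = F (u (lc N 1 x t ?e)) - F (u x) - F' (u x) * \<Delta> x" for x
      have [measurable]: "\<Delta> \<in> borel_measurable (LB N)" "R \<in> borel_measurable (LB N)"
        unfolding \<Delta>_def[abs_def] R_def[abs_def] by measurable
      define h where "h = (\<lambda>j. t * unit_dir i j)"
      have l: "lc N 1 x s h = lc N 1 x (s * t) ?e" for x s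
        by (rule Rn_eqI[of _ N]) (auto simp: h_def)
      have st: "\<bar>s * t\<bar> \<le> r" "\<bar>s * t\<bar> \<le> t" if "s \<in> {0..1}" for s
      proof -
        have "s * t \<le> 1 * t" "0 \<le> s * t" using that t by (intro mult_right_mono mult_nonneg_nonneg; simp)+
        then show "\<bar>s * t\<bar> \<le> r" "\<bar>s * t\<bar> \<le> t" using t by linarith+
      qed
      have dqK: "integrable (LB N) (\<lambda>x. indicator K x * (\<Delta> x)\<^sup>2)"
        "(LINT x|LB N. indicator K x * (\<Delta> x)\<^sup>2) \<le> t\<^sup>2 * \<Gamma>"
        using difference_quotient_bound[OF \<Omega> conv P i K K2(2,3), of t] sh1 st KK unfolding \<Delta>_def \<Gamma>' by blast+
      \<comment> \<open>The Taylor remainder is quadratic in the increment of \<open>u\<close>.\<close>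
      have R: "\<bar>\<eta> x * R x\<bar> \<le> B * M * (indicator K x * (\<Delta> x)\<^sup>2)" if x: "x \<in> Rn N" for x
      proof (cases "x \<in> K")
        case True
        have "\<bar>R x\<bar> \<le> M * (\<Delta> x)\<^sup>2" unfolding R_def \<Delta>_def by (rule taylor)
        then have "\<bar>\<eta> x\<bar> * \<bar>R x\<bar> \<le> B * (M * (\<Delta> x)\<^sup>2)" using B[OF x] B0 by (intro mult_mono) auto
        then show ?thesis using True by (simp add: abs_mult)
      qed (use \<eta>0 x in simp)
      have dqi: "integrable (LB N) (\<lambda>x. B * M * (indicator K x * (\<Delta> x)\<^sup>2))" using dqK(1) by (rule integrable_mult_right)
      have Ri: "integrable (LB N) (\<lambda>x. \<eta> x * R x)"
        by (rule Bochner_Integration.integrable_bound[OF dqi])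
           (use R in \<open>auto intro!: order_trans[OF _ abs_ge_self]\<close>)
      have Rle: "\<bar>LINT x|LB N. \<eta> x * R x\<bar> \<le> B * M * (t\<^sup>2 * \<Gamma>)"
      proof -
        have "\<bar>LINT x|LB N. \<eta> x * R x\<bar> \<le> (LINT x|LB N. \<bar>\<eta> x * R x\<bar>)" by (rule integral_abs_bound)
        also have "\<dots> \<le> (LINT x|LB N. B * M * (indicator K x * (\<Delta> x)\<^sup>2))"
          using R by (intro integral_mono integrable_abs Ri dqi) auto
        also have "\<dots> \<le> B * M * (t\<^sup>2 * \<Gamma>)" using dqK(2) B0 M0 by (simp add: mult_left_mono)
        finally show ?thesis .
      qed
      \<comment> \<open>The main term: the increment of \<open>u\<close> as a mean of \<open>G i\<close>, with the shift moved to \<open>\<zeta>\<close>.\<close>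
      have avg: "(LINT x|LB N. \<zeta> x * \<Delta> x) = t * (LINT s|U01. LINT x|LB N. \<zeta> (lc N 1 x (- s) h) * g x)"
        and avgi: "integrable (LB N) (\<lambda>x. \<zeta> x * \<Delta> x)"
      proof -
        have ae: "AE x in LB N. \<zeta> x * \<Delta> x = t * (\<zeta> x * (LINT s|U01. g (lc N 1 x s h)))"
          using sobolev_FTC_coordinate[OF \<Omega> conv P i, of t] AE_space
        proof eventually_elim
          case (elim x)
          show ?case
          proof (cases "x \<in> K")
            case True
            then have "x \<in> \<Omega>" "lc N 1 x t ?e \<in> \<Omega>" using K K1 sh1[OF True, of t] t by auto
            then have "\<Delta> x = t * (LINT s|U01. G i (lc N 1 x (s * t) ?e))" using elim by (simp add: \<Delta>_def)
            also have "(LINT s|U01. G i (lc N 1 x (s * t) ?e)) = (LINT s|U01. g (lc N 1 x s h))"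
              using subsetD[OF KK(2) sh1[OF True st(1)]] by (intro Bochner_Integration.integral_cong refl) (auto simp: g_def l)
            finally show ?thesis by simp
          qed (use \<zeta>0 elim in simp)
        qed
        note sa = integral_segment_average[OF g(1), of \<zeta> "B * L" h, OF _ \<zeta>B]
        have i: "integrable (LB N) (\<lambda>x. t * (\<zeta> x * (LINT s|U01. g (lc N 1 x s h))))"
          using sa(1) by simp
        have [measurable]: "(\<lambda>x. LINT s|U01. g (lc N 1 x s h)) \<in> borel_measurable (LB N)"
          using integrable_segment_average[OF g(1)] by (rule borel_measurable_integrable)
        show "integrable (LB N) (\<lambda>x. \<zeta> x * \<Delta> x)"
          using i by (rule integrable_cong_AE[THEN iffD1, rotated 3]) (use ae in auto)
        have "(LINT x|LB N. \<zeta> x * \<Delta> x) = (LINT x|LB N. t * (\<zeta> x * (LINT s|U01. g (lc N 1 x s h))))"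
          by (rule integral_cong_AE) (use ae in auto)
        then show "(LINT x|LB N. \<zeta> x * \<Delta> x) = t * (LINT s|U01. LINT x|LB N. \<zeta> (lc N 1 x (- s) h) * g x)"
          using sa(2) by simp
      qed
      \<comment> \<open>Undoing the shift of \<open>\<zeta> = \<eta> * F'(u)\<close>: one error from \<open>\<eta>\<close>, one from the Lipschitz bound on \<open>F'\<close>.\<close>
      have shift: "\<bar>(LINT x|LB N. \<zeta> (lc N 1 x (- s) h) * g x) - J\<bar> \<le> t * (C * L * g1 + B * M * (2 * \<Gamma>))"
        if s: "s \<in> {0..1}" for s
      proof -
        define y where "y x = lc N 1 x (- (s * t)) ?e" for x
        have yeq: "lc N 1 x (- s) h = y x" for x unfolding y_def by (rule Rn_eqI[of _ N]) (auto simp: h_def)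
        have [measurable]: "y \<in> measurable (LB N) (LB N)" unfolding y_def[abs_def] by measurable
        have dq1: "integrable (LB N) (\<lambda>x. indicator K1 x * (u (y x) - u x)\<^sup>2)"
          "(LINT x|LB N. indicator K1 x * (u (y x) - u x)\<^sup>2) \<le> (- (s * t))\<^sup>2 * \<Gamma>"
        proof -
          have "lc N 1 x (s' * - (s * t)) ?e \<in> K2" if "x \<in> K1" "s' \<in> {0..1}" for x s'
          proof (rule sh2[OF that(1)])
            have "\<bar>s'\<bar> * \<bar>s * t\<bar> \<le> 1 * r" using that st(1)[OF s] by (intro mult_mono) auto
            then show "\<bar>s' * - (s * t)\<bar> \<le> r" by (simp add: abs_mult)
          qed
          then show "integrable (LB N) (\<lambda>x. indicator K1 x * (u (y x) - u x)\<^sup>2)"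
            "(LINT x|LB N. indicator K1 x * (u (y x) - u x)\<^sup>2) \<le> (- (s * t))\<^sup>2 * \<Gamma>"
            using difference_quotient_bound[OF \<Omega> conv P i K1(2,3) K2(2,3), of "- (s * t)"] unfolding y_def \<Gamma>' by blast+
        qed
        have st2: "(- (s * t))\<^sup>2 \<le> t\<^sup>2" using st(2)[OF s] t by (simp add: abs_le_square_iff[symmetric])
        define bd where "bd x = C * L * t * \<bar>g x\<bar> + B * M * (inverse t * (indicator K1 x * (u (y x) - u x)\<^sup>2) + t * (g x)\<^sup>2)" for x
        have bdi: "integrable (LB N) bd" unfolding bd_def[abs_def]
          using dq1(1) g by (intro Bochner_Integration.integrable_add integrable_mult_right integrable_abs)
        have pt: "\<bar>\<zeta> (y x) * g x - \<zeta> x * g x\<bar> \<le> bd x" if x: "x \<in> Rn N" for x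
        proof (cases "x \<in> K1")
          case False
          have "y x \<notin> K"
          proof
            assume "y x \<in> K"
            from sh1[OF this st(1)[OF s]] have "lc N 1 (y x) (s * t) ?e \<in> K1" .
            then show False using False lc_shift_cancel(2)[OF x, of "s * t" ?e] by (simp add: y_def)
          qed
          then have "\<zeta> (y x) = 0" by (intro \<zeta>0) (auto simp: y_def)
          moreover have "\<zeta> x = 0" using False KK x by (intro \<zeta>0) auto
          ultimately show ?thesis using False B0 M0 C0 L0 t by (simp add: bd_def)
        next
          case True
          have "\<zeta> (y x) - \<zeta> x = (\<eta> (y x) - \<eta> x) * F' (u (y x)) + \<eta> x * (F' (u (y x)) - F' (u x))"
            by (simp add: \<zeta>_def algebra_simps)
          also have "\<bar>\<dots>\<bar> \<le> C * t * L + B * (M * \<bar>u (y x) - u x\<bar>)"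
          proof (rule order_trans[OF abs_triangle_ineq], rule add_mono)
            have "\<bar>\<eta> (y x) - \<eta> x\<bar> \<le> C * \<bar>- (s * t)\<bar>" unfolding y_def
              by (rule test_function_lipschitz[OF \<eta> i x C])
            also have "\<dots> \<le> C * t" using st(2)[OF s] C0 by (intro mult_left_mono) auto
            finally show "\<bar>(\<eta> (y x) - \<eta> x) * F' (u (y x))\<bar> \<le> C * t * L"
              using L[of "u (y x)"] by (simp add: abs_mult mult_mono)
            show "\<bar>\<eta> x * (F' (u (y x)) - F' (u x))\<bar> \<le> B * (M * \<bar>u (y x) - u x\<bar>)"
              using B[OF x] M[of "u (y x)" "u x"] B0 by (simp add: abs_mult mult_mono)
          qed
          finally have "\<bar>\<zeta> (y x) - \<zeta> x\<bar> * \<bar>g x\<bar> \<le> (C * t * L + B * (M * \<bar>u (y x) - u x\<bar>)) * \<bar>g x\<bar>"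
            by (rule mult_right_mono) simp
          also have "\<dots> = C * L * t * \<bar>g x\<bar> + B * M * (\<bar>u (y x) - u x\<bar> * \<bar>g x\<bar>)" by (simp add: algebra_simps)
          also have "\<bar>u (y x) - u x\<bar> * \<bar>g x\<bar> \<le> inverse t * (u (y x) - u x)\<^sup>2 + t * (g x)\<^sup>2"
          proof -
            \<comment> \<open>The weights \<open>1 / t\<close> and \<open>t\<close> balance an increment of order \<open>t\<close> against the gradient.\<close>
            have "p * q \<le> inverse t * p\<^sup>2 + t * q\<^sup>2" if "p \<ge> 0" "q \<ge> 0" for p q :: real
            proof -
              have "0 \<le> inverse t * (p - t * q)\<^sup>2" using t by simp
              also have "\<dots> = inverse t * p\<^sup>2 + t * q\<^sup>2 - 2 * (p * q)" using t by (simp add: power2_eq_square field_simps)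
              finally show ?thesis using mult_nonneg_nonneg[OF that] by linarith
            qed
            from this[of "\<bar>u (y x) - u x\<bar>" "\<bar>g x\<bar>"] show ?thesis by simp
          qed
          finally show ?thesis using B0 M0 True
            by (simp add: bd_def mult_left_mono flip: left_diff_distrib abs_mult)
        qed
        have i1: "integrable (LB N) (\<lambda>x. \<zeta> (y x) * g x)"
          by (rule integrable_bounded_mult[OF g(1), of _ "B * L"]) (auto simp: y_def intro: \<zeta>B)
        have i2: "integrable (LB N) (\<lambda>x. \<zeta> x * g x)"
          by (rule integrable_bounded_mult[OF g(1), of _ "B * L"]) (auto intro: \<zeta>B)
        have "\<bar>(LINT x|LB N. \<zeta> (y x) * g x) - J\<bar> = \<bar>LINT x|LB N. \<zeta> (y x) * g x - \<zeta> x * g x\<bar>"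
          unfolding J_def using i1 i2 by simp
        also have "\<dots> \<le> (LINT x|LB N. \<bar>\<zeta> (y x) * g x - \<zeta> x * g x\<bar>)" by (rule integral_abs_bound)
        also have "\<dots> \<le> (LINT x|LB N. bd x)" using pt i1 i2 bdi by (intro integral_mono) auto
        also have "\<dots> = C * L * t * g1 + B * M * (inverse t * (LINT x|LB N. indicator K1 x * (u (y x) - u x)\<^sup>2) + t * \<Gamma>)"
          unfolding bd_def g1_def \<Gamma>_def using dq1(1) g by simp
        also have "\<dots> \<le> C * L * t * g1 + B * M * (inverse t * (t\<^sup>2 * \<Gamma>) + t * \<Gamma>)"
          using order_trans[OF dq1(2) mult_right_mono[OF st2 \<Gamma>0]] B0 M0 t
          by (intro add_mono mult_left_mono order_refl) auto
        also have "\<dots> = t * (C * L * g1 + B * M * (2 * \<Gamma>))" using t by (simp add: field_simps power2_eq_square)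
        finally show ?thesis by (simp add: yeq)
      qed
      have shift': "\<bar>(LINT s|U01. LINT x|LB N. \<zeta> (lc N 1 x (- s) h) * g x) - J\<bar> \<le> t * (C * L * g1 + B * M * (2 * \<Gamma>))"
      proof -
        have W: "(\<lambda>p. \<zeta> (lc N 1 (fst p) (- snd p) h)) \<in> borel_measurable (LB N \<Otimes>\<^sub>M U01)" by measurable
        have "integrable (LB N \<Otimes>\<^sub>M U01) (\<lambda>(x, s). \<zeta> (lc N 1 x (- s) h) * g x)"
          using integrable_pair_shift(2)[OF g(1) W, of "B * L"] \<zeta>B by simp
        from LBU.integrable_snd[OF this]
        have i: "integrable U01 (\<lambda>s. LINT x|LB N. \<zeta> (lc N 1 x (- s) h) * g x)" .
        have "\<bar>(LINT s|U01. LINT x|LB N. \<zeta> (lc N 1 x (- s) h) * g x) - J\<bar> =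
          \<bar>LINT s|U01. (LINT x|LB N. \<zeta> (lc N 1 x (- s) h) * g x) - J\<bar>"
          using i U01.prob_space by simp
        also have "\<dots> \<le> (LINT s|U01. \<bar>(LINT x|LB N. \<zeta> (lc N 1 x (- s) h) * g x) - J\<bar>)" by (rule integral_abs_bound)
        also have "\<dots> \<le> (LINT s|U01. t * (C * L * g1 + B * M * (2 * \<Gamma>)))"
          using i shift by (intro integral_mono) auto
        also have "\<dots> = t * (C * L * g1 + B * M * (2 * \<Gamma>))" using U01.prob_space by simp
        finally show ?thesis .
      qed
      have "(LINT x|LB N. \<eta> x * (F (u (lc N 1 x t ?e)) - F (u x))) = (LINT x|LB N. \<eta> x * R x + \<zeta> x * \<Delta> x)"
      proof (rule Bochner_Integration.integral_cong[OF refl])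
        fix x assume x: "x \<in> space (LB N)"
        show "\<eta> x * (F (u (lc N 1 x t ?e)) - F (u x)) = \<eta> x * R x + \<zeta> x * \<Delta> x"
        proof (cases "x \<in> K")
          case True
          show ?thesis by (simp add: R_def \<zeta>_def algebra_simps)
        qed (use \<eta>0 \<zeta>0 x in simp)
      qed
      also have "\<dots> = (LINT x|LB N. \<eta> x * R x) + (LINT x|LB N. \<zeta> x * \<Delta> x)" using Ri avgi by simp
      finally have "\<bar>(LINT x|LB N. \<eta> x * (F (u (lc N 1 x t ?e)) - F (u x))) - t * J\<bar> \<le>
        \<bar>LINT x|LB N. \<eta> x * R x\<bar> + \<bar>t * ((LINT s|U01. LINT x|LB N. \<zeta> (lc N 1 x (- s) h) * g x) - J)\<bar>"
        unfolding avg by (simp add: right_diff_distrib)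
      also have "\<dots> \<le> B * M * (t\<^sup>2 * \<Gamma>) + t * (t * (C * L * g1 + B * M * (2 * \<Gamma>)))"
        using Rle shift' t by (intro add_mono) (simp_all add: abs_mult)
      also have "\<dots> = t\<^sup>2 * E" by (simp add: E_def power2_eq_square algebra_simps)
      finally show ?thesis .
    qed
    have "(LINT x:\<Omega>|LB N. F (u x) * partial_deriv i \<eta> x) = - J"
      by (rule weak_partial_of_difference_quotients[OF \<Omega> \<eta> i _ _ r main])
         (use set_integrable_of_square[OF _ compactin_in_sets_LB emeasure_compactin_finite sqF] in auto)
    moreover have "J = (LINT x:\<Omega>|LB N. (F' (u x) * G i x) * \<eta> x)"
      unfolding set_lebesgue_integral_def J_def
    proof (rule Bochner_Integration.integral_cong[OF refl])
      fix x assume x: "x \<in> space (LB N)"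
      show "\<zeta> x * g x = indicator \<Omega> x *\<^sub>R ((F' (u x) * G i x) * \<eta> x)"
      proof (cases "x \<in> K")
        case True
        then have "x \<in> K2" "x \<in> \<Omega>" using KK K(2) by blast+
        then show ?thesis by (simp add: \<zeta>_def g_def)
      next
        case False
        then show ?thesis using \<eta>0[of x] \<zeta>0[of x] x by simp
      qed
    qed
    ultimately show ?thesis by simp
  qed
  have sqG: "set_integrable (LB N) K (\<lambda>x. (F' (u x) * G i x)\<^sup>2)" if K: "K \<subseteq> \<Omega>" "compactin (Rn_top N) K" and i: "i < N" for K i
  proof -
    have [measurable]: "K \<in> sets (LB N)" "G i \<in> borel_measurable (LB N)" using compactin_in_sets_LB[OF K(2)] Gm[OF i] by auto
    have "integrable (LB N) (\<lambda>x. L\<^sup>2 * (indicator K x *\<^sub>R (G i x)\<^sup>2))"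
      using sobolev_pairD(4)[OF P K i] unfolding set_integrable_def by (rule integrable_mult_right)
    then show ?thesis unfolding set_integrable_def
    proof (rule Bochner_Integration.integrable_bound)
      have "(F' a)\<^sup>2 \<le> L\<^sup>2" for a using L[of a] L0 by (simp add: abs_le_square_iff[symmetric])
      then show "AE x in LB N. norm (indicator K x *\<^sub>R (F' (u x) * G i x)\<^sup>2) \<le> norm (L\<^sup>2 * (indicator K x *\<^sub>R (G i x)\<^sup>2))"
        by (auto simp: indicator_def power_mult_distrib mult_right_mono)
    qed measurable
  qed
  show ?thesis unfolding sobolev_pair_def
    using weak sqF sqG Gm by (intro conjI allI impI) auto
qed

section \<open>Root-concave weights\<close>

locale weighted_domain =
  fixes N m :: nat and \<Omega> :: "(nat \<Rightarrow> real) set" and \<phi> :: "(nat \<Rightarrow> real) \<Rightarrow> real"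
  assumes N_pos: "N \<ge> 1" and m_pos: "m \<ge> 1"
    and domain: "bounded_convex_domain N \<Omega>"
    and weight: "root_concave_weight N m \<Omega> \<phi>"
begin

lemma open_dom: "openin (Rn_top N) \<Omega>" and convex_dom: "Rn_convex N \<Omega>" and nonempty_dom: "\<Omega> \<noteq> {}"
  and bounded_dom: "Rn_bounded N \<Omega>"
  using domain by (auto simp: bounded_convex_domain_def)

lemma dom_subset: "\<Omega> \<subseteq> Rn N"
  using convex_dom by (simp add: Rn_convex_def)

lemma dom_sets [measurable]: "\<Omega> \<in> sets (LB N)"
  by (rule openin_in_sets_LB[OF open_dom])

lemma weight_pos: "x \<in> \<Omega> \<Longrightarrow> 0 < \<phi> x"
  using weight by (simp add: root_concave_weight_def)

lemma dom_lc:
  assumes "x \<in> \<Omega>" "y \<in> \<Omega>" "s \<in> {0..1}"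
  shows "lc N (1 - s) x s y \<in> \<Omega>"
  using convex_dom assms unfolding Rn_convex_def segment_point_eq_lc[symmetric] by simp

text \<open>
  Concavity of the root, with the value at the other end point bounded below by \<open>0\<close>.
\<close>

lemma weight_lower:
  assumes "x \<in> \<Omega>" "y \<in> \<Omega>" "s \<in> {0..1}"
  shows "(1 - s) ^ m * \<phi> x \<le> \<phi> (lc N (1 - s) x s y)"
proof -
  have pm: "(\<phi> z powr (1 / real m)) ^ m = \<phi> z" if "z \<in> \<Omega>" for z
    using weight_pos[OF that] m_pos by (simp add: powr_powr flip: powr_realpow)
  have "(1 - s) * \<phi> x powr (1 / real m) + s * \<phi> y powr (1 / real m) \<le> \<phi> (lc N (1 - s) x s y) powr (1 / real m)"
    using weight assms unfolding root_concave_weight_def Rn_concave_on_def segment_point_eq_lc[symmetric] by simp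
  moreover have "0 \<le> s * \<phi> y powr (1 / real m)" using assms by simp
  ultimately have "(1 - s) * \<phi> x powr (1 / real m) \<le> \<phi> (lc N (1 - s) x s y) powr (1 / real m)" by linarith
  then have "((1 - s) * \<phi> x powr (1 / real m)) ^ m \<le> (\<phi> (lc N (1 - s) x s y) powr (1 / real m)) ^ m"
    using assms by (intro power_mono) auto
  then show ?thesis using pm[OF assms(1)] pm[OF dom_lc[OF assms]] by (simp add: power_mult_distrib)
qed

text \<open>
  A point near \<open>x\<close> has the form \<open>(1 - e) x + e z\<close> with \<open>z\<close> in \<open>\<Omega>\<close>, where the weight is at least
  \<open>(1 - e)\<^sup>m \<phi> x\<close>. This semicontinuity provides the measurability of the weight.
\<close>

lemma weight_superlevel_open:
  assumes "0 \<le> c"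
  shows "openin (Rn_top N) {x \<in> \<Omega>. c < \<phi> x}"
  unfolding openin_Rn_iff
proof (intro conjI ballI)
  fix x assume x: "x \<in> {x \<in> \<Omega>. c < \<phi> x}"
  have "((\<lambda>e. (1 - e) ^ m * \<phi> x) \<longlongrightarrow> (1 - 0) ^ m * \<phi> x) (at_right 0)"
    by (intro tendsto_intros)
  then have "\<forall>\<^sub>F e in at_right 0. c < (1 - e) ^ m * \<phi> x"
    using x by (intro order_tendstoD(1)) auto
  moreover have "\<forall>\<^sub>F e in at_right 0. e < (1::real)" using eventually_at_right_real[of 0 1] by (auto elim: eventually_mono)
  moreover have "\<forall>\<^sub>F e in at_right 0. (0::real) < e" by (simp add: eventually_at_right_less)
  ultimately have "\<forall>\<^sub>F e in at_right 0. c < (1 - e) ^ m * \<phi> x \<and> e < 1 \<and> 0 < e" by eventually_elim auto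
  then obtain e where e: "c < (1 - e) ^ m * \<phi> x" "e < 1" "0 < e"
    using eventually_happens'[OF trivial_limit_at_right_real] by blast
  obtain r where r: "r > 0" "\<And>y. y \<in> Rn N \<Longrightarrow> (\<And>i. i < N \<Longrightarrow> \<bar>y i - x i\<bar> \<le> r) \<Longrightarrow> y \<in> \<Omega>"
    using openin_Rn_nbhd[OF open_dom, of x] x by blast
  show "\<exists>q>0. \<forall>y\<in>Rn N. (\<forall>i<N. \<bar>y i - x i\<bar> \<le> q) \<longrightarrow> y \<in> {x \<in> \<Omega>. c < \<phi> x}"
  proof (intro exI[of _ "e * r"] conjI ballI impI)
    show "e * r > 0" using e r by simp
    fix y assume y: "y \<in> Rn N" "\<forall>i<N. \<bar>y i - x i\<bar> \<le> e * r"
    define z where "z = lc N (1 - 1 / e) x (1 / e) y"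
    have z: "z \<in> \<Omega>"
    proof (rule r(2))
      fix i assume i: "i < N"
      have "z i - x i = (y i - x i) / e" using i e by (simp add: z_def field_simps)
      moreover have "\<bar>(y i - x i) / e\<bar> \<le> r" using y(2)[rule_format, OF i] e by (simp add: abs_divide pos_divide_le_eq mult.commute)
      ultimately show "\<bar>z i - x i\<bar> \<le> r" by simp
    qed (simp add: z_def)
    have "y = lc N (1 - e) x e z"
      by (rule Rn_eqI[of _ N]) (use y e in \<open>auto simp: z_def field_simps\<close>)
    then have "y \<in> \<Omega>" "(1 - e) ^ m * \<phi> x \<le> \<phi> y" using dom_lc[OF _ z, of x e] weight_lower[OF _ z, of x e] x e by auto
    then show "y \<in> {x \<in> \<Omega>. c < \<phi> x}" using e by auto
  qed
qed (use dom_subset in auto)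

definition rho :: "(nat \<Rightarrow> real) \<Rightarrow> real" where "rho x = indicator \<Omega> x * \<phi> x"

lemma rho_nonneg: "0 \<le> rho x"
  using weight_pos by (auto simp: rho_def indicator_def less_imp_le)

lemma rho_measurable [measurable]: "rho \<in> borel_measurable (LB N)"
proof (rule borel_measurableI_greater)
  fix c :: real
  show "{x \<in> space (LB N). c < rho x} \<in> sets (LB N)"
  proof (cases "0 \<le> c")
    case True
    then have "{x \<in> space (LB N). c < rho x} = {x \<in> \<Omega>. c < \<phi> x}"
      using dom_subset by (auto simp: rho_def indicator_def split: if_splits)
    then show ?thesis using openin_in_sets_LB[OF weight_superlevel_open[OF True]] by simp
  next
    case False
    then have "{x \<in> space (LB N). c < rho x} = space (LB N)"
      using less_le_trans[OF _ rho_nonneg, of c] by auto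
    then show ?thesis using sets.top[of "LB N"] by simp
  qed
qed

lemma coordinate_dist: "i < N \<Longrightarrow> \<bar>x i - y i\<bar> \<le> Rn_dist N x y"
  using member_le_L2_set[of "{..<N}" i "\<lambda>i. \<bar>x i - y i\<bar>"] by (simp add: Rn_dist_def L2_set_def)

lemma dist_le_diameter:
  assumes "x \<in> \<Omega>" "y \<in> \<Omega>"
  shows "Rn_dist N x y \<le> Rn_diameter N \<Omega>"
proof -
  obtain B where "\<And>x y. x \<in> \<Omega> \<Longrightarrow> y \<in> \<Omega> \<Longrightarrow> Rn_dist N x y \<le> B" using bounded_dom unfolding Rn_bounded_def by blast
  then have "bdd_above ((\<lambda>(x, y). Rn_dist N x y) ` (\<Omega> \<times> \<Omega>))" by (auto intro!: bdd_aboveI)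
  then have "(\<lambda>(x, y). Rn_dist N x y) (x, y) \<le> (SUP (x, y)\<in>\<Omega> \<times> \<Omega>. Rn_dist N x y)"
    using assms by (intro cSUP_upper) auto
  then show ?thesis using nonempty_dom by (simp add: Rn_diameter_def)
qed

text \<open>
  The point \<open>x\<^sub>0\<close> lies on the segment from \<open>x\<close> to a point \<open>z\<close> slightly behind \<open>x\<^sub>0\<close>, in a
  proportion that does not depend on \<open>x\<close> because \<open>\<Omega>\<close> is bounded. The weight at \<open>x\<^sub>0\<close> therefore controls
  the weight at \<open>x\<close>.
\<close>

lemma weight_bounded: "\<exists>B. \<forall>x\<in>\<Omega>. \<phi> x \<le> B"
proof -
  obtain x0 where x0: "x0 \<in> \<Omega>" using nonempty_dom by blast
  obtain r where r: "r > 0" "\<And>y. y \<in> Rn N \<Longrightarrow> (\<And>i. i < N \<Longrightarrow> \<bar>y i - x0 i\<bar> \<le> r) \<Longrightarrow> y \<in> \<Omega>"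
    using openin_Rn_nbhd[OF open_dom x0] by blast
  define b where "b = max 1 (Rn_diameter N \<Omega>)"
  \<comment> \<open>With \<open>z = x0 + q (x0 - x)\<close> one has \<open>x0 = s x + (1 - s) z\<close>; the choice of \<open>q\<close> keeps \<open>z\<close> within \<open>r\<close> of \<open>x0\<close>.\<close>
  define q where "q = r / b"
  define s where "s = q / (1 + q)"
  have b: "b > 0" by (simp add: b_def)
  have q: "q > 0" using r b by (simp add: q_def)
  have s: "0 < s" "s < 1" "1 - s = 1 / (1 + q)" using q by (auto simp: s_def field_simps)
  have "\<phi> x \<le> \<phi> x0 / s ^ m" if x: "x \<in> \<Omega>" for x
  proof -
    define z where "z = lc N (1 + q) x0 (- q) x"
    have z: "z \<in> \<Omega>"
    proof (rule r(2))
      fix i assume i: "i < N"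
      have "\<bar>x0 i - x i\<bar> \<le> b" using coordinate_dist[OF i, of x0 x] dist_le_diameter[OF x0 x] by (simp add: b_def)
      then have "q * \<bar>x0 i - x i\<bar> \<le> q * b" using q by (intro mult_left_mono) auto
      also have "\<dots> = r" using b by (simp add: q_def)
      finally have "\<bar>q * (x0 i - x i)\<bar> \<le> r" using q by (simp add: abs_mult)
      moreover have "z i - x0 i = q * (x0 i - x i)" using i by (simp add: z_def algebra_simps)
      ultimately show "\<bar>z i - x0 i\<bar> \<le> r" by simp
    qed (simp add: z_def)
    have "x0 = lc N s x (1 - s) z"
    proof (rule Rn_eqI[of _ N])
      fix i assume i: "i < N"
      have "1 / (1 + q) * ((1 + q) * x0 i + - q * x i) = x0 i - s * x i"
        using q by (simp add: s_def diff_divide_distrib)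
      then show "x0 i = lc N s x (1 - s) z i" unfolding s(3) using i by (simp add: z_def)
    qed (use x0 dom_subset in auto)
    then have "s ^ m * \<phi> x \<le> \<phi> x0" using weight_lower[OF x z, of "1 - s"] s(1,2) by simp
    then show ?thesis using s by (simp add: field_simps)
  qed
  then show ?thesis by blast
qed

lemma emeasure_dom_finite: "emeasure (LB N) \<Omega> < \<infinity>"
proof -
  obtain x0 where x0: "x0 \<in> \<Omega>" using nonempty_dom by blast
  define b where "b = Rn_diameter N \<Omega>"
  have "\<Omega> \<subseteq> closed_box N (\<lambda>i. x0 i - b) (\<lambda>i. x0 i + b)"
  proof
    fix x assume x: "x \<in> \<Omega>"
    have "\<bar>x i - x0 i\<bar> \<le> b" if "i < N" for i
      using coordinate_dist[OF that, of x x0] dist_le_diameter[OF x x0] by (simp add: b_def)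
    then show "x \<in> closed_box N (\<lambda>i. x0 i - b) (\<lambda>i. x0 i + b)"
      using x dom_subset by (auto simp: mem_closed_box abs_le_iff algebra_simps)
  qed
  then have "emeasure (LB N) \<Omega> \<le> emeasure (LB N) (closed_box N (\<lambda>i. x0 i - b) (\<lambda>i. x0 i + b))"
    by (intro emeasure_mono) auto
  then show ?thesis using emeasure_closed_box_finite le_less_trans by blast
qed

lemma emeasure_dom_pos: "0 < emeasure (LB N) \<Omega>"
proof -
  obtain x where x: "x \<in> \<Omega>" using nonempty_dom by blast
  obtain r where r: "r > 0" "\<And>y. y \<in> Rn N \<Longrightarrow> (\<And>i. i < N \<Longrightarrow> \<bar>y i - x i\<bar> \<le> r) \<Longrightarrow> y \<in> \<Omega>"
    using openin_Rn_nbhd[OF open_dom x] by blast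
  have "open_box N (\<lambda>i. x i - r) (\<lambda>i. x i + r) \<subseteq> \<Omega>"
  proof
    fix y assume y: "y \<in> open_box N (\<lambda>i. x i - r) (\<lambda>i. x i + r)"
    show "y \<in> \<Omega>" using y by (intro r(2)) (auto simp: mem_open_box abs_le_iff algebra_simps less_imp_le)
  qed
  then have "emeasure (LB N) (open_box N (\<lambda>i. x i - r) (\<lambda>i. x i + r)) \<le> emeasure (LB N) \<Omega>"
    by (intro emeasure_mono) auto
  then show ?thesis using emeasure_open_box_pos[of N "\<lambda>i. x i - r" "\<lambda>i. x i + r"] r(1) less_le_trans by fastforce
qed

lemma not_AE_outside_dom: "\<not> (AE x in LB N. x \<notin> \<Omega>)"
proof
  assume "AE x in LB N. x \<notin> \<Omega>"
  then have "emeasure (LB N) \<Omega> = 0" by (subst (asm) AE_iff_measurable[OF dom_sets]) (use dom_subset in auto)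
  then show False using emeasure_dom_pos by simp
qed

lemma integrable_rho: "integrable (LB N) rho"
proof -
  obtain B where B: "\<And>x. x \<in> \<Omega> \<Longrightarrow> \<phi> x \<le> B" using weight_bounded by blast
  have "integrable (LB N) (\<lambda>x. B * indicator \<Omega> x :: real)" using emeasure_dom_finite by auto
  then show ?thesis
  proof (rule Bochner_Integration.integrable_bound)
    show "AE x in LB N. norm (rho x) \<le> norm (B * indicator \<Omega> x :: real)"
      using B weight_pos by (intro AE_I2) (fastforce simp: rho_def indicator_def)
  qed measurable
qed

definition nu :: "(nat \<Rightarrow> real) measure" where "nu = density (LB N) (\<lambda>x. ennreal (rho x))"

lemma sets_nu [measurable_cong, simp]: "sets nu = sets (LB N)"
  by (simp add: nu_def)

lemma space_nu [simp]: "space nu = Rn N"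
  by (simp add: nu_def)

lemma nn_integral_nu: "f \<in> borel_measurable (LB N) \<Longrightarrow> (\<integral>\<^sup>+x. f x \<partial>nu) = (\<integral>\<^sup>+x. ennreal (rho x) * f x \<partial>LB N)"
  unfolding nu_def by (subst nn_integral_density) auto

lemma AE_nu_iff: "(AE x in nu. P x) \<longleftrightarrow> (AE x in LB N. x \<in> \<Omega> \<longrightarrow> P x)"
proof -
  have "0 < ennreal (rho x) \<longleftrightarrow> x \<in> \<Omega>" for x
    using weight_pos by (auto simp: rho_def indicator_def)
  then show ?thesis unfolding nu_def by (subst AE_density) auto
qed

lemma AE_nu_dom: "AE x in nu. x \<in> \<Omega>"
  by (simp add: AE_nu_iff)

lemma emeasure_nu_space: "emeasure nu (Rn N) = ennreal (LINT x|LB N. rho x)"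
proof -
  have "emeasure nu (Rn N) = (\<integral>\<^sup>+x. ennreal (rho x) * indicator (Rn N) x \<partial>LB N)"
    unfolding nu_def using sets.top[of "LB N"] by (subst emeasure_density) auto
  also have "\<dots> = (\<integral>\<^sup>+x. ennreal (rho x) \<partial>LB N)" by (intro nn_integral_cong) (auto simp: indicator_def)
  also have "\<dots> = ennreal (LINT x|LB N. rho x)"
    using integrable_rho rho_nonneg by (intro nn_integral_eq_integral) auto
  finally show ?thesis .
qed

definition vol :: real where "vol = (LINT x|LB N. rho x)"

lemma emeasure_nu: "emeasure nu (Rn N) = ennreal vol"
  by (simp add: emeasure_nu_space vol_def)

lemma vol_pos: "0 < vol"
proof -
  have "vol \<ge> 0" unfolding vol_def using rho_nonneg by (intro Bochner_Integration.integral_nonneg) auto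
  moreover have "vol \<noteq> 0"
  proof
    assume "vol = 0"
    then have "AE x in LB N. rho x = 0"
      unfolding vol_def using integral_nonneg_eq_0_iff_AE[OF integrable_rho] rho_nonneg by auto
    then have "AE x in LB N. x \<notin> \<Omega>"
      by eventually_elim (use weight_pos in \<open>force simp: rho_def\<close>)
    then show False using not_AE_outside_dom by contradiction
  qed
  ultimately show ?thesis by simp
qed

lemma finite_measure_nu: "finite_measure nu"
  by standard (simp add: emeasure_nu)

sublocale nu: finite_measure nu by (rule finite_measure_nu)
sublocale nunu: pair_sigma_finite nu nu ..
sublocale nuU: pair_sigma_finite nu U01 ..

text \<open>
  The dimension in which the weighted measure scales.
\<close>

definition hdim :: nat where "hdim = N + m"

text \<open>
  The weight at the contracted point has lost at most the factor \<open>(1 - s)\<^sup>m\<close>, and the change of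
  variables contributes \<open>(1 - s)\<^sup>N\<close>.
\<close>

lemma contraction:
  assumes y: "y \<in> \<Omega>" and s: "0 \<le> s" "s < 1" and [measurable]: "f \<in> borel_measurable (LB N)"
  shows "ennreal ((1 - s) ^ hdim) * (\<integral>\<^sup>+x. f (lc N (1 - s) x s y) \<partial>nu) \<le> (\<integral>\<^sup>+x. f x \<partial>nu)"
proof -
  let ?T = "\<lambda>x. lc N (1 - s) x s y"
  have "ennreal ((1 - s) ^ hdim) * (\<integral>\<^sup>+x. f (?T x) \<partial>nu) =
      ennreal ((1 - s) ^ N) * (ennreal ((1 - s) ^ m) * (\<integral>\<^sup>+x. ennreal (rho x) * f (?T x) \<partial>LB N))"
    using s by (subst nn_integral_nu) (auto simp: hdim_def power_add ennreal_mult mult_ac)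
  also have "\<dots> = ennreal ((1 - s) ^ N) * (\<integral>\<^sup>+x. ennreal ((1 - s) ^ m) * (ennreal (rho x) * f (?T x)) \<partial>LB N)"
    by (subst nn_integral_cmult) auto
  also have "\<dots> \<le> ennreal ((1 - s) ^ N) * (\<integral>\<^sup>+x. ennreal (rho (?T x)) * f (?T x) \<partial>LB N)"
  proof (intro mult_left_mono nn_integral_mono)
    fix x
    have "(1 - s) ^ m * rho x \<le> rho (?T x)"
    proof (cases "x \<in> \<Omega>")
      case True
      then show ?thesis using weight_lower[OF True y, of s] dom_lc[OF True y, of s] s by (simp add: rho_def)
    qed (simp add: rho_def rho_nonneg[unfolded rho_def])
    then have "ennreal ((1 - s) ^ m) * ennreal (rho x) \<le> ennreal (rho (?T x))"
      using s rho_nonneg by (subst ennreal_mult[symmetric]) (auto intro: ennreal_leI)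
    then show "ennreal ((1 - s) ^ m) * (ennreal (rho x) * f (?T x)) \<le> ennreal (rho (?T x)) * f (?T x)"
      by (simp add: mult.assoc[symmetric] mult_right_mono)
  qed auto
  also have "\<dots> = (\<integral>\<^sup>+x. ennreal (rho x) * f x \<partial>LB N)"
    using nn_integral_lc[of "1 - s" "\<lambda>x. ennreal (rho x) * f x" N s y] s by simp
  also have "\<dots> = (\<integral>\<^sup>+x. f x \<partial>nu)" by (simp add: nn_integral_nu)
  finally show ?thesis .
qed

text \<open>
  One of the coefficients \<open>1 - s\<close> and \<open>s\<close> is at least one half, and the contraction is applied in
  the corresponding variable.
\<close>

lemma two_point_contraction:
  assumes s: "s \<in> {0..1}" and [measurable]: "f \<in> borel_measurable (LB N)"
  shows "(\<integral>\<^sup>+x. \<integral>\<^sup>+y. f (lc N (1 - s) x s y) \<partial>nu \<partial>nu) \<le> ennreal (2 ^ hdim * vol) * (\<integral>\<^sup>+x. f x \<partial>nu)"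
proof -
  have half: "(\<integral>\<^sup>+x. f (lc N (1 - s) x s y) \<partial>nu) \<le> ennreal (2 ^ hdim) * (\<integral>\<^sup>+x. f x \<partial>nu)"
    if "y \<in> \<Omega>" "0 \<le> s" "s \<le> 1 / 2" for s y
  proof -
    have "1 \<le> 2 ^ hdim * (1 - s) ^ hdim" using that one_le_power[of "2 * (1 - s)" hdim] by (simp add: power_mult_distrib[symmetric])
    then have "1 * (\<integral>\<^sup>+x. f (lc N (1 - s) x s y) \<partial>nu) \<le> ennreal (2 ^ hdim * (1 - s) ^ hdim) * (\<integral>\<^sup>+x. f (lc N (1 - s) x s y) \<partial>nu)"
      by (intro mult_right_mono) auto
    also have "\<dots> = ennreal (2 ^ hdim) * (ennreal ((1 - s) ^ hdim) * (\<integral>\<^sup>+x. f (lc N (1 - s) x s y) \<partial>nu))"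
      using that by (simp add: ennreal_mult mult.assoc)
    also have "\<dots> \<le> ennreal (2 ^ hdim) * (\<integral>\<^sup>+x. f x \<partial>nu)"
      using that by (intro mult_left_mono contraction) auto
    finally show ?thesis by simp
  qed
  have const: "(\<integral>\<^sup>+y. ennreal (2 ^ hdim) * (\<integral>\<^sup>+x. f x \<partial>nu) \<partial>nu) = ennreal (2 ^ hdim * vol) * (\<integral>\<^sup>+x. f x \<partial>nu)"
    using vol_pos by (simp add: emeasure_nu ennreal_mult mult_ac)
  show ?thesis
  proof (cases "s \<le> 1 / 2")
    case True
    have "(\<integral>\<^sup>+x. \<integral>\<^sup>+y. f (lc N (1 - s) x s y) \<partial>nu \<partial>nu) = (\<integral>\<^sup>+y. \<integral>\<^sup>+x. f (lc N (1 - s) x s y) \<partial>nu \<partial>nu)"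
      by (rule nunu.Fubini') measurable
    also have "\<dots> \<le> (\<integral>\<^sup>+y. ennreal (2 ^ hdim) * (\<integral>\<^sup>+x. f x \<partial>nu) \<partial>nu)"
      using AE_nu_dom
    proof (intro nn_integral_mono_AE, eventually_elim)
      case (elim y)
      then show ?case using True s by (intro half) auto
    qed
    finally show ?thesis unfolding const .
  next
    case False
    have "(\<integral>\<^sup>+x. \<integral>\<^sup>+y. f (lc N (1 - s) x s y) \<partial>nu \<partial>nu) = (\<integral>\<^sup>+x. \<integral>\<^sup>+y. f (lc N (1 - (1 - s)) y (1 - s) x) \<partial>nu \<partial>nu)"
      by (subst lc_swap) simp
    also have "\<dots> \<le> (\<integral>\<^sup>+x. ennreal (2 ^ hdim) * (\<integral>\<^sup>+x. f x \<partial>nu) \<partial>nu)"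
      using AE_nu_dom
    proof (intro nn_integral_mono_AE, eventually_elim)
      case (elim x)
      then show ?case using False s by (intro half) auto
    qed
    finally show ?thesis unfolding const .
  qed
qed

end

section \<open>The segment, Poincare and Nash inequalities\<close>

lemma ennreal_square_mean_le:
  fixes q :: "real \<Rightarrow> real"
  assumes q: "q \<in> borel_measurable U01"
  shows "ennreal ((LINT s|U01. q s)\<^sup>2) \<le> (\<integral>\<^sup>+s. ennreal ((q s)\<^sup>2) \<partial>U01)"
proof (cases "(\<integral>\<^sup>+s. ennreal ((q s)\<^sup>2) \<partial>U01) = \<infinity>")
  case False
  then have "integrable U01 (\<lambda>s. (q s)\<^sup>2)" using q by (intro integrableI_bounded) (auto simp: less_top)
  then show ?thesis using square_mean_le[OF _ q] by (simp add: nn_integral_eq_integral ennreal_leI)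
qed simp

lemma ennreal_add_square_le: "((a::ennreal) + b)\<^sup>2 \<le> 2 * a\<^sup>2 + 2 * b\<^sup>2"
proof (cases "a = top \<or> b = top")
  case True
  then show ?thesis by (auto simp: power2_eq_square ennreal_mult_top)
next
  case False
  then obtain p q where pq: "a = ennreal p" "b = ennreal q" "p \<ge> 0" "q \<ge> 0"
    by (metis ennreal_cases)
  have "(p + q)\<^sup>2 \<le> 2 * p\<^sup>2 + 2 * q\<^sup>2"
    using zero_le_power2[of "p - q"] by (simp add: power2_eq_square algebra_simps)
  then have "ennreal ((p + q)\<^sup>2) \<le> ennreal (2 * p\<^sup>2 + 2 * q\<^sup>2)" by (rule ennreal_leI)
  moreover have "ennreal (2 * p\<^sup>2 + 2 * q\<^sup>2) = 2 * a\<^sup>2 + 2 * b\<^sup>2"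
    using pq by (simp add: ennreal_mult ennreal_power)
  moreover have "ennreal ((p + q)\<^sup>2) = (a + b)\<^sup>2"
    using pq by (simp add: ennreal_plus[symmetric] ennreal_power del: ennreal_plus)
  ultimately show ?thesis by simp
qed

context weighted_domain
begin

definition energy :: "(nat \<Rightarrow> (nat \<Rightarrow> real) \<Rightarrow> real) \<Rightarrow> ennreal" where
  "energy G = (\<integral>\<^sup>+x. ennreal (\<Sum>i<N. (G i x)\<^sup>2) \<partial>nu)"

abbreviation (input) diam :: real where "diam \<equiv> Rn_diameter N \<Omega>"

lemma diam_nonneg: "0 \<le> diam"
proof -
  obtain x where "x \<in> \<Omega>" using nonempty_dom by blast
  then have "Rn_dist N x x \<le> diam" by (intro dist_le_diameter)
  then show ?thesis by (simp add: Rn_dist_def L2_set_def)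
qed

text \<open>
  The exceptional null set in \<open>sobolev_FTC\<close> depends on the translation \<open>h\<close>. Fubini's theorem exchanges
  the two variables, and for fixed \<open>x\<close> the affine map \<open>y \<mapsto> t (y - x)\<close> pulls null sets back to null
  sets.
\<close>

lemma segment_FTC:
  assumes P: "sobolev_pair N \<Omega> v G" and t: "0 < t"
  shows "AE x in LB N. AE y in LB N. x \<in> \<Omega> \<longrightarrow> lc N (1 - t) x t y \<in> \<Omega> \<longrightarrow>
    v (lc N (1 - t) x t y) - v x = (LINT s|U01. (\<Sum>i<N. t * (y i - x i) * G i (lc N (1 - s * t) x (s * t) y)))"
proof -
  have v [measurable]: "v \<in> borel_measurable (LB N)" using sobolev_pairD(1)[OF P] .
  let ?A = "\<lambda>h x. LINT s|U01. (\<Sum>i<N. h i * G i (lc N 1 x s h))"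
  let ?P = "\<lambda>h x. x \<in> \<Omega> \<longrightarrow> lc N 1 x 1 h \<in> \<Omega> \<longrightarrow> v (lc N 1 x 1 h) - v x = ?A h x"
  have mA [measurable]: "(\<lambda>p. ?A (fst p) (snd p)) \<in> borel_measurable (LB N \<Otimes>\<^sub>M LB N)"
  proof (rule U01.borel_measurable_lebesgue_integral)
    have "(\<lambda>p. (fst (fst p)) i * G i (lc N 1 (snd (fst p)) (snd p) (fst (fst p)))) \<in> borel_measurable ((LB N \<Otimes>\<^sub>M LB N) \<Otimes>\<^sub>M U01)"
      if i: "i < N" for i
    proof -
      note [measurable] = sobolev_pairD(2)[OF P i] measurable_component_LB[OF i]
      show ?thesis by measurable
    qed
    then show "(\<lambda>(p, s). \<Sum>i<N. fst p i * G i (lc N 1 (snd p) s (fst p))) \<in> borel_measurable ((LB N \<Otimes>\<^sub>M LB N) \<Otimes>\<^sub>M U01)"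
      unfolding split_beta' by (intro borel_measurable_sum) simp
  qed
  have meas: "{p \<in> space (LB N \<Otimes>\<^sub>M LB N). ?P (fst p) (snd p)} \<in> sets (LB N \<Otimes>\<^sub>M LB N)"
    by measurable
  have "AE h in LB N. AE x in LB N. ?P h x"
    by (rule AE_I2) (rule sobolev_FTC[OF open_dom convex_dom P])
  then have "AE x in LB N. AE h in LB N. ?P h x" by (subst (asm) LBLB.AE_commute[OF meas])
  then show ?thesis
  proof eventually_elim
    case (elim x)
    from AE_lc[OF _ elim, of t "- t" x] t
    have "AE y in LB N. ?P (lc N t y (- t) x) x" by simp
    then show ?case
    proof eventually_elim
      case (elim y)
      have l: "lc N 1 x s (lc N t y (- t) x) = lc N (1 - s * t) x (s * t) y" for s
        by (rule Rn_eqI[of _ N]) (auto simp: algebra_simps)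
      have "(\<Sum>i<N. lc N t y (- t) x i * G i z) = (\<Sum>i<N. t * (y i - x i) * G i z)" for z
        by (intro sum.cong) (auto simp: algebra_simps)
      then show ?case using elim by (simp add: l)
    qed
  qed
qed

text \<open>
  The increment is a mean of \<open>t (y - x)\<close> applied to the gradient at the points
  \<open>(1 - s t) x + s t y\<close>. For each \<open>s\<close> the double integral over \<open>x\<close> and \<open>y\<close> is estimated by
  \<open>two_point_contraction\<close>.
\<close>

lemma segment_inequality:
  assumes P: "sobolev_pair N \<Omega> v G" and t: "0 < t" "t \<le> 1"
  shows "(\<integral>\<^sup>+x. \<integral>\<^sup>+y. ennreal ((v (lc N (1 - t) x t y) - v x)\<^sup>2) \<partial>nu \<partial>nu)
    \<le> ennreal (t\<^sup>2 * diam\<^sup>2 * 2 ^ hdim * vol) * energy G"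
proof -
  have [measurable]: "v \<in> borel_measurable (LB N)" using sobolev_pairD(1)[OF P] .
  define \<Gamma> where "\<Gamma> z = ennreal (\<Sum>i<N. (G i z)\<^sup>2)" for z
  have [measurable]: "\<Gamma> \<in> borel_measurable (LB N)"
    unfolding \<Gamma>_def[abs_def] using sobolev_pairD(2)[OF P]
    by (intro measurable_compose[OF _ measurable_ennreal] borel_measurable_sum borel_measurable_power) auto
  let ?c = "ennreal (t\<^sup>2 * diam\<^sup>2)"
  have "AE x in nu. AE y in nu. ennreal ((v (lc N (1 - t) x t y) - v x)\<^sup>2)
      \<le> ?c * (\<integral>\<^sup>+s. \<Gamma> (lc N (1 - s * t) x (s * t) y) \<partial>U01)"
    unfolding AE_nu_iff using segment_FTC[OF P t(1)]
  proof eventually_elim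
    case (elim x)
    show ?case
    proof
      assume x: "x \<in> \<Omega>"
      from elim show "AE y in LB N. y \<in> \<Omega> \<longrightarrow> ennreal ((v (lc N (1 - t) x t y) - v x)\<^sup>2)
          \<le> ?c * (\<integral>\<^sup>+s. \<Gamma> (lc N (1 - s * t) x (s * t) y) \<partial>U01)"
        using AE_space
      proof eventually_elim
        case (elim y)
        show ?case
        proof
          assume y: "y \<in> \<Omega>"
          define q where "q s = (\<Sum>i<N. t * (y i - x i) * G i (lc N (1 - s * t) x (s * t) y))" for s
          have [measurable]: "q \<in> borel_measurable U01"
            unfolding q_def[abs_def]
          proof (intro borel_measurable_sum borel_measurable_times measurable_const)
            fix i assume "i \<in> {..<N}"
            then have [measurable]: "G i \<in> borel_measurable (LB N)" using sobolev_pairD(2)[OF P] by simp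
            have "y \<in> space (LB N)" using elim(2) .
            then show "(\<lambda>s. G i (lc N (1 - s * t) x (s * t) y)) \<in> borel_measurable U01" by measurable
          qed simp_all
          have "lc N (1 - t) x t y \<in> \<Omega>" using dom_lc[OF x y] t by simp
          then have "(v (lc N (1 - t) x t y) - v x)\<^sup>2 = (LINT s|U01. q s)\<^sup>2"
            using elim(1) x by (simp add: q_def)
          also have "ennreal \<dots> \<le> (\<integral>\<^sup>+s. ennreal ((q s)\<^sup>2) \<partial>U01)" by (rule ennreal_square_mean_le) measurable
          also have "\<dots> \<le> (\<integral>\<^sup>+s. ?c * \<Gamma> (lc N (1 - s * t) x (s * t) y) \<partial>U01)"
          proof (rule nn_integral_mono)
            fix s
            let ?z = "lc N (1 - s * t) x (s * t) y"
            have "(q s)\<^sup>2 \<le> (\<Sum>i<N. (t * (y i - x i))\<^sup>2) * (\<Sum>i<N. (G i ?z)\<^sup>2)"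
              unfolding q_def by (rule Cauchy_Schwarz_ineq_sum)
            also have "(\<Sum>i<N. (t * (y i - x i))\<^sup>2) = t\<^sup>2 * (Rn_dist N y x)\<^sup>2"
              by (simp add: Rn_dist_def L2_set_def sum_nonneg power_mult_distrib sum_distrib_left)
            also have "t\<^sup>2 * (Rn_dist N y x)\<^sup>2 * (\<Sum>i<N. (G i ?z)\<^sup>2) \<le> t\<^sup>2 * diam\<^sup>2 * (\<Sum>i<N. (G i ?z)\<^sup>2)"
              using dist_le_diameter[OF y x] by (intro mult_right_mono mult_left_mono power_mono sum_nonneg) (auto simp: Rn_dist_def)
            finally show "ennreal ((q s)\<^sup>2) \<le> ?c * \<Gamma> ?z"
              unfolding \<Gamma>_def by (subst ennreal_mult[symmetric]) (auto intro!: ennreal_leI sum_nonneg)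
          qed
          also have "\<dots> = ?c * (\<integral>\<^sup>+s. \<Gamma> (lc N (1 - s * t) x (s * t) y) \<partial>U01)"
            using elim(2) by (intro nn_integral_cmult) measurable
          finally show "ennreal ((v (lc N (1 - t) x t y) - v x)\<^sup>2)
            \<le> ?c * (\<integral>\<^sup>+s. \<Gamma> (lc N (1 - s * t) x (s * t) y) \<partial>U01)" .
        qed
      qed
    qed
  qed
  then have "(\<integral>\<^sup>+x. \<integral>\<^sup>+y. ennreal ((v (lc N (1 - t) x t y) - v x)\<^sup>2) \<partial>nu \<partial>nu) \<le>
     (\<integral>\<^sup>+x. \<integral>\<^sup>+y. ?c * (\<integral>\<^sup>+s. \<Gamma> (lc N (1 - s * t) x (s * t) y) \<partial>U01) \<partial>nu \<partial>nu)"
    by (intro nn_integral_mono_AE, eventually_elim) (rule nn_integral_mono_AE)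
  also have "\<dots> = ?c * (\<integral>\<^sup>+x. \<integral>\<^sup>+y. \<integral>\<^sup>+s. \<Gamma> (lc N (1 - s * t) x (s * t) y) \<partial>U01 \<partial>nu \<partial>nu)"
    by (simp add: nn_integral_cmult)
  also have "(\<integral>\<^sup>+x. \<integral>\<^sup>+y. \<integral>\<^sup>+s. \<Gamma> (lc N (1 - s * t) x (s * t) y) \<partial>U01 \<partial>nu \<partial>nu) =
     (\<integral>\<^sup>+x. \<integral>\<^sup>+s. \<integral>\<^sup>+y. \<Gamma> (lc N (1 - s * t) x (s * t) y) \<partial>nu \<partial>U01 \<partial>nu)"
    by (intro nn_integral_cong nuU.Fubini'[symmetric]) measurable
  also have "\<dots> = (\<integral>\<^sup>+s. \<integral>\<^sup>+x. \<integral>\<^sup>+y. \<Gamma> (lc N (1 - s * t) x (s * t) y) \<partial>nu \<partial>nu \<partial>U01)"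
    by (rule nuU.Fubini'[symmetric]) measurable
  also have "\<dots> \<le> (\<integral>\<^sup>+s. ennreal (2 ^ hdim * vol) * (\<integral>\<^sup>+x. \<Gamma> x \<partial>nu) \<partial>U01)"
  proof (rule nn_integral_mono)
    fix s assume "s \<in> space U01"
    then have "s * t \<in> {0..1}" using t by (auto intro: mult_le_one)
    then show "(\<integral>\<^sup>+x. \<integral>\<^sup>+y. \<Gamma> (lc N (1 - s * t) x (s * t) y) \<partial>nu \<partial>nu) \<le> ennreal (2 ^ hdim * vol) * (\<integral>\<^sup>+x. \<Gamma> x \<partial>nu)"
      by (rule two_point_contraction) measurable
  qed
  also have "\<dots> = ennreal (2 ^ hdim * vol) * energy G"
    using U01.emeasure_space_1 by (simp add: energy_def \<Gamma>_def)
  also have "?c * (ennreal (2 ^ hdim * vol) * energy G) = ennreal (t\<^sup>2 * diam\<^sup>2 * 2 ^ hdim * vol) * energy G"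
    using vol_pos by (simp add: ennreal_mult mult_ac)
  finally show ?thesis by (simp add: mult_left_mono)
qed

lemma energy_eq:
  assumes "integrable nu (\<lambda>x. \<Sum>i<N. (G i x)\<^sup>2)"
  shows "energy G = ennreal (LINT x|nu. (\<Sum>i<N. (G i x)\<^sup>2))"
  unfolding energy_def using assms by (intro nn_integral_eq_integral) (auto intro!: AE_I2 sum_nonneg)

lemma integrable_nu_of_square:
  fixes v :: "(nat \<Rightarrow> real) \<Rightarrow> real"
  assumes "v \<in> borel_measurable (LB N)" "integrable nu (\<lambda>x. (v x)\<^sup>2)"
  shows "integrable nu v"
  using nu.square_integrable_imp_integrable[of v] assms by simp

lemma measure_nu_space: "measure nu (Rn N) = vol"
  using vol_pos by (simp add: measure_def emeasure_nu)

text \<open>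
  The case \<open>t = 1\<close> of the segment inequality: for mean zero, the double integral of
  \<open>(v y - v x)\<^sup>2\<close> is \<open>2 \<nu>(\<Omega>) \<integral> v\<^sup>2\<close>.
\<close>

lemma poincare:
  assumes P: "sobolev_pair N \<Omega> v G" and v2: "integrable nu (\<lambda>x. (v x)\<^sup>2)"
    and E: "integrable nu (\<lambda>x. \<Sum>i<N. (G i x)\<^sup>2)" and mean: "(LINT x|nu. v x) = 0"
  shows "2 * (LINT x|nu. (v x)\<^sup>2) \<le> diam\<^sup>2 * 2 ^ hdim * (LINT x|nu. (\<Sum>i<N. (G i x)\<^sup>2))"
proof -
  have [measurable]: "v \<in> borel_measurable (LB N)" using sobolev_pairD(1)[OF P] .
  have v1: "integrable nu v" by (rule integrable_nu_of_square) (use v2 in auto)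
  define Q where "Q = (LINT x|nu. (v x)\<^sup>2)"
  define e where "e = (LINT x|nu. (\<Sum>i<N. (G i x)\<^sup>2))"
  have Q0: "0 \<le> Q" by (simp add: Q_def)
  have e0: "0 \<le> e" unfolding e_def by (intro Bochner_Integration.integral_nonneg sum_nonneg) auto
  have inner: "(\<integral>\<^sup>+y. ennreal ((v y - v x)\<^sup>2) \<partial>nu) = ennreal (Q + vol * (v x)\<^sup>2)" for x
  proof -
    have eq: "(v y - v x)\<^sup>2 = (v y)\<^sup>2 - 2 * v x * v y + (v x)\<^sup>2" for y by (simp add: power2_eq_square algebra_simps)
    have "integrable nu (\<lambda>y. (v y - v x)\<^sup>2)" unfolding eq using v1 v2 by simp
    then have "(\<integral>\<^sup>+y. ennreal ((v y - v x)\<^sup>2) \<partial>nu) = ennreal (LINT y|nu. (v y - v x)\<^sup>2)"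
      by (intro nn_integral_eq_integral) auto
    also have "(LINT y|nu. (v y - v x)\<^sup>2) = Q + vol * (v x)\<^sup>2"
      unfolding eq using v1 v2 mean by (simp add: Q_def measure_nu_space)
    finally show ?thesis .
  qed
  have "ennreal (2 * vol * Q) = (\<integral>\<^sup>+x. ennreal (Q + vol * (v x)\<^sup>2) \<partial>nu)"
  proof -
    have "(\<integral>\<^sup>+x. ennreal (Q + vol * (v x)\<^sup>2) \<partial>nu) = ennreal (LINT x|nu. Q + vol * (v x)\<^sup>2)"
      using v2 Q0 vol_pos by (intro nn_integral_eq_integral) auto
    also have "(LINT x|nu. Q + vol * (v x)\<^sup>2) = 2 * vol * Q"
      using v2 by (simp add: measure_nu_space Q_def)
    finally show ?thesis by simp
  qed
  also have "\<dots> = (\<integral>\<^sup>+x. \<integral>\<^sup>+y. ennreal ((v y - v x)\<^sup>2) \<partial>nu \<partial>nu)" by (simp add: inner)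
  also have "\<dots> = (\<integral>\<^sup>+x. \<integral>\<^sup>+y. ennreal ((v (lc N (1 - 1) x 1 y) - v x)\<^sup>2) \<partial>nu \<partial>nu)"
  proof (rule nn_integral_cong, rule nn_integral_cong)
    fix x y assume "y \<in> space nu"
    then have "lc N (1 - 1) x 1 y = y" by (intro Rn_eqI[of _ N]) auto
    then show "ennreal ((v y - v x)\<^sup>2) = ennreal ((v (lc N (1 - 1) x 1 y) - v x)\<^sup>2)" by simp
  qed
  also have "\<dots> \<le> ennreal (1\<^sup>2 * diam\<^sup>2 * 2 ^ hdim * vol) * energy G"
    by (rule segment_inequality[OF P]) auto
  also have "\<dots> = ennreal (diam\<^sup>2 * 2 ^ hdim * vol * e)"
    unfolding energy_eq[OF E] e_def[symmetric] using vol_pos e0 by (simp add: ennreal_mult)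
  finally have "2 * vol * Q \<le> diam\<^sup>2 * 2 ^ hdim * vol * e"
    using vol_pos e0 by (subst (asm) ennreal_le_iff) auto
  then have "vol * (2 * Q) \<le> vol * (diam\<^sup>2 * 2 ^ hdim * e)" by (simp add: mult_ac)
  then show ?thesis using vol_pos by (simp add: Q_def e_def)
qed

text \<open>
  The value \<open>v x\<close> is the mean over \<open>y\<close> of \<open>v(z)\<close> plus the mean of \<open>v x - v(z)\<close>, where
  \<open>z = (1 - t) x + t y\<close>. The first mean is bounded by \<open>contraction\<close> towards \<open>x\<close>, the second by the
  segment inequality.
\<close>

lemma nash:
  assumes P: "sobolev_pair N \<Omega> v G" and v2: "integrable nu (\<lambda>x. (v x)\<^sup>2)"
    and E: "integrable nu (\<lambda>x. \<Sum>i<N. (G i x)\<^sup>2)" and nonneg: "\<And>x. 0 \<le> v x" and t: "0 < t" "t \<le> 1"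
  shows "(LINT x|nu. (v x)\<^sup>2) \<le> 2 * t\<^sup>2 * diam\<^sup>2 * 2 ^ hdim * (LINT x|nu. (\<Sum>i<N. (G i x)\<^sup>2))
     + 2 * (LINT x|nu. v x)\<^sup>2 / (vol * (t ^ hdim)\<^sup>2)"
proof -
  have [measurable]: "v \<in> borel_measurable (LB N)" using sobolev_pairD(1)[OF P] .
  have v1: "integrable nu v" by (rule integrable_nu_of_square) (use v2 in auto)
  define Q where "Q = (LINT x|nu. (v x)\<^sup>2)"
  define e where "e = (LINT x|nu. (\<Sum>i<N. (G i x)\<^sup>2))"
  define I where "I = (LINT x|nu. v x)"
  have Q0: "0 \<le> Q" by (simp add: Q_def)
  have I0: "0 \<le> I" unfolding I_def using nonneg by simp
  have e0: "0 \<le> e" unfolding e_def by (intro Bochner_Integration.integral_nonneg sum_nonneg) auto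
  define z where "z x y = lc N (1 - t) x t y" for x y
  define J where "J = I / t ^ hdim"
  have J0: "0 \<le> J" using I0 t by (simp add: J_def)
  have pw: "AE x in nu. ennreal ((vol * v x)\<^sup>2) \<le>
      ennreal (2 * vol) * (\<integral>\<^sup>+y. ennreal ((v (z x y) - v x)\<^sup>2) \<partial>nu) + ennreal (2 * J\<^sup>2)"
    using AE_nu_dom
  proof eventually_elim
    case (elim x)
    have [measurable]: "z x \<in> measurable (LB N) (LB N)" unfolding z_def[abs_def] by measurable
    define a where "a = (\<integral>\<^sup>+y. ennreal \<bar>v (z x y) - v x\<bar> * 1 \<partial>nu)"
    define b where "b = (\<integral>\<^sup>+y. ennreal (v (z x y)) \<partial>nu)"
    define c where "c = (\<integral>\<^sup>+y. ennreal ((v (z x y) - v x)\<^sup>2) \<partial>nu)"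
    have "a\<^sup>2 \<le> (\<integral>\<^sup>+y. (ennreal \<bar>v (z x y) - v x\<bar>)\<^sup>2 \<partial>nu) * (\<integral>\<^sup>+y. 1\<^sup>2 \<partial>nu)"
      unfolding a_def by (rule Cauchy_Schwarz_nn_integral) measurable
    also have "\<dots> = c * ennreal vol" by (simp add: c_def emeasure_nu ennreal_power)
    finally have a: "a\<^sup>2 \<le> c * ennreal vol" .
    have "ennreal (t ^ hdim) * b \<le> (\<integral>\<^sup>+y. ennreal (v y) \<partial>nu)"
    proof -
      have "z x = (\<lambda>y. lc N (1 - (1 - t)) y (1 - t) x)" by (intro ext) (simp add: z_def lc_swap[of N "1 - t"])
      then show ?thesis unfolding b_def using contraction[OF elim, of "1 - t" "\<lambda>y. ennreal (v y)"] t by simp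
    qed
    also have "\<dots> = ennreal I" unfolding I_def using v1 nonneg by (intro nn_integral_eq_integral) auto
    finally have "ennreal (1 / t ^ hdim) * (ennreal (t ^ hdim) * b) \<le> ennreal (1 / t ^ hdim) * ennreal I" by (rule mult_left_mono) simp
    then have b: "b \<le> ennreal J"
      using t I0 by (simp add: mult.assoc[symmetric] ennreal_mult[symmetric] J_def)
    have "ennreal (vol * v x) = (\<integral>\<^sup>+y. ennreal (v x) \<partial>nu)"
      using nonneg[of x] vol_pos by (simp add: emeasure_nu ennreal_mult mult.commute)
    also have "\<dots> \<le> (\<integral>\<^sup>+y. ennreal \<bar>v (z x y) - v x\<bar> * 1 + ennreal (v (z x y)) \<partial>nu)"
      using nonneg by (intro nn_integral_mono) (auto simp: ennreal_plus[symmetric] intro!: ennreal_leI simp del: ennreal_plus)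
    also have "\<dots> = a + b" unfolding a_def b_def by (rule nn_integral_add) measurable
    finally have "(ennreal (vol * v x))\<^sup>2 \<le> (a + b)\<^sup>2" by (rule power_mono) simp
    also have "\<dots> \<le> 2 * a\<^sup>2 + 2 * b\<^sup>2" by (rule ennreal_add_square_le)
    also have "\<dots> \<le> 2 * (c * ennreal vol) + 2 * (ennreal J)\<^sup>2"
      using a b by (intro add_mono mult_left_mono power_mono) auto
    also have "\<dots> = ennreal (2 * vol) * c + ennreal (2 * J\<^sup>2)"
      using vol_pos J0 by (simp add: ennreal_mult ennreal_power mult_ac)
    finally show ?case using nonneg[of x] vol_pos by (simp add: ennreal_power c_def)
  qed
  have "ennreal (vol\<^sup>2 * Q) = (\<integral>\<^sup>+x. ennreal ((vol * v x)\<^sup>2) \<partial>nu)"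
  proof -
    have "(\<integral>\<^sup>+x. ennreal ((vol * v x)\<^sup>2) \<partial>nu) = ennreal (LINT x|nu. (vol * v x)\<^sup>2)"
      using v2 by (intro nn_integral_eq_integral) (auto simp: power_mult_distrib)
    then show ?thesis by (simp add: power_mult_distrib Q_def)
  qed
  also have "\<dots> \<le> (\<integral>\<^sup>+x. ennreal (2 * vol) * (\<integral>\<^sup>+y. ennreal ((v (z x y) - v x)\<^sup>2) \<partial>nu) + ennreal (2 * J\<^sup>2) \<partial>nu)"
    by (rule nn_integral_mono_AE[OF pw])
  also have "\<dots> = ennreal (2 * vol) * (\<integral>\<^sup>+x. \<integral>\<^sup>+y. ennreal ((v (z x y) - v x)\<^sup>2) \<partial>nu \<partial>nu) + ennreal (2 * J\<^sup>2) * ennreal vol"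
    unfolding z_def by (subst nn_integral_add) (auto simp: nn_integral_cmult emeasure_nu)
  also have "\<dots> \<le> ennreal (2 * vol) * (ennreal (t\<^sup>2 * diam\<^sup>2 * 2 ^ hdim * vol) * energy G) + ennreal (2 * J\<^sup>2) * ennreal vol"
    unfolding z_def by (intro add_mono mult_left_mono segment_inequality[OF P t]) auto
  also have "\<dots> = ennreal (2 * vol * (t\<^sup>2 * diam\<^sup>2 * 2 ^ hdim * vol * e) + 2 * J\<^sup>2 * vol)"
    unfolding energy_eq[OF E] e_def[symmetric] using vol_pos e0
    by (simp add: ennreal_mult[symmetric] ennreal_plus[symmetric] del: ennreal_plus)
  finally have "vol\<^sup>2 * Q \<le> 2 * vol * (t\<^sup>2 * diam\<^sup>2 * 2 ^ hdim * vol * e) + 2 * J\<^sup>2 * vol"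
    using vol_pos e0 by (subst (asm) ennreal_le_iff) auto
  also have "\<dots> = vol\<^sup>2 * (2 * t\<^sup>2 * diam\<^sup>2 * 2 ^ hdim * e + 2 * I\<^sup>2 / (vol * (t ^ hdim)\<^sup>2))"
    using vol_pos t by (simp add: J_def power_divide power2_eq_square field_simps)
  finally show ?thesis using vol_pos by (simp add: Q_def e_def I_def)
qed

end

section \<open>De Giorgi iteration\<close>

text \<open>
  A version of \<open>max 0 (s - k)\<close> with Lipschitz derivative, as the chain rule needs: it vanishes up to
  \<open>k\<close>, is quadratic on \<open>[k, k + h]\<close>, and has slope \<open>1\<close> afterwards. Its derivative is \<open>soft_step\<close>.
\<close>

definition soft_excess :: "real \<Rightarrow> real \<Rightarrow> real \<Rightarrow> real" where
  "soft_excess k h s = ((max 0 (s - k))\<^sup>2 - (max 0 (s - k - h))\<^sup>2) / (2 * h)"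

definition soft_step :: "real \<Rightarrow> real \<Rightarrow> real \<Rightarrow> real" where
  "soft_step k h s = (max 0 (s - k) - max 0 (s - k - h)) / h"

lemma max0_square_has_derivative:
  "((\<lambda>s::real. (max 0 (s - c))\<^sup>2) has_real_derivative 2 * max 0 (s - c)) (at s)"
proof -
  consider "s > c" | "s = c" | "s < c" by linarith
  then show ?thesis
  proof cases
    case 1
    have "((\<lambda>s. (s - c)\<^sup>2) has_real_derivative 2 * max 0 (s - c)) (at s)"
      using 1 by (auto intro!: derivative_eq_intros)
    then show ?thesis
      by (rule has_field_derivative_transform_within_open[where S = "{c<..}"]) (use 1 in auto)
  next
    case 2
    have "((\<lambda>h. ((max 0 (s + h - c))\<^sup>2 - (max 0 (s - c))\<^sup>2) / h) \<longlongrightarrow> 0) (at 0)"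
    proof (rule Lim_null_comparison)
      show "\<forall>\<^sub>F h in at 0. norm (((max 0 (s + h - c))\<^sup>2 - (max 0 (s - c))\<^sup>2) / h) \<le> \<bar>h\<bar>"
        using 2 by (intro always_eventually) (auto simp: max_def power2_eq_square)
      show "((\<lambda>h::real. \<bar>h\<bar>) \<longlongrightarrow> 0) (at 0)" by (intro tendsto_rabs_zero tendsto_ident_at)
    qed
    then show ?thesis using 2 by (simp add: DERIV_def)
  next
    case 3
    have "((\<lambda>s. 0) has_real_derivative 2 * max 0 (s - c)) (at s)" using 3 by simp
    then show ?thesis
      by (rule has_field_derivative_transform_within_open[where S = "{..<c}"]) (use 3 in auto)
  qed
qed

lemma soft_excess_has_derivative:
  assumes "h > 0"
  shows "(soft_excess k h has_real_derivative soft_step k h s) (at s)"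
proof -
  have "((\<lambda>s. ((max 0 (s - k))\<^sup>2 - (max 0 (s - (k + h)))\<^sup>2) / (2 * h)) has_real_derivative
      (2 * max 0 (s - k) - 2 * max 0 (s - (k + h))) / (2 * h)) (at s)"
    by (intro DERIV_cdivide DERIV_diff max0_square_has_derivative)
  moreover have "(2 * max 0 (s - k) - 2 * max 0 (s - (k + h))) / (2 * h) = soft_step k h s"
  proof -
    have "(2 * a - 2 * b) / (2 * h) = (a - b) / h" for a b using assms by (simp add: field_simps)
    then show ?thesis by (simp only: soft_step_def diff_diff_eq)
  qed
  ultimately show ?thesis by (simp add: soft_excess_def[abs_def] diff_diff_eq)
qed

lemma soft_step_bounds:
  assumes "h > 0"
  shows "0 \<le> soft_step k h s" "soft_step k h s \<le> 1"
  using assms by (auto simp: soft_step_def max_def divide_simps)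

lemma soft_step_lipschitz:
  assumes "h > 0"
  shows "\<bar>soft_step k h x - soft_step k h y\<bar> \<le> 2 / h * \<bar>x - y\<bar>"
proof -
  have "\<bar>soft_step k h x - soft_step k h y\<bar> =
    \<bar>(max 0 (x - k) - max 0 (y - k)) - (max 0 (x - k - h) - max 0 (y - k - h))\<bar> / h"
    using assms by (simp add: soft_step_def flip: diff_divide_distrib) (simp add: algebra_simps)
  also have "\<dots> \<le> (2 * \<bar>x - y\<bar>) / h"
    using assms by (intro divide_right_mono) (auto simp: max_def)
  finally show ?thesis by simp
qed

lemma soft_excess_cases:
  assumes "h > 0"
  shows "s \<le> k \<Longrightarrow> soft_excess k h s = 0"
    and "k \<le> s \<Longrightarrow> s \<le> k + h \<Longrightarrow> soft_excess k h s = (s - k)\<^sup>2 / (2 * h)"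
    and "k + h \<le> s \<Longrightarrow> soft_excess k h s = s - k - h / 2"
  using assms by (auto simp: soft_excess_def max_def power2_eq_square field_simps)

lemma soft_excess_nonneg:
  assumes "h > 0"
  shows "0 \<le> soft_excess k h s"
proof -
  consider "s \<le> k" | "k \<le> s" "s \<le> k + h" | "k + h \<le> s" by linarith
  then show ?thesis
  proof cases
    case 2
    then show ?thesis using soft_excess_cases(2)[OF assms 2] assms by simp
  next
    case 3
    then show ?thesis using soft_excess_cases(3)[OF assms 3] assms by simp
  qed (use soft_excess_cases(1)[OF assms, of s k] in simp)
qed

lemma soft_excess_le:
  assumes "h > 0"
  shows "soft_excess k h s \<le> max 0 (s - k)"
proof -
  consider "s \<le> k" | "k \<le> s" "s \<le> k + h" | "k + h \<le> s" by linarith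
  then show ?thesis
  proof cases
    case 2
    have "(s - k)\<^sup>2 \<le> (s - k) * (2 * h)" using 2 assms unfolding power2_eq_square by (intro mult_left_mono) auto
    then have "(s - k)\<^sup>2 / (2 * h) \<le> s - k" using assms by (simp add: pos_divide_le_eq)
    then show ?thesis using soft_excess_cases(2)[OF assms 2] 2 by simp
  next
    case 3
    then show ?thesis using soft_excess_cases(3)[OF assms 3] assms by simp
  qed (use soft_excess_cases(1)[OF assms, of s k] in simp)
qed

lemma abs_soft_excess_le:
  assumes "0 \<le> k" "0 < h"
  shows "\<bar>soft_excess k h s\<bar> \<le> \<bar>s\<bar>"
  using soft_excess_nonneg[OF assms(2), of k s] soft_excess_le[OF assms(2), of k s] assms(1)
  by (auto simp: max_def split: if_splits)

lemma le_soft_excess: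
  assumes "h > 0"
  shows "s \<le> k + h + soft_excess k h s"
proof (cases "s \<le> k + h")
  case True
  then show ?thesis using soft_excess_nonneg[OF assms, of k s] by simp
next
  case False
  then show ?thesis using soft_excess_cases(3)[OF assms, of k s] assms by simp
qed

lemma soft_excess_ge:
  assumes "h > 0" "k + h \<le> s"
  shows "h / 2 \<le> soft_excess k h s"
  using soft_excess_cases(3)[OF assms] assms by simp

context weighted_domain
begin

lemma integrable_nu_dominated:
  fixes u w :: "(nat \<Rightarrow> real) \<Rightarrow> real"
  assumes [measurable]: "u \<in> borel_measurable (LB N)" "w \<in> borel_measurable (LB N)"
    and u2: "integrable nu (\<lambda>x. (u x)\<^sup>2)" and wu: "\<And>x. \<bar>w x\<bar> \<le> \<bar>u x\<bar>"
  shows "integrable nu (\<lambda>x. (w x)\<^sup>2)" "integrable nu (\<lambda>x. u x * w x)"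
proof -
  show "integrable nu (\<lambda>x. (w x)\<^sup>2)"
    by (rule Bochner_Integration.integrable_bound[OF u2])
       (use wu in \<open>auto intro!: AE_I2 simp: abs_le_square_iff[symmetric]\<close>)
  show "integrable nu (\<lambda>x. u x * w x)"
  proof (rule Bochner_Integration.integrable_bound[OF u2])
    have "norm (u x * w x) \<le> norm ((u x)\<^sup>2)" for x
      using mult_left_mono[OF wu[of x], of "\<bar>u x\<bar>"] by (simp add: abs_mult power2_eq_square)
    then show "AE x in nu. norm (u x * w x) \<le> norm ((u x)\<^sup>2)" by simp
  qed measurable
qed

definition level_mass :: "((nat \<Rightarrow> real) \<Rightarrow> real) \<Rightarrow> real \<Rightarrow> real" where
  "level_mass u k = measure nu {x \<in> Rn N. k < u x}"

lemma emeasure_level_set: "emeasure nu {x \<in> Rn N. k < u x} = ennreal (level_mass u k)"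
  by (simp add: level_mass_def nu.emeasure_eq_measure)

lemma level_mass_nonneg: "0 \<le> level_mass u k"
  by (simp add: level_mass_def)

lemma level_mass_antimono:
  assumes [measurable]: "u \<in> borel_measurable (LB N)" and "k \<le> l"
  shows "level_mass u l \<le> level_mass u k"
proof -
  have "{x \<in> Rn N. k < u x} \<in> sets nu"
    using borel_measurable_less[of "\<lambda>_. k" "LB N" u] by simp
  then show ?thesis unfolding level_mass_def using assms(2) by (intro nu.finite_measure_mono) auto
qed

text \<open>
  The Cauchy-Schwarz inequality, applied to \<open>w\<close> and the indicator of \<open>{u > k}\<close>.
\<close>

lemma integral_level_sets:
  assumes [measurable]: "w \<in> borel_measurable (LB N)" "u \<in> borel_measurable (LB N)"
    and w2: "integrable nu (\<lambda>x. (w x)\<^sup>2)" and nonneg: "\<And>x. 0 \<le> w x"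
    and supp: "\<And>x. u x \<le> k \<Longrightarrow> w x = 0"
  shows "(LINT x|nu. w x)\<^sup>2 \<le> level_mass u k * (LINT x|nu. (w x)\<^sup>2)"
proof -
  have w1: "integrable nu w" by (rule integrable_nu_of_square) (use w2 in auto)
  let ?S = "{x \<in> Rn N. k < u x}"
  have S [measurable]: "?S \<in> sets (LB N)"
    using borel_measurable_less[of "\<lambda>_. k" "LB N" u] by simp
  have I0: "0 \<le> (LINT x|nu. w x)" using nonneg by simp
  have "(ennreal (LINT x|nu. w x))\<^sup>2 = (\<integral>\<^sup>+x. ennreal (w x) * indicator ?S x \<partial>nu)\<^sup>2"
  proof -
    have "ennreal (LINT x|nu. w x) = (\<integral>\<^sup>+x. ennreal (w x) \<partial>nu)"
      using w1 nonneg by (intro nn_integral_eq_integral[symmetric]) auto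
    also have "\<dots> = (\<integral>\<^sup>+x. ennreal (w x) * indicator ?S x \<partial>nu)"
      using supp by (intro nn_integral_cong) (auto simp: indicator_def not_less)
    finally show ?thesis by simp
  qed
  also have "\<dots> \<le> (\<integral>\<^sup>+x. (ennreal (w x))\<^sup>2 \<partial>nu) * (\<integral>\<^sup>+x. (indicator ?S x)\<^sup>2 \<partial>nu)"
    by (rule Cauchy_Schwarz_nn_integral) measurable
  also have "(\<integral>\<^sup>+x. (indicator ?S x)\<^sup>2 \<partial>nu) = (\<integral>\<^sup>+x. indicator ?S x \<partial>nu)"
    by (intro nn_integral_cong) (auto simp: indicator_def)
  also have "\<dots> = ennreal (level_mass u k)"
    by (simp add: emeasure_level_set)
  also have "(\<integral>\<^sup>+x. (ennreal (w x))\<^sup>2 \<partial>nu) = ennreal (LINT x|nu. (w x)\<^sup>2)"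
    using w2 nonneg by (simp add: ennreal_power nn_integral_eq_integral)
  finally have "ennreal ((LINT x|nu. w x)\<^sup>2) \<le> ennreal ((LINT x|nu. (w x)\<^sup>2) * level_mass u k)"
    using I0 level_mass_nonneg by (simp add: ennreal_power ennreal_mult)
  then show ?thesis using level_mass_nonneg by (subst (asm) ennreal_le_iff) (auto simp: mult.commute)
qed

lemma markov_level_mass:
  assumes [measurable]: "w \<in> borel_measurable (LB N)" "u \<in> borel_measurable (LB N)"
    and w1: "integrable nu w" and nonneg: "\<And>x. 0 \<le> w x"
    and ge: "\<And>x. k < u x \<Longrightarrow> c \<le> w x"
  shows "c * level_mass u k \<le> (LINT x|nu. w x)"
proof -
  let ?S = "{x \<in> Rn N. k < u x}"
  have S [measurable]: "?S \<in> sets (LB N)"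
    using borel_measurable_less[of "\<lambda>_. k" "LB N" u] by simp
  have iS: "integrable nu (\<lambda>x. c * indicator ?S x)"
    by (intro integrable_mult_right integrable_real_indicator) (use S in \<open>auto simp: emeasure_level_set\<close>)
  have "?S \<inter> Rn N = ?S" by blast
  then have "c * level_mass u k = (LINT x|nu. c * indicator ?S x)"
    by (simp add: level_mass_def)
  also have "\<dots> \<le> (LINT x|nu. w x)"
  proof (rule integral_mono[OF iS w1])
    fix x
    show "c * indicator ?S x \<le> w x" using ge[of x] nonneg[of x] by (cases "x \<in> ?S") auto
  qed
  finally show ?thesis .
qed

text \<open>
  Let \<open>w\<close> be the truncation of \<open>u\<close> at level \<open>k\<close>. If \<open>{u > k}\<close> is small compared with \<open>t\<^sup>2\<^sup>n\<close>, then the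
  \<open>L\<^sup>1\<close> term of the Nash inequality for \<open>w\<close> can be absorbed, and so can the part of the energy bound that
  contains \<open>\<integral> w\<^sup>2\<close>. What remains bounds \<open>\<integral> w\<^sup>2\<close> by \<open>\<integral> w\<close>; with \<open>(\<integral> w)\<^sup>2 \<le> \<nu>{u > k} \<integral> w\<^sup>2\<close> this becomes a
  bound on \<open>\<integral> w\<close>, which dominates the mass above \<open>k + h\<close>.
\<close>

lemma de_giorgi_step:
  assumes P: "sobolev_pair N \<Omega> u G" and u2: "integrable nu (\<lambda>x. (u x)\<^sup>2)"
    and E: "integrable nu (\<lambda>x. \<Sum>i<N. (G i x)\<^sup>2)"
    and k: "0 \<le> k" and h: "0 < h" and \<mu>: "0 \<le> \<mu>"
    and ineq: "(LINT x|nu. (\<Sum>i<N. (soft_step k h (u x) * G i x)\<^sup>2)) \<le> 2 * \<mu> * (LINT x|nu. u x * soft_excess k h (u x))"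
    and t: "0 < t" "t \<le> 1"
    and small: "4 * level_mass u k \<le> (t ^ hdim)\<^sup>2 * vol"
    and \<beta>: "\<beta> = 2 ^ hdim * diam\<^sup>2 * \<mu>" and t\<beta>: "16 * \<beta> * t\<^sup>2 \<le> 1"
  shows "level_mass u (k + h) \<le> 32 * \<beta> * t\<^sup>2 * ((k + h) / h) * level_mass u k"
proof -
  note um [measurable] = sobolev_pairD(1)[OF P]
  define w where "w x = soft_excess k h (u x)" for x
  define g where "g i x = soft_step k h (u x) * G i x" for i x
  define A where "A = level_mass u k"
  have A0: "0 \<le> A" by (simp add: A_def level_mass_nonneg)
  have Pw: "sobolev_pair N \<Omega> w g"
    unfolding w_def[abs_def] g_def[abs_def]
    by (rule sobolev_chain_rule[OF open_dom convex_dom P soft_excess_has_derivative[OF h] _ soft_step_lipschitz[OF h], of _ 1])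
       (use soft_step_bounds[OF h] in simp)
  note [measurable] = sobolev_pairD(1)[OF Pw]
  have w0: "0 \<le> w x" for x by (simp add: w_def soft_excess_nonneg[OF h])
  have wu: "\<bar>w x\<bar> \<le> \<bar>u x\<bar>" for x unfolding w_def by (rule abs_soft_excess_le[OF k h])
  note w2 = integrable_nu_dominated(1)[OF um sobolev_pairD(1)[OF Pw] u2 wu]
    and uw = integrable_nu_dominated(2)[OF um sobolev_pairD(1)[OF Pw] u2 wu]
  have w1: "integrable nu w" by (rule integrable_nu_of_square) (use w2 in auto)
  have g2: "integrable nu (\<lambda>x. \<Sum>i<N. (g i x)\<^sup>2)"
  proof (rule Bochner_Integration.integrable_bound[OF E])
    show "(\<lambda>x. \<Sum>i<N. (g i x)\<^sup>2) \<in> borel_measurable nu"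
      using sobolev_pairD(2)[OF Pw] by (intro borel_measurable_sum borel_measurable_power) auto
    show "AE x in nu. norm (\<Sum>i<N. (g i x)\<^sup>2) \<le> norm (\<Sum>i<N. (G i x)\<^sup>2)"
    proof (rule AE_I2)
      fix x
      have "(soft_step k h (u x))\<^sup>2 \<le> 1" using soft_step_bounds[OF h, of k "u x"] by (simp add: power_le_one)
      then have "(g i x)\<^sup>2 \<le> (G i x)\<^sup>2" for i
        unfolding g_def power_mult_distrib by (rule mult_left_le_one_le[rotated 2]) auto
      then show "norm (\<Sum>i<N. (g i x)\<^sup>2) \<le> norm (\<Sum>i<N. (G i x)\<^sup>2)"
        by (simp add: sum_nonneg sum_mono)
    qed
  qed
  define Q where "Q = (LINT x|nu. (w x)\<^sup>2)"
  define I where "I = (LINT x|nu. w x)"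
  define e where "e = (LINT x|nu. (\<Sum>i<N. (g i x)\<^sup>2))"
  have Q0: "0 \<le> Q" by (simp add: Q_def)
  have I0: "0 \<le> I" unfolding I_def using w0 by simp
  have IA: "I\<^sup>2 \<le> A * Q" unfolding I_def Q_def A_def
  proof (rule integral_level_sets)
    show "w x = 0" if "u x \<le> k" for x using soft_excess_cases(1)[OF h that] by (simp add: w_def)
  qed (use w2 w0 um sobolev_pairD(1)[OF Pw] in auto)
  have "(LINT x|nu. u x * w x) \<le> (LINT x|nu. (w x)\<^sup>2 + (k + h) * w x)"
  proof (rule integral_mono[OF uw])
    show "integrable nu (\<lambda>x. (w x)\<^sup>2 + (k + h) * w x)" using w2 w1 by simp
    fix x
    have "u x * w x \<le> (k + h + w x) * w x" using le_soft_excess[OF h, of "u x" k] w0 by (intro mult_right_mono) (auto simp: w_def)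
    then show "u x * w x \<le> (w x)\<^sup>2 + (k + h) * w x" by (simp add: power2_eq_square algebra_simps)
  qed
  also have "\<dots> = Q + (k + h) * I" using w2 w1 by (simp add: Q_def I_def)
  finally have "e \<le> 2 * \<mu> * (Q + (k + h) * I)"
    using ineq \<mu> mult_left_mono[of "LINT x|nu. u x * w x" "Q + (k + h) * I" "2 * \<mu>"]
    by (simp add: e_def g_def w_def)
  then have ebd: "2 * t\<^sup>2 * diam\<^sup>2 * 2 ^ hdim * e \<le> 2 * t\<^sup>2 * diam\<^sup>2 * 2 ^ hdim * (2 * \<mu> * (Q + (k + h) * I))"
    by (intro mult_left_mono) auto
  \<comment> \<open>The smallness of the level set absorbs the \<open>L\<^sup>1\<close> term.\<close>
  have "2 * I\<^sup>2 / (vol * (t ^ hdim)\<^sup>2) \<le> Q / 2"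
  proof -
    have "4 * I\<^sup>2 \<le> 4 * A * Q" using IA by simp
    also have "\<dots> \<le> (t ^ hdim)\<^sup>2 * vol * Q" using small Q0 by (intro mult_right_mono) (auto simp: A_def)
    finally show ?thesis using vol_pos t by (simp add: divide_simps mult_ac)
  qed
  with nash[OF Pw w2 g2 w0 t] ebd
  have "Q \<le> 2 * t\<^sup>2 * diam\<^sup>2 * 2 ^ hdim * (2 * \<mu> * (Q + (k + h) * I)) + Q / 2"
    unfolding Q_def[symmetric] I_def[symmetric] e_def[symmetric] by linarith
  also have "2 * t\<^sup>2 * diam\<^sup>2 * 2 ^ hdim * (2 * \<mu> * (Q + (k + h) * I)) = 4 * \<beta> * t\<^sup>2 * Q + 4 * \<beta> * t\<^sup>2 * ((k + h) * I)"
    by (simp add: \<beta> algebra_simps)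
  \<comment> \<open>Both terms with \<open>Q\<close> on the right can now be absorbed, as \<open>16 \<beta> t\<^sup>2 \<le> 1\<close>.\<close>
  finally have "Q \<le> 4 * \<beta> * t\<^sup>2 * Q + 4 * \<beta> * t\<^sup>2 * ((k + h) * I) + Q / 2" .
  moreover have "16 * \<beta> * t\<^sup>2 * Q \<le> 1 * Q" using t\<beta> Q0 by (rule mult_right_mono)
  ultimately have Qle: "Q \<le> 16 * \<beta> * t\<^sup>2 * ((k + h) * I)" by simp
  have Ile: "I \<le> 16 * \<beta> * t\<^sup>2 * (k + h) * A"
  proof (cases "I = 0")
    case True
    have "0 \<le> \<beta>" using \<mu> by (simp add: \<beta>)
    then show ?thesis using True A0 k h by simp
  next
    case False
    have "I * I \<le> A * (16 * \<beta> * t\<^sup>2 * ((k + h) * I))"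
      using IA mult_left_mono[OF Qle A0] by (simp add: power2_eq_square)
    then have "I * I \<le> (16 * \<beta> * t\<^sup>2 * (k + h) * A) * I" by (simp add: mult_ac)
    then show ?thesis using False I0 by simp
  qed
  have "h / 2 * level_mass u (k + h) \<le> I" unfolding I_def
  proof (rule markov_level_mass)
    show "h / 2 \<le> w x" if "k + h < u x" for x
      using soft_excess_ge[OF h less_imp_le[OF that]] by (simp add: w_def)
  qed (use w1 w0 um sobolev_pairD(1)[OF Pw] in auto)
  also note Ile
  finally have "level_mass u (k + h) \<le> 16 * \<beta> * t\<^sup>2 * (k + h) * A / (h / 2)"
    using h by (simp add: divide_simps mult_ac)
  also have "\<dots> = 32 * \<beta> * t\<^sup>2 * ((k + h) / h) * level_mass u k" by (simp add: A_def)
  finally show ?thesis .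
qed

lemma hdim_pos: "hdim \<ge> 1"
  using N_pos by (simp add: hdim_def)

text \<open>
  The levels \<open>K (2 - 2\<^sup>-\<^sup>j)\<close> increase to \<open>2 K\<close>. Their gaps shrink like \<open>2\<^sup>-\<^sup>j\<close>, and the choice
  \<open>t\<^sup>2 = \<theta> 2\<^sup>-\<^sup>j\<close> compensates for this: each step multiplies the mass by at most \<open>2\<^sup>-\<^sup>n\<close>, which
  is exactly the decay needed to take the next step with its smaller \<open>t\<close>. The constant \<open>K\<close> is the
  level at which Markov's inequality makes the first step possible.
\<close>

theorem de_giorgi_bound:
  assumes P: "sobolev_pair N \<Omega> u G" and u2: "integrable nu (\<lambda>x. (u x)\<^sup>2)"
    and E: "integrable nu (\<lambda>x. \<Sum>i<N. (G i x)\<^sup>2)"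
    and \<mu>: "0 \<le> \<mu>" and Qpos: "0 < (LINT x|nu. (u x)\<^sup>2)"
    and ineq: "\<And>k h. 0 \<le> k \<Longrightarrow> 0 < h \<Longrightarrow>
      (LINT x|nu. (\<Sum>i<N. (soft_step k h (u x) * G i x)\<^sup>2)) \<le> 2 * \<mu> * (LINT x|nu. u x * soft_excess k h (u x))"
    and \<beta>: "\<beta> = 2 ^ hdim * diam\<^sup>2 * \<mu>" "1 \<le> \<beta>"
  shows "AE x in nu. u x \<le> 4 * sqrt ((128 * 2 ^ hdim * \<beta>) ^ hdim * (LINT x|nu. (u x)\<^sup>2) / vol)"
proof -
  note um [measurable] = sobolev_pairD(1)[OF P]
  \<comment> \<open>The value that makes the factor \<open>128 \<beta> \<theta>\<close> of a single step equal to \<open>2\<^sup>-\<^sup>n\<close>.\<close>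
  define \<theta> where "\<theta> = 1 / (128 * 2 ^ hdim * \<beta>)"
  define Q where "Q = (LINT x|nu. (u x)\<^sup>2)"
  define K where "K = 2 * sqrt ((128 * 2 ^ hdim * \<beta>) ^ hdim * Q / vol)"
  have \<theta>: "0 < \<theta>" using \<beta>(2) by (simp add: \<theta>_def)
  have \<beta>\<theta>: "128 * \<beta> * \<theta> = 1 / 2 ^ hdim" using \<beta>(2) by (simp add: \<theta>_def)
  have p1: "(1::real) \<le> 2 ^ hdim" by simp
  have \<beta>\<theta>1: "16 * \<beta> * \<theta> \<le> 1"
  proof -
    have "1 / 2 ^ hdim \<le> (1::real)" using p1 by simp
    then have "128 * \<beta> * \<theta> \<le> 1" using \<beta>\<theta> by simp
    then show ?thesis using \<beta>(2) \<theta> by (simp add: mult.assoc)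
  qed
  have \<theta>1: "\<theta> \<le> 1"
  proof -
    have "1 * 1 * 1 \<le> 128 * 2 ^ hdim * \<beta>" using \<beta>(2) p1 by (intro mult_mono) auto
    then show ?thesis unfolding \<theta>_def using \<beta>(2) by (subst divide_le_eq_1_pos) auto
  qed
  have Q0: "0 < Q" using Qpos by (simp add: Q_def)
  have K: "0 < K" using Q0 \<beta>(2) vol_pos by (simp add: K_def)
  \<comment> \<open>The level \<open>K\<close> is chosen so that Markov's inequality starts the induction.\<close>
  have K2: "K\<^sup>2 * (\<theta> ^ hdim * vol) = 4 * Q"
    using Q0 \<beta>(2) vol_pos by (simp add: K_def \<theta>_def power_mult_distrib power_divide)
  define kk where "kk j = K * (2 - 1 / 2 ^ j)" for j :: nat
  define hh where "hh j = K / 2 ^ Suc j" for j :: nat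
  have kkS: "kk j + hh j = kk (Suc j)" for j by (simp add: kk_def hh_def field_simps)
  have kk0: "0 \<le> kk j" for j
  proof -
    have "1 / 2 ^ j \<le> (1::real)" by simp
    then have "0 \<le> 2 - 1 / (2::real) ^ j" by linarith
    then show ?thesis unfolding kk_def using K by (intro mult_nonneg_nonneg) (rule less_imp_le)
  qed
  have kk2: "kk j \<le> 2 * K" for j using K by (simp add: kk_def field_simps)
  have claim: "4 * level_mass u (kk j) \<le> (\<theta> / 2 ^ j) ^ hdim * vol" for j
  proof (induction j)
    case 0
    have "K\<^sup>2 * level_mass u K \<le> Q" unfolding Q_def
    proof (rule markov_level_mass)
      show "K\<^sup>2 \<le> (u x)\<^sup>2" if "K < u x" for x using that K by (intro power_mono) auto
    qed (use u2 in auto)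
    then have "K\<^sup>2 * (4 * level_mass u K) \<le> K\<^sup>2 * (\<theta> ^ hdim * vol)" using K2 by simp
    then show ?case using K by (simp add: kk_def)
  next
    case (Suc j)
    define t where "t = sqrt (\<theta> / 2 ^ j)"
    have t2: "t\<^sup>2 = \<theta> / 2 ^ j" using \<theta> by (simp add: t_def)
    have j1: "\<theta> / 2 ^ j \<le> \<theta>" using \<theta> by (simp add: field_simps)
    have "t > 0" using \<theta> by (simp add: t_def)
    have "t \<le> 1" unfolding t_def real_sqrt_le_1_iff using j1 \<theta>1 by linarith
    have "level_mass u (kk j + hh j) \<le> 32 * \<beta> * t\<^sup>2 * ((kk j + hh j) / hh j) * level_mass u (kk j)"
    proof (rule de_giorgi_step[OF P u2 E kk0 _ \<mu> ineq[OF kk0] \<open>t > 0\<close> \<open>t \<le> 1\<close> _ \<beta>(1)])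
      show "4 * level_mass u (kk j) \<le> (t ^ hdim)\<^sup>2 * vol"
        using Suc by (simp add: t2 flip: power_mult) (simp add: mult.commute[of hdim 2] power_mult t2)
      have "16 * \<beta> * (\<theta> / 2 ^ j) \<le> 16 * \<beta> * \<theta>" using j1 \<beta>(2) by (intro mult_left_mono) auto
      then show "16 * \<beta> * t\<^sup>2 \<le> 1" unfolding t2 using \<beta>\<theta>1 by (rule order_trans)
    qed (use K in \<open>auto simp: hh_def\<close>)
    also have "32 * \<beta> * t\<^sup>2 * ((kk j + hh j) / hh j) \<le> 1 / 2 ^ hdim"
    proof -
      have "(kk j + hh j) / hh j \<le> 2 * K / hh j" unfolding kkS using kk2 K by (intro divide_right_mono) (auto simp: hh_def)
      also have "\<dots> = 4 * 2 ^ j" using K by (simp add: hh_def)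
      finally have "32 * \<beta> * t\<^sup>2 * ((kk j + hh j) / hh j) \<le> 32 * \<beta> * t\<^sup>2 * (4 * 2 ^ j)"
        using \<beta>(2) by (intro mult_left_mono) auto
      also have "\<dots> = 128 * \<beta> * \<theta>" by (simp add: t2)
      finally show ?thesis using \<beta>\<theta> by simp
    qed
    then have "32 * \<beta> * t\<^sup>2 * ((kk j + hh j) / hh j) * level_mass u (kk j) \<le> 1 / 2 ^ hdim * level_mass u (kk j)"
      by (rule mult_right_mono) (rule level_mass_nonneg)
    finally have "4 * level_mass u (kk (Suc j)) \<le> 1 / 2 ^ hdim * (4 * level_mass u (kk j))" unfolding kkS by simp
    also have "\<dots> \<le> 1 / 2 ^ hdim * ((\<theta> / 2 ^ j) ^ hdim * vol)" using Suc by (intro mult_left_mono) auto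
    also have "\<dots> = (\<theta> / 2 ^ Suc j) ^ hdim * vol" by (simp add: power_divide power_mult_distrib)
    finally show ?case .
  qed
  have "level_mass u (2 * K) \<le> vol * (1 / 2) ^ j" for j
  proof -
    have "4 * level_mass u (2 * K) \<le> 4 * level_mass u (kk j)" using level_mass_antimono[OF um kk2] by simp
    also have "\<dots> \<le> (\<theta> / 2 ^ j) ^ hdim * vol" by (rule claim)
    also have "\<dots> \<le> (1 / 2) ^ j * vol"
    proof (rule mult_right_mono)
      have b: "\<theta> / 2 ^ j \<le> 1 / 2 ^ j" using \<theta>1 by (intro divide_right_mono) auto
      have "(\<theta> / 2 ^ j) ^ hdim \<le> (\<theta> / 2 ^ j) ^ 1"
        using hdim_pos \<theta> order_trans[OF b, of 1] by (intro power_decreasing) auto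
      then show "(\<theta> / 2 ^ j) ^ hdim \<le> (1 / 2) ^ j" using b by (simp add: power_one_over)
    qed (use vol_pos in simp)
    finally show ?thesis using level_mass_nonneg[of u "2 * K"] by (simp add: mult.commute)
  qed
  moreover have "(\<lambda>j. vol * (1 / 2) ^ j) \<longlonglongrightarrow> vol * 0" by (intro tendsto_intros LIMSEQ_power_zero) auto
  ultimately have "level_mass u (2 * K) \<le> 0" by (intro LIMSEQ_le_const) auto
  then have z: "emeasure nu {x \<in> Rn N. 2 * K < u x} = 0" using level_mass_nonneg[of u "2 * K"] by (simp add: emeasure_level_set)
  have "{x \<in> Rn N. 2 * K < u x} \<in> sets nu" using borel_measurable_less[of "\<lambda>_. 2 * K" "LB N" u] by simp
  then have "AE x in nu. \<not> 2 * K < u x" by (subst AE_iff_measurable[OF _ refl]) (use z in auto)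
  then show ?thesis by eventually_elim (simp add: K_def Q_def)
qed

end

section \<open>Weak gradients and the Rayleigh quotient on Borel representatives\<close>

lemma completion_transfer:
  fixes f F :: "'a \<Rightarrow> real"
  assumes f: "f \<in> borel_measurable (completion M)" and F: "F \<in> borel_measurable M"
    and ae: "AE x in M. f x = F x"
  shows "integrable (completion M) f \<longleftrightarrow> integrable M F"
    and "(LINT x|completion M. f x) = (LINT x|M. F x)"
proof -
  have "integrable (completion M) f \<longleftrightarrow> integrable (completion M) F"
    by (rule integrable_cong_AE[OF f measurable_completion[OF F] AE_completion[OF ae]])
  then show "integrable (completion M) f \<longleftrightarrow> integrable M F" by (simp add: integrable_completion[OF F])
  have "(LINT x|completion M. f x) = (LINT x|completion M. F x)"
    by (rule integral_cong_AE[OF f measurable_completion[OF F] AE_completion[OF ae]])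
  then show "(LINT x|completion M. f x) = (LINT x|M. F x)" by (simp add: integral_completion[OF F])
qed

lemma borel_representative:
  assumes "set_borel_measurable (Rn_lebesgue N) \<Omega> (f :: _ \<Rightarrow> real)"
  obtains F where "F \<in> borel_measurable (LB N)" "AE x in LB N. x \<in> \<Omega> \<longrightarrow> f x = F x"
proof -
  obtain F where F: "F \<in> borel_measurable (LB N)" "AE x in LB N. indicator \<Omega> x *\<^sub>R f x = F x"
    using completion_ex_borel_measurable_real assms unfolding set_borel_measurable_def Rn_lebesgue_LB by blast
  from F(2) have "AE x in LB N. x \<in> \<Omega> \<longrightarrow> f x = F x" by eventually_elim auto
  then show ?thesis using F(1) that by blast
qed

lemma borel_representative_gradient:
  assumes W: "is_weak_gradient N \<Omega> u W"
  obtains G where "\<And>i. i < N \<Longrightarrow> G i \<in> borel_measurable (LB N)"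
    "\<And>i. i < N \<Longrightarrow> AE x in LB N. x \<in> \<Omega> \<longrightarrow> W i x = G i x"
proof -
  have "\<exists>G. G \<in> borel_measurable (LB N) \<and> (AE x in LB N. x \<in> \<Omega> \<longrightarrow> W i x = G x)" if "i < N" for i
  proof -
    have "set_borel_measurable (Rn_lebesgue N) \<Omega> (W i)" using W that by (simp add: is_weak_gradient_def L2_loc_def)
    then show ?thesis by (rule borel_representative) blast
  qed
  then show ?thesis using that by metis
qed

lemma sobolev_pair_of_weak_gradient:
  assumes \<Omega>: "openin (Rn_top N) \<Omega>" and u: "L2_loc N \<Omega> u" and W: "is_weak_gradient N \<Omega> u W"
    and U: "U \<in> borel_measurable (LB N)" "AE x in LB N. x \<in> \<Omega> \<longrightarrow> u x = U x"
    and H: "\<And>i. i < N \<Longrightarrow> H i \<in> borel_measurable (LB N)" "\<And>i. i < N \<Longrightarrow> AE x in LB N. x \<in> \<Omega> \<longrightarrow> W i x = H i x"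
  shows "sobolev_pair N \<Omega> U H"
proof -
  have \<Omega>s [measurable]: "\<Omega> \<in> sets (LB N)" by (rule openin_in_sets_LB[OF \<Omega>])
  have sq: "set_integrable (LB N) K (\<lambda>x. (F x)\<^sup>2)"
    if f: "L2_loc N \<Omega> f" and F: "F \<in> borel_measurable (LB N)" "AE x in LB N. x \<in> \<Omega> \<longrightarrow> f x = F x"
      and K: "K \<subseteq> \<Omega>" "compactin (Rn_top N) K" for f F K
  proof -
    have [measurable]: "K \<in> sets (LB N)" "F \<in> borel_measurable (LB N)" using compactin_in_sets_LB[OF K(2)] F by auto
    have i: "integrable (completion (LB N)) (\<lambda>x. indicator K x *\<^sub>R (f x)\<^sup>2)"
      using f K unfolding L2_loc_def set_integrable_def Rn_lebesgue_LB by simp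
    have "AE x in LB N. indicator K x *\<^sub>R (f x)\<^sup>2 = indicator K x *\<^sub>R (F x)\<^sup>2"
      using F(2) by eventually_elim (use K in \<open>auto simp: indicator_def\<close>)
    then have "integrable (LB N) (\<lambda>x. indicator K x *\<^sub>R (F x)\<^sup>2)"
      using completion_transfer(1)[OF borel_measurable_integrable[OF i], of "\<lambda>x. indicator K x *\<^sub>R (F x)\<^sup>2"] i by simp
    then show ?thesis unfolding set_integrable_def .
  qed
  have int: "(LINT x:\<Omega>|Rn_lebesgue N. f x * \<psi> x) = (LINT x:\<Omega>|LB N. F x * \<psi> x)"
    if f: "set_borel_measurable (Rn_lebesgue N) \<Omega> f" and F: "F \<in> borel_measurable (LB N)" "AE x in LB N. x \<in> \<Omega> \<longrightarrow> f x = F x"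
      and \<psi>: "\<psi> \<in> borel_measurable (LB N)" for f F \<psi> :: "_ \<Rightarrow> real"
    unfolding set_lebesgue_integral_def Rn_lebesgue_LB
  proof (rule completion_transfer(2))
    have "(\<lambda>x. (indicator \<Omega> x *\<^sub>R f x) * \<psi> x) \<in> borel_measurable (completion (LB N))"
      using f measurable_completion[OF \<psi>] unfolding set_borel_measurable_def Rn_lebesgue_LB by (rule borel_measurable_times)
    then show "(\<lambda>x. indicator \<Omega> x *\<^sub>R (f x * \<psi> x)) \<in> borel_measurable (completion (LB N))" by (simp add: mult.assoc)
    show "(\<lambda>x. indicator \<Omega> x *\<^sub>R (F x * \<psi> x)) \<in> borel_measurable (LB N)" using F(1) \<psi> by simp
    show "AE x in LB N. indicator \<Omega> x *\<^sub>R (f x * \<psi> x) = indicator \<Omega> x *\<^sub>R (F x * \<psi> x)"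
      using F(2) by eventually_elim (auto simp: indicator_def)
  qed
  have Wl: "L2_loc N \<Omega> (W i)" "weak_partial N \<Omega> i u (W i)" if "i < N" for i
    using W that by (auto simp: is_weak_gradient_def)
  show ?thesis unfolding sobolev_pair_def
  proof (intro conjI allI impI)
    fix i \<psi> assume i: "i < N" and \<psi>: "test_function N \<Omega> \<psi>"
    have "(LINT x:\<Omega>|Rn_lebesgue N. u x * partial_deriv i \<psi> x) = - (LINT x:\<Omega>|Rn_lebesgue N. W i x * \<psi> x)"
      using Wl(2)[OF i] \<psi> unfolding weak_partial_def by blast
    moreover have "(LINT x:\<Omega>|Rn_lebesgue N. u x * partial_deriv i \<psi> x) = (LINT x:\<Omega>|LB N. U x * partial_deriv i \<psi> x)"
      using u test_function_measurable[OF test_function_partial_deriv[OF \<psi> i]] by (intro int U) (auto simp: L2_loc_def)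
    moreover have "(LINT x:\<Omega>|Rn_lebesgue N. W i x * \<psi> x) = (LINT x:\<Omega>|LB N. H i x * \<psi> x)"
      using Wl(1)[OF i] test_function_measurable[OF \<psi>] by (intro int H i) (auto simp: L2_loc_def)
    ultimately show "(LINT x:\<Omega>|LB N. U x * partial_deriv i \<psi> x) = - (LINT x:\<Omega>|LB N. H i x * \<psi> x)" by simp
  qed (use U H sq[OF u U] sq[OF Wl(1) H] in auto)
qed

lemma weak_gradient_of_sobolev_pair:
  assumes \<Omega>: "openin (Rn_top N) \<Omega>" and P: "sobolev_pair N \<Omega> v G"
  shows "L2_loc N \<Omega> v" "is_weak_gradient N \<Omega> v G"
proof -
  have \<Omega>s [measurable]: "\<Omega> \<in> sets (LB N)" by (rule openin_in_sets_LB[OF \<Omega>])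
  have l2: "L2_loc N \<Omega> f" if f [measurable]: "f \<in> borel_measurable (LB N)"
    and sq: "\<And>K. K \<subseteq> \<Omega> \<Longrightarrow> compactin (Rn_top N) K \<Longrightarrow> set_integrable (LB N) K (\<lambda>x. (f x)\<^sup>2)" for f
    unfolding L2_loc_def
  proof (intro conjI allI impI)
    show "set_borel_measurable (Rn_lebesgue N) \<Omega> f"
      unfolding set_borel_measurable_def Rn_lebesgue_LB by (rule measurable_completion) measurable
    fix K assume K: "K \<subseteq> \<Omega>" "compactin (Rn_top N) K"
    then have [measurable]: "K \<in> sets (LB N)" by (intro compactin_in_sets_LB)
    show "set_integrable (Rn_lebesgue N) K (\<lambda>x. (f x)\<^sup>2)"
      using sq[OF K] unfolding set_integrable_def Rn_lebesgue_LB by (subst integrable_completion) auto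
  qed
  show "L2_loc N \<Omega> v" using sobolev_pairD(1,3)[OF P] by (intro l2) auto
  have int: "(LINT x:\<Omega>|Rn_lebesgue N. f x) = (LINT x:\<Omega>|LB N. f x)" if "f \<in> borel_measurable (LB N)" for f :: "_ \<Rightarrow> real"
    using that unfolding set_lebesgue_integral_def Rn_lebesgue_LB by (subst integral_completion) auto
  show "is_weak_gradient N \<Omega> v G"
    unfolding is_weak_gradient_def weak_partial_def
  proof (intro allI impI conjI)
    fix i assume i: "i < N"
    show "L2_loc N \<Omega> (G i)" using sobolev_pairD(2,4)[OF P] i by (intro l2) auto
    fix \<psi> assume \<psi>: "test_function N \<Omega> \<psi>"
    note [measurable] = test_function_measurable[OF \<psi>] test_function_measurable[OF test_function_partial_deriv[OF \<psi> i]]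
      sobolev_pairD(1)[OF P] sobolev_pairD(2)[OF P i]
    show "(LINT x:\<Omega>|Rn_lebesgue N. v x * partial_deriv i \<psi> x) = - (LINT x:\<Omega>|Rn_lebesgue N. G i x * \<psi> x)"
      using sobolev_pairD(7)[OF P i \<psi>] by (simp add: int)
  qed
qed

text \<open>
  The difference of two weak gradients is orthogonal to all test functions.
\<close>

lemma sobolev_pair_gradient_unique:
  assumes \<Omega>: "openin (Rn_top N) \<Omega>" and G: "sobolev_pair N \<Omega> v G" and H: "sobolev_pair N \<Omega> v H" and i: "i < N"
  shows "AE x in LB N. x \<in> \<Omega> \<longrightarrow> G i x = H i x"
proof -
  note [measurable] = sobolev_pairD(2)[OF G i] sobolev_pairD(2)[OF H i]
  have "AE x in LB N. x \<in> \<Omega> \<longrightarrow> G i x - H i x = 0"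
  proof (rule fundamental_lemma[OF \<Omega>])
    show "set_integrable (LB N) K (\<lambda>x. G i x - H i x)" if "compactin (Rn_top N) K" "K \<subseteq> \<Omega>" for K
      by (rule set_integral_diff(1)) (use sobolev_pairD(6)[OF G that(2,1) i] sobolev_pairD(6)[OF H that(2,1) i] in auto)
    fix f a b
    assume sm: "\<And>i k. i < N \<Longrightarrow> smooth_upto k (f i)"
      and supp: "\<And>i t. i < N \<Longrightarrow> t \<notin> {a i..b i} \<Longrightarrow> f i t = 0" and Q: "closed_box N a b \<subseteq> \<Omega>"
    define \<psi> where "\<psi> = prod_fun N f"
    have test: "test_function N \<Omega> \<psi>" unfolding \<psi>_def by (rule test_function_prod_fun[OF sm supp Q])
    note \<psi>m [measurable] = test_function_measurable[OF test]
    obtain B where B: "\<And>x. x \<in> Rn N \<Longrightarrow> \<bar>\<psi> x\<bar> \<le> B" using test_function_bounded[OF test] by blast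
    have \<psi>0: "\<psi> x = 0" if "x \<in> Rn N - closed_box N a b" for x
      unfolding \<psi>_def using supp that by (rule prod_fun_vanishes)
    have one: "integrable (LB N) (\<lambda>x. \<psi> x * F x)" "(LINT x:\<Omega>|LB N. F x * \<psi> x) = (LINT x|LB N. \<psi> x * F x)"
      if F: "set_integrable (LB N) (closed_box N a b) F" for F
    proof -
      have "integrable (LB N) (\<lambda>x. \<psi> x * (indicator (closed_box N a b) x * F x))"
        by (rule integrable_bounded_mult[of _ _ _ B]) (use F B in \<open>auto simp: set_integrable_def\<close>)
      also have "?this \<longleftrightarrow> integrable (LB N) (\<lambda>x. \<psi> x * F x)"
      proof (rule Bochner_Integration.integrable_cong[OF refl])
        fix x assume "x \<in> space (LB N)"
        then show "\<psi> x * (indicator (closed_box N a b) x * F x) = \<psi> x * F x"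
          using \<psi>0[of x] by (cases "x \<in> closed_box N a b") auto
      qed
      finally show "integrable (LB N) (\<lambda>x. \<psi> x * F x)" .
      show "(LINT x:\<Omega>|LB N. F x * \<psi> x) = (LINT x|LB N. \<psi> x * F x)"
        unfolding set_lebesgue_integral_def
      proof (rule Bochner_Integration.integral_cong[OF refl])
        fix x assume "x \<in> space (LB N)"
        then show "indicator \<Omega> x *\<^sub>R (F x * \<psi> x) = \<psi> x * F x"
          using \<psi>0[of x] subsetD[OF Q, of x] by (cases "x \<in> closed_box N a b") auto
      qed
    qed
    note iG = one[OF sobolev_pairD(6)[OF G Q compactin_closed_box i]] and iH = one[OF sobolev_pairD(6)[OF H Q compactin_closed_box i]]
    have "(LINT x|LB N. \<psi> x * G i x) = (LINT x|LB N. \<psi> x * H i x)"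
      using sobolev_pairD(7)[OF G i test] sobolev_pairD(7)[OF H i test] iG(2) iH(2) by simp
    moreover have "(LINT x|LB N. (G i x - H i x) * prod_fun N f x) = (LINT x|LB N. \<psi> x * G i x) - (LINT x|LB N. \<psi> x * H i x)"
      using iG(1) iH(1) by (subst Bochner_Integration.integral_diff[symmetric]) (auto simp: \<psi>_def algebra_simps)
    ultimately show "(LINT x|LB N. (G i x - H i x) * prod_fun N f x) = 0" by simp
  qed measurable
  then show ?thesis by eventually_elim auto
qed

text \<open>
  The increments of a coordinate function are exactly linear in the step, so the difference quotients
  have no error term.
\<close>

lemma sobolev_pair_coordinate:
  assumes \<Omega>: "openin (Rn_top N) \<Omega>" and N: "0 < N"
  shows "sobolev_pair N \<Omega> (\<lambda>x. x 0) (\<lambda>i x. if i = 0 then 1 else 0)"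
proof -
  have m [measurable]: "(\<lambda>x. x 0) \<in> borel_measurable (LB N)" by (rule measurable_component_LB[OF N])
  have sq: "set_integrable (LB N) K (\<lambda>x. (x 0)\<^sup>2)" if K: "K \<subseteq> \<Omega>" "compactin (Rn_top N) K" for K
  proof -
    obtain a b where ab: "K \<subseteq> closed_box N a b" using compactin_subset_closed_box[OF K(2)] .
    have Ks [measurable]: "K \<in> sets (LB N)" by (rule compactin_in_sets_LB[OF K(2)])
    have "integrable (LB N) (\<lambda>x. (\<bar>a 0\<bar> + \<bar>b 0\<bar>)\<^sup>2 * indicator K x)"
      using emeasure_compactin_finite[OF K(2)] by auto
    then show ?thesis unfolding set_integrable_def
    proof (rule Bochner_Integration.integrable_bound)
      show "AE x in LB N. norm (indicator K x *\<^sub>R (x 0)\<^sup>2) \<le> norm ((\<bar>a 0\<bar> + \<bar>b 0\<bar>)\<^sup>2 * indicator K x)"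
      proof (rule AE_I2)
        fix x
        show "norm (indicator K x *\<^sub>R (x 0)\<^sup>2) \<le> norm ((\<bar>a 0\<bar> + \<bar>b 0\<bar>)\<^sup>2 * indicator K x)"
        proof (cases "x \<in> K")
          case True
          then have "a 0 \<le> x 0" "x 0 \<le> b 0" using ab N by (auto simp: mem_closed_box)
          then have "(x 0)\<^sup>2 \<le> (\<bar>a 0\<bar> + \<bar>b 0\<bar>)\<^sup>2" by (intro power2_le_iff_abs_le[THEN iffD2]) auto
          then show ?thesis using True by simp
        qed simp
      qed
    qed measurable
  qed
  have loc: "set_integrable (LB N) K (\<lambda>x. x 0)" if K: "K \<subseteq> \<Omega>" "compactin (Rn_top N) K" for K
    by (rule set_integrable_of_square[OF m compactin_in_sets_LB[OF K(2)] emeasure_compactin_finite[OF K(2)] sq[OF K]])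
  have one: "set_integrable (LB N) K (\<lambda>x. (if i = 0 then 1 else 0 :: real)\<^sup>2)" if K: "compactin (Rn_top N) K" for K and i :: nat
    using compactin_in_sets_LB[OF K] emeasure_compactin_finite[OF K] by (auto simp: set_integrable_def)
  have weak: "(LINT x:\<Omega>|LB N. x 0 * partial_deriv i \<psi> x) = - (LINT x:\<Omega>|LB N. (if i = 0 then 1 else 0) * \<psi> x)"
    if i: "i < N" and \<psi>: "test_function N \<Omega> \<psi>" for i \<psi>
  proof (rule weak_partial_of_difference_quotients[OF \<Omega> \<psi> i m loc, of 1 _ 0])
    fix t :: real
    have "(LINT x|LB N. \<psi> x * (lc N 1 x t (unit_dir i) 0 - x 0)) = (LINT x|LB N. t * (indicator \<Omega> x * ((if i = 0 then 1 else 0) * \<psi> x)))"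
    proof (rule Bochner_Integration.integral_cong[OF refl])
      fix x assume "x \<in> space (LB N)"
      moreover obtain K where "K \<subseteq> \<Omega>" "\<And>x. x \<in> Rn N - K \<Longrightarrow> \<psi> x = 0" using \<psi> unfolding test_function_def by blast
      ultimately have "x \<in> \<Omega> \<or> \<psi> x = 0" by auto
      then show "\<psi> x * (lc N 1 x t (unit_dir i) 0 - x 0) = t * (indicator \<Omega> x * ((if i = 0 then 1 else 0) * \<psi> x))"
        using N by (auto simp: unit_dir_def)
    qed
    then show "\<bar>(LINT x|LB N. \<psi> x * (lc N 1 x t (unit_dir i) 0 - x 0)) - t * (LINT x:\<Omega>|LB N. (if i = 0 then 1 else 0) * \<psi> x)\<bar> \<le> t\<^sup>2 * 0"
      by (simp add: set_lebesgue_integral_def)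
  qed auto
  show ?thesis unfolding sobolev_pair_def using m sq one weak by (intro conjI allI impI) auto
qed

context weighted_domain
begin

lemma integral_nu:
  fixes f :: "_ \<Rightarrow> real"
  assumes "f \<in> borel_measurable (LB N)"
  shows "(LINT x|nu. f x) = (LINT x|LB N. rho x * f x)" "integrable nu f \<longleftrightarrow> integrable (LB N) (\<lambda>x. rho x * f x)"
  unfolding nu_def using assms rho_nonneg by (simp_all add: integral_density integrable_density)

text \<open>
  The quotient is defined with an arbitrary choice of weak gradient; by uniqueness it may be computed
  with any Borel one.
\<close>

lemma rayleigh_eq:
  assumes u: "H1_loc N \<Omega> u" and U: "AE x in LB N. x \<in> \<Omega> \<longrightarrow> u x = U x" and P: "sobolev_pair N \<Omega> U G"
  shows "rayleigh N \<Omega> \<phi> u = energy G / (\<integral>\<^sup>+x. ennreal ((U x)\<^sup>2) \<partial>nu)"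
proof -
  define W where "W = weak_gradient N \<Omega> u"
  have L: "L2_loc N \<Omega> u" and W: "is_weak_gradient N \<Omega> u W"
    using u someI_ex[of "is_weak_gradient N \<Omega> u"] by (auto simp: H1_loc_def W_def weak_gradient_def)
  obtain H where H: "\<And>i. i < N \<Longrightarrow> H i \<in> borel_measurable (LB N)"
    "\<And>i. i < N \<Longrightarrow> AE x in LB N. x \<in> \<Omega> \<longrightarrow> W i x = H i x"
    using borel_representative_gradient[OF W] by blast
  note Um [measurable] = sobolev_pairD(1)[OF P]
  have PH: "sobolev_pair N \<Omega> U H" by (rule sobolev_pair_of_weak_gradient[OF open_dom L W Um U H])
  have "AE x in LB N. x \<in> \<Omega> \<longrightarrow> W i x = G i x" if "i < N" for i
    using H(2)[OF that] sobolev_pair_gradient_unique[OF open_dom P PH that] by eventually_elim auto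
  then have ae: "AE x in LB N. \<forall>i\<in>{..<N}. x \<in> \<Omega> \<longrightarrow> W i x = G i x"
    by (subst AE_ball_countable) auto
  have "(\<integral>\<^sup>+x\<in>\<Omega>. ennreal ((\<Sum>i<N. (W i x)\<^sup>2) * \<phi> x) \<partial>Rn_lebesgue N) =
      (\<integral>\<^sup>+x. ennreal (rho x) * ennreal (\<Sum>i<N. (G i x)\<^sup>2) \<partial>LB N)"
    unfolding Rn_lebesgue_LB nn_integral_completion
  proof (rule nn_integral_cong_AE)
    show "AE x in LB N. ennreal ((\<Sum>i<N. (W i x)\<^sup>2) * \<phi> x) * indicator \<Omega> x = ennreal (rho x) * ennreal (\<Sum>i<N. (G i x)\<^sup>2)"
      using ae
    proof eventually_elim
      case (elim x)
      show ?case
      proof (cases "x \<in> \<Omega>")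
        case True
        then have "(\<Sum>i<N. (W i x)\<^sup>2) = (\<Sum>i<N. (G i x)\<^sup>2)" using elim by (intro sum.cong) auto
        then show ?thesis using True weight_pos[OF True]
          by (simp add: rho_def ennreal_mult sum_nonneg mult.commute)
      qed (simp add: rho_def)
    qed
  qed
  also have "\<dots> = energy G"
    unfolding energy_def using sobolev_pairD(2)[OF P]
    by (intro nn_integral_nu[symmetric] measurable_compose[OF _ measurable_ennreal] borel_measurable_sum borel_measurable_power) auto
  finally have num: "(\<integral>\<^sup>+x\<in>\<Omega>. ennreal ((\<Sum>i<N. (W i x)\<^sup>2) * \<phi> x) \<partial>Rn_lebesgue N) = energy G" .
  have "(\<integral>\<^sup>+x\<in>\<Omega>. ennreal ((u x)\<^sup>2 * \<phi> x) \<partial>Rn_lebesgue N) = (\<integral>\<^sup>+x. ennreal (rho x) * ennreal ((U x)\<^sup>2) \<partial>LB N)"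
    unfolding Rn_lebesgue_LB nn_integral_completion
  proof (rule nn_integral_cong_AE)
    show "AE x in LB N. ennreal ((u x)\<^sup>2 * \<phi> x) * indicator \<Omega> x = ennreal (rho x) * ennreal ((U x)\<^sup>2)"
      using U
    proof eventually_elim
      case (elim x)
      then show ?case using weight_pos[of x] by (cases "x \<in> \<Omega>") (auto simp: rho_def ennreal_mult mult.commute)
    qed
  qed
  also have "\<dots> = (\<integral>\<^sup>+x. ennreal ((U x)\<^sup>2) \<partial>nu)" by (rule nn_integral_nu[symmetric]) measurable
  finally show ?thesis unfolding rayleigh_def W_def[symmetric] num by simp
qed

lemma admissible_of_sobolev_pair:
  assumes P: "sobolev_pair N \<Omega> v G" and v2: "integrable nu (\<lambda>x. (v x)\<^sup>2)"
    and mean: "(LINT x|nu. v x) = 0" and nz: "(LINT x|nu. (v x)\<^sup>2) \<noteq> 0"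
  shows "admissible N \<Omega> \<phi> v"
proof -
  note vm [measurable] = sobolev_pairD(1)[OF P]
  have eq: "indicator \<Omega> x *\<^sub>R (a * \<phi> x) = rho x * a" for a x by (simp add: rho_def)
  have "H1_loc N \<Omega> v" using weak_gradient_of_sobolev_pair[OF open_dom P] unfolding H1_loc_def by blast
  moreover have "L2_weighted N \<Omega> \<phi> v" unfolding L2_weighted_def
  proof
    show "set_borel_measurable (Rn_lebesgue N) \<Omega> v"
      unfolding set_borel_measurable_def Rn_lebesgue_LB by (rule measurable_completion) measurable
    show "set_integrable (Rn_lebesgue N) \<Omega> (\<lambda>x. (v x)\<^sup>2 * \<phi> x)"
      unfolding set_integrable_def Rn_lebesgue_LB eq
      using v2 by (subst integrable_completion) (auto simp: integral_nu)
  qed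
  moreover have "\<not> (AE x\<in>\<Omega> in Rn_lebesgue N. v x = 0)"
  proof
    assume "AE x\<in>\<Omega> in Rn_lebesgue N. v x = 0"
    then have "AE x in nu. (v x)\<^sup>2 = 0" unfolding Rn_lebesgue_LB AE_completion_iff AE_nu_iff by simp
    then have "(LINT x|nu. (v x)\<^sup>2) = 0" by (rule integral_eq_zero_AE)
    then show False using nz by simp
  qed
  moreover have "(LINT x:\<Omega>|Rn_lebesgue N. v x * \<phi> x) = 0"
    unfolding set_lebesgue_integral_def Rn_lebesgue_LB eq
    using mean by (subst integral_completion) (auto simp: integral_nu)
  ultimately show ?thesis by (simp add: admissible_def)
qed

lemma neumann_mu1_le:
  assumes P: "sobolev_pair N \<Omega> v G" and v2: "integrable nu (\<lambda>x. (v x)\<^sup>2)"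
    and mean: "(LINT x|nu. v x) = 0" and nz: "(LINT x|nu. (v x)\<^sup>2) \<noteq> 0"
    and E: "integrable nu (\<lambda>x. \<Sum>i<N. (G i x)\<^sup>2)"
  shows "neumann_mu1 N \<Omega> \<phi> \<le> ennreal ((LINT x|nu. (\<Sum>i<N. (G i x)\<^sup>2)) / (LINT x|nu. (v x)\<^sup>2))"
proof -
  have adm: "admissible N \<Omega> \<phi> v" by (rule admissible_of_sobolev_pair[OF P v2 mean nz])
  have pos: "0 < (LINT x|nu. (v x)\<^sup>2)" using nz by (simp add: order.not_eq_order_implies_strict)
  have "neumann_mu1 N \<Omega> \<phi> \<le> rayleigh N \<Omega> \<phi> v" unfolding neumann_mu1_def using adm by (intro INF_lower) simp
  also have "\<dots> = energy G / (\<integral>\<^sup>+x. ennreal ((v x)\<^sup>2) \<partial>nu)"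
    by (rule rayleigh_eq[OF _ _ P]) (use adm in \<open>auto simp: admissible_def\<close>)
  also have "\<dots> = ennreal (LINT x|nu. (\<Sum>i<N. (G i x)\<^sup>2)) / ennreal (LINT x|nu. (v x)\<^sup>2)"
    using v2 by (simp add: energy_eq[OF E] nn_integral_eq_integral)
  also have "\<dots> = ennreal ((LINT x|nu. (\<Sum>i<N. (G i x)\<^sup>2)) / (LINT x|nu. (v x)\<^sup>2))"
    using pos by (intro divide_ennreal Bochner_Integration.integral_nonneg sum_nonneg) auto
  finally show ?thesis .
qed

lemma integral_centered:
  fixes v :: "_ \<Rightarrow> real"
  assumes v2: "integrable nu (\<lambda>x. (v x)\<^sup>2)" and v: "v \<in> borel_measurable (LB N)"
  defines "c \<equiv> (LINT x|nu. v x) / vol"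
  shows "integrable nu (\<lambda>x. (v x - c)\<^sup>2)" "(LINT x|nu. v x - c) = 0"
    "(LINT x|nu. (v x - c)\<^sup>2) = (LINT x|nu. (v x)\<^sup>2) - (LINT x|nu. v x)\<^sup>2 / vol"
proof -
  have v1: "integrable nu v" by (rule integrable_nu_of_square[OF v v2])
  have eq: "(v x - c)\<^sup>2 = (v x)\<^sup>2 - 2 * c * v x + c\<^sup>2" for x by (simp add: power2_eq_square algebra_simps)
  show "integrable nu (\<lambda>x. (v x - c)\<^sup>2)" unfolding eq using v1 v2 by simp
  show "(LINT x|nu. v x - c) = 0" using v1 vol_pos by (simp add: measure_nu_space c_def)
  have "(LINT x|nu. (v x - c)\<^sup>2) = (LINT x|nu. (v x)\<^sup>2) - 2 * c * (LINT x|nu. v x) + c\<^sup>2 * vol"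
    unfolding eq using v1 v2 by (simp add: measure_nu_space)
  then show "(LINT x|nu. (v x - c)\<^sup>2) = (LINT x|nu. (v x)\<^sup>2) - (LINT x|nu. v x)\<^sup>2 / vol"
    using vol_pos by (simp add: c_def power2_eq_square field_simps)
qed

lemma sobolev_pair_translate:
  assumes "sobolev_pair N \<Omega> v G"
  shows "sobolev_pair N \<Omega> (\<lambda>x. v x - c) G"
proof -
  have d: "((\<lambda>s. s - c) has_real_derivative 1) (at s)" for s by (auto intro!: derivative_eq_intros)
  show ?thesis using sobolev_chain_rule[OF open_dom convex_dom assms d, of 1 0] by simp
qed

text \<open>
  Minimality of the eigenvalue, tested with the function minus its mean.
\<close>

lemma variance_bound:
  assumes \<mu>: "neumann_mu1 N \<Omega> \<phi> = ennreal \<mu>" "0 \<le> \<mu>"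
    and P: "sobolev_pair N \<Omega> v G" and v2: "integrable nu (\<lambda>x. (v x)\<^sup>2)"
    and E: "integrable nu (\<lambda>x. \<Sum>i<N. (G i x)\<^sup>2)"
  shows "\<mu> * ((LINT x|nu. (v x)\<^sup>2) - (LINT x|nu. v x)\<^sup>2 / vol) \<le> (LINT x|nu. (\<Sum>i<N. (G i x)\<^sup>2))"
proof -
  define c where "c = (LINT x|nu. v x) / vol"
  define q where "q = (LINT x|nu. (v x - c)\<^sup>2)"
  define e where "e = (LINT x|nu. (\<Sum>i<N. (G i x)\<^sup>2))"
  note cent = integral_centered[OF v2 sobolev_pairD(1)[OF P], folded c_def]
  have q0: "0 \<le> q" by (simp add: q_def)
  have e0: "0 \<le> e" unfolding e_def by (intro Bochner_Integration.integral_nonneg sum_nonneg) auto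
  have "\<mu> * q \<le> e"
  proof (cases "q = 0")
    case False
    have "ennreal \<mu> \<le> ennreal (e / q)"
      using neumann_mu1_le[OF sobolev_pair_translate[OF P, of c] cent(1,2) _ E] False
      by (simp add: q_def e_def \<mu>(1))
    then have "\<mu> \<le> e / q" using e0 q0 by (subst (asm) ennreal_le_iff) auto
    then show ?thesis using False q0 by (simp add: field_simps)
  qed (use e0 in simp)
  then show ?thesis using cent(3) by (simp add: q_def e_def)
qed

text \<open>
  The comparison function is \<open>u - w\<close>, where \<open>w\<close> is the truncation of \<open>u\<close>; write \<open>a\<close> for the slope of the truncation at
  \<open>u\<close>. Its energy is that of \<open>u\<close> minus \<open>\<integral> (2 a - a\<^sup>2) |G|\<^sup>2\<close> and its variance is at least
  \<open>\<integral> u\<^sup>2 - 2 \<integral> u w\<close>, so that \<open>\<integral> (2 a - a\<^sup>2) |G|\<^sup>2 \<le> 2 \<mu> \<integral> u w\<close>. Since \<open>0 \<le> a \<le> 1\<close>, the left side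
  dominates \<open>\<integral> a\<^sup>2 |G|\<^sup>2\<close>.
\<close>

lemma truncation_energy:
  assumes \<mu>: "neumann_mu1 N \<Omega> \<phi> = ennreal \<mu>" "0 \<le> \<mu>"
    and P: "sobolev_pair N \<Omega> u G" and u2: "integrable nu (\<lambda>x. (u x)\<^sup>2)"
    and E: "integrable nu (\<lambda>x. \<Sum>i<N. (G i x)\<^sup>2)" and mean: "(LINT x|nu. u x) = 0"
    and eig: "(LINT x|nu. (\<Sum>i<N. (G i x)\<^sup>2)) = \<mu> * (LINT x|nu. (u x)\<^sup>2)"
    and k: "0 \<le> k" and h: "0 < h"
  shows "(LINT x|nu. (\<Sum>i<N. (soft_step k h (u x) * G i x)\<^sup>2)) \<le> 2 * \<mu> * (LINT x|nu. u x * soft_excess k h (u x))"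
proof -
  note um [measurable] = sobolev_pairD(1)[OF P]
  define w where "w x = soft_excess k h (u x)" for x
  define a where "a x = soft_step k h (u x)" for x
  define g where "g x = (\<Sum>i<N. (G i x)\<^sup>2)" for x
  have g0: "0 \<le> g x" for x by (simp add: g_def sum_nonneg)
  have gi: "integrable nu g" using E by (simp add: g_def[abs_def])
  have gm [measurable]: "g \<in> borel_measurable (LB N)" using gi by (auto dest: borel_measurable_integrable)
  have a01: "0 \<le> a x" "a x \<le> 1" for x using soft_step_bounds[OF h] by (auto simp: a_def)
  have am [measurable]: "a \<in> borel_measurable (LB N)" unfolding a_def[abs_def] soft_step_def[abs_def] by measurable
  have wm [measurable]: "w \<in> borel_measurable (LB N)" unfolding w_def[abs_def] soft_excess_def[abs_def] by measurable
  have wu: "\<bar>w x\<bar> \<le> \<bar>u x\<bar>" for x unfolding w_def by (rule abs_soft_excess_le[OF k h])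
  note w2 = integrable_nu_dominated(1)[OF um wm u2 wu] and uw = integrable_nu_dominated(2)[OF um wm u2 wu]
  have bg: "integrable nu (\<lambda>x. b x * g x)" if [measurable]: "b \<in> borel_measurable (LB N)" and b: "\<And>x. 0 \<le> b x \<and> b x \<le> 1" for b
    by (rule Bochner_Integration.integrable_bound[OF gi])
       (use b g0 in \<open>auto intro!: AE_I2 mult_left_le_one_le simp: abs_mult\<close>)
  have ag: "integrable nu (\<lambda>x. a x * g x)" by (rule bg) (use a01 in auto)
  have aag: "integrable nu (\<lambda>x. (a x)\<^sup>2 * g x)" by (rule bg) (use a01 in \<open>auto simp: power_le_one\<close>)
  have Pv: "sobolev_pair N \<Omega> (\<lambda>x. u x - w x) (\<lambda>i x. (1 - a x) * G i x)"
    unfolding w_def a_def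
  proof (rule sobolev_chain_rule[OF open_dom convex_dom P, where F = "\<lambda>s. s - soft_excess k h s" and F' = "\<lambda>s. 1 - soft_step k h s"])
    show "((\<lambda>s. s - soft_excess k h s) has_real_derivative 1 - soft_step k h s) (at s)" for s
      by (intro DERIV_diff DERIV_ident soft_excess_has_derivative[OF h])
    show "\<bar>1 - soft_step k h s\<bar> \<le> 1" for s using soft_step_bounds[OF h, of k s] by auto
    show "\<bar>(1 - soft_step k h x) - (1 - soft_step k h y)\<bar> \<le> 2 / h * \<bar>x - y\<bar>" for x y
      using soft_step_lipschitz[OF h, of k y x] by (simp add: abs_minus_commute)
  qed
  have sq: "(u x - w x)\<^sup>2 = (u x)\<^sup>2 - 2 * (u x * w x) + (w x)\<^sup>2" for x by (simp add: power2_eq_square algebra_simps)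
  have v2: "integrable nu (\<lambda>x. (u x - w x)\<^sup>2)" unfolding sq using u2 uw w2 by simp
  have sumeq: "(\<Sum>i<N. ((1 - a x) * G i x)\<^sup>2) = g x - 2 * (a x * g x) + (a x)\<^sup>2 * g x" for x
    unfolding power_mult_distrib sum_distrib_left[symmetric] g_def[symmetric] by (simp add: power2_eq_square algebra_simps)
  have Ev: "integrable nu (\<lambda>x. \<Sum>i<N. ((1 - a x) * G i x)\<^sup>2)" unfolding sumeq using gi ag aag by simp
  have u1: "integrable nu u" "integrable nu w" using u2 w2 by (auto intro: integrable_nu_of_square)
  have "(LINT x|nu. u x - w x) = - (LINT x|nu. w x)" using u1 mean by simp
  with variance_bound[OF \<mu> Pv v2 Ev]
  have "\<mu> * ((LINT x|nu. (u x - w x)\<^sup>2) - (LINT x|nu. w x)\<^sup>2 / vol) \<le> (LINT x|nu. g x - 2 * (a x * g x) + (a x)\<^sup>2 * g x)"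
    by (simp add: sumeq)
  also have "\<dots> = (LINT x|nu. g x) - 2 * (LINT x|nu. a x * g x) + (LINT x|nu. (a x)\<^sup>2 * g x)"
    using gi ag aag by simp
  finally have main: "\<mu> * ((LINT x|nu. (u x - w x)\<^sup>2) - (LINT x|nu. w x)\<^sup>2 / vol) \<le>
    \<mu> * (LINT x|nu. (u x)\<^sup>2) - 2 * (LINT x|nu. a x * g x) + (LINT x|nu. (a x)\<^sup>2 * g x)"
    using eig by (simp add: g_def)
  have "(LINT x|nu. (u x - w x)\<^sup>2) = (LINT x|nu. (u x)\<^sup>2) - 2 * (LINT x|nu. u x * w x) + (LINT x|nu. (w x)\<^sup>2)"
    unfolding sq using u2 uw w2 by simp
  moreover have "0 \<le> (LINT x|nu. (w x)\<^sup>2) - (LINT x|nu. w x)\<^sup>2 / vol"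
  proof -
    have "0 \<le> (LINT x|nu. (w x - (LINT x|nu. w x) / vol)\<^sup>2)" by simp
    then show ?thesis unfolding integral_centered(3)[OF w2 wm] .
  qed
  ultimately have "\<mu> * ((LINT x|nu. (u x)\<^sup>2) - 2 * (LINT x|nu. u x * w x)) \<le> \<mu> * ((LINT x|nu. (u x - w x)\<^sup>2) - (LINT x|nu. w x)\<^sup>2 / vol)"
    using \<mu>(2) by (intro mult_left_mono) auto
  with main have "2 * (LINT x|nu. a x * g x) - (LINT x|nu. (a x)\<^sup>2 * g x) \<le> 2 * \<mu> * (LINT x|nu. u x * w x)"
    by (simp add: right_diff_distrib)
  moreover have "(LINT x|nu. (a x)\<^sup>2 * g x) \<le> (LINT x|nu. a x * g x)"
  proof (rule integral_mono[OF aag ag])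
    fix x
    have "(a x)\<^sup>2 \<le> a x" using a01[of x] by (simp add: power2_eq_square mult_left_le_one_le)
    then show "(a x)\<^sup>2 * g x \<le> a x * g x" using g0 by (rule mult_right_mono)
  qed
  ultimately have "(LINT x|nu. (a x)\<^sup>2 * g x) \<le> 2 * \<mu> * (LINT x|nu. u x * w x)" by linarith
  moreover have "(\<Sum>i<N. (a x * G i x)\<^sup>2) = (a x)\<^sup>2 * g x" for x by (simp add: g_def power_mult_distrib sum_distrib_left)
  ultimately show ?thesis by (simp add: a_def w_def)
qed

text \<open>
  A coordinate function minus its mean is admissible: it has constant gradient, and it is not constant
  on \<open>\<Omega>\<close> because hyperplanes are null sets.
\<close>

lemma neumann_mu1_finite: "neumann_mu1 N \<Omega> \<phi> < \<infinity>"
proof -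
  have N0: "0 < N" using N_pos by simp
  define v where "v x = (x 0 :: real)" for x :: "nat \<Rightarrow> real"
  define G where "G = (\<lambda>(i :: nat) (x :: nat \<Rightarrow> real). if i = 0 then 1 else 0 :: real)"
  have P: "sobolev_pair N \<Omega> v G" unfolding v_def[abs_def] G_def by (rule sobolev_pair_coordinate[OF open_dom N0])
  note vm [measurable] = sobolev_pairD(1)[OF P]
  obtain x0 where x0: "x0 \<in> \<Omega>" using nonempty_dom by blast
  have v2: "integrable nu (\<lambda>x. (v x)\<^sup>2)"
  proof (rule nu.integrable_const_bound)
    show "AE x in nu. norm ((v x)\<^sup>2) \<le> (\<bar>x0 0\<bar> + diam)\<^sup>2"
      using AE_nu_dom
    proof eventually_elim
      case (elim x)
      have "\<bar>x 0 - x0 0\<bar> \<le> diam" using coordinate_dist[OF N0, of x x0] dist_le_diameter[OF elim x0] by linarith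
      then have "(v x)\<^sup>2 \<le> (\<bar>x0 0\<bar> + diam)\<^sup>2" unfolding v_def by (intro power2_le_iff_abs_le[THEN iffD2]) auto
      then show ?case by simp
    qed
  qed measurable
  have E: "integrable nu (\<lambda>x. \<Sum>i<N. (G i x)\<^sup>2)" by (simp add: G_def)
  define c where "c = (LINT x|nu. v x) / vol"
  note cent = integral_centered[OF v2 vm, folded c_def]
  have "(LINT x|nu. (v x - c)\<^sup>2) \<noteq> 0"
  proof
    assume "(LINT x|nu. (v x - c)\<^sup>2) = 0"
    then have "AE x in nu. (v x - c)\<^sup>2 = 0"
      by (subst (asm) integral_nonneg_eq_0_iff_AE[OF cent(1)]) auto
    then have "AE x in LB N. x \<in> \<Omega> \<longrightarrow> x 0 = c" unfolding AE_nu_iff by (simp add: v_def)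
    moreover have "AE x in LB N. \<not> x 0 = c"
      using emeasure_coordinate_hyperplane[OF N0, of c] borel_measurable_eq[OF vm borel_measurable_const[of c]]
      by (subst AE_iff_measurable[OF _ refl]) (auto simp: v_def)
    ultimately have "AE x in LB N. x \<notin> \<Omega>" by eventually_elim auto
    then show False using not_AE_outside_dom by contradiction
  qed
  from neumann_mu1_le[OF sobolev_pair_translate[OF P, of c] cent(1,2) this E]
  show ?thesis by (rule le_less_trans) simp
qed

end

section \<open>The supremum bound\<close>

text \<open>
  The base is \<open>1 / (\<theta> D\<^sup>2 \<mu>)\<close> for the parameter \<open>\<theta>\<close> chosen in \<open>de_giorgi_bound\<close>.
\<close>

definition sup_const :: "nat \<Rightarrow> real" where
  "sup_const n = 4 * sqrt ((128 * 4 ^ n) ^ n)"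

lemma sup_const_pos: "0 < sup_const n"
  by (simp add: sup_const_def)

context weighted_domain
begin

text \<open>
  The Poincare inequality for the eigenfunction itself gives \<open>2 \<le> \<beta>\<close>, the lower bound on the
  eigenvalue that the iteration needs.
\<close>

lemma one_sided_bound:
  assumes \<mu>: "neumann_mu1 N \<Omega> \<phi> = ennreal \<mu>" "0 \<le> \<mu>"
    and P: "sobolev_pair N \<Omega> u G" and u2: "integrable nu (\<lambda>x. (u x)\<^sup>2)"
    and E: "integrable nu (\<lambda>x. \<Sum>i<N. (G i x)\<^sup>2)" and mean: "(LINT x|nu. u x) = 0"
    and eig: "(LINT x|nu. (\<Sum>i<N. (G i x)\<^sup>2)) = \<mu> * (LINT x|nu. (u x)\<^sup>2)"
    and pos: "0 < (LINT x|nu. (u x)\<^sup>2)"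
  shows "AE x in nu. u x \<le> sup_const hdim * \<mu> powr (real hdim / 2) * (diam ^ hdim / sqrt vol) * sqrt (LINT x|nu. (u x)\<^sup>2)"
proof -
  define Q where "Q = (LINT x|nu. (u x)\<^sup>2)"
  define \<beta> where "\<beta> = 2 ^ hdim * diam\<^sup>2 * \<mu>"
  have "2 * Q \<le> \<beta> * Q"
    using poincare[OF P u2 E mean] eig by (simp add: Q_def \<beta>_def mult_ac)
  then have \<beta>2: "2 \<le> \<beta>" using pos by (simp add: Q_def)
  then have \<mu>pos: "0 < \<mu>" using \<mu>(2) by (auto simp: \<beta>_def intro!: order.not_eq_order_implies_strict)
  have bound: "AE x in nu. u x \<le> 4 * sqrt ((128 * 2 ^ hdim * \<beta>) ^ hdim * (LINT x|nu. (u x)\<^sup>2) / vol)"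
    by (rule de_giorgi_bound[OF P u2 E \<mu>(2) pos truncation_energy[OF \<mu> P u2 E mean eig] \<beta>_def])
       (use \<beta>2 in auto)
  have "(4::real) ^ hdim = 2 ^ hdim * 2 ^ hdim" by (simp flip: power_mult_distrib)
  then have eq: "128 * 2 ^ hdim * \<beta> = 128 * 4 ^ hdim * diam\<^sup>2 * \<mu>"
    by (simp add: \<beta>_def)
  have split: "(128 * 2 ^ hdim * \<beta>) ^ hdim * Q / vol = (128 * 4 ^ hdim) ^ hdim * ((diam ^ hdim)\<^sup>2 * \<mu> ^ hdim * Q / vol)"
    unfolding eq by (simp add: power_mult_distrib mult_ac flip: power_mult)
  have "sqrt ((128 * 2 ^ hdim * \<beta>) ^ hdim * Q / vol) =
      sqrt ((128 * 4 ^ hdim) ^ hdim) * (diam ^ hdim * sqrt (\<mu> ^ hdim) * sqrt Q / sqrt vol)"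
    unfolding split using diam_nonneg by (simp only: real_sqrt_mult real_sqrt_divide) simp
  moreover have "sqrt (\<mu> ^ hdim) = \<mu> powr (real hdim / 2)"
    using \<mu>pos by (simp add: powr_half_sqrt[symmetric] powr_powr flip: powr_realpow)
  ultimately show ?thesis using bound by (simp add: sup_const_def Q_def mult_ac)
qed

theorem eigenfunction_bound:
  assumes eig: "first_eigenfunction N \<Omega> \<phi> u"
  shows "Linf_norm N \<Omega> u \<le>
    ereal (sup_const hdim * enn2real (neumann_mu1 N \<Omega> \<phi>) powr (real hdim / 2)
      * (diam ^ hdim / sqrt (LINT x:\<Omega>|Rn_lebesgue N. \<phi> x)) * L2_weighted_norm N \<Omega> \<phi> u)"
proof -
  define \<mu> where "\<mu> = enn2real (neumann_mu1 N \<Omega> \<phi>)"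
  have \<mu>: "neumann_mu1 N \<Omega> \<phi> = ennreal \<mu>" "0 \<le> \<mu>"
    using neumann_mu1_finite by (auto simp: \<mu>_def)
  have adm: "admissible N \<Omega> \<phi> u" and ray: "rayleigh N \<Omega> \<phi> u = ennreal \<mu>"
    using eig \<mu>(1) by (auto simp: first_eigenfunction_def)
  have H1: "H1_loc N \<Omega> u" and L2: "L2_weighted N \<Omega> \<phi> u" and nz: "\<not> (AE x\<in>\<Omega> in Rn_lebesgue N. u x = 0)"
    and mean0: "(LINT x:\<Omega>|Rn_lebesgue N. u x * \<phi> x) = 0"
    using adm by (auto simp: admissible_def)
  obtain W where L: "L2_loc N \<Omega> u" and W: "is_weak_gradient N \<Omega> u W" using H1 by (auto simp: H1_loc_def)
  have um: "set_borel_measurable (Rn_lebesgue N) \<Omega> u" using L2 by (simp add: L2_weighted_def)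
  obtain U where U [measurable]: "U \<in> borel_measurable (LB N)" and uU: "AE x in LB N. x \<in> \<Omega> \<longrightarrow> u x = U x"
    using borel_representative[OF um] by blast
  obtain G where G: "\<And>i. i < N \<Longrightarrow> G i \<in> borel_measurable (LB N)"
    "\<And>i. i < N \<Longrightarrow> AE x in LB N. x \<in> \<Omega> \<longrightarrow> W i x = G i x"
    using borel_representative_gradient[OF W] by blast
  have P: "sobolev_pair N \<Omega> U G" by (rule sobolev_pair_of_weak_gradient[OF open_dom L W U uU G])
  have rhom: "(\<lambda>x. indicator \<Omega> x *\<^sub>R (u x * \<phi> x)) \<in> borel_measurable (completion (LB N))"
  proof -
    have "(\<lambda>x. (indicator \<Omega> x *\<^sub>R u x) * rho x) \<in> borel_measurable (completion (LB N))"
      using um measurable_completion[OF rho_measurable] unfolding set_borel_measurable_def Rn_lebesgue_LB by (rule borel_measurable_times)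
    also have "(\<lambda>x. (indicator \<Omega> x *\<^sub>R u x) * rho x) = (\<lambda>x. indicator \<Omega> x *\<^sub>R (u x * \<phi> x))"
      by (auto simp: rho_def indicator_def)
    finally show ?thesis .
  qed
  have i2: "integrable (completion (LB N)) (\<lambda>x. indicator \<Omega> x *\<^sub>R ((u x)\<^sup>2 * \<phi> x))"
    using L2 by (simp add: L2_weighted_def set_integrable_def Rn_lebesgue_LB)
  have ae2: "AE x in LB N. indicator \<Omega> x *\<^sub>R ((u x)\<^sup>2 * \<phi> x) = rho x * (U x)\<^sup>2"
    using uU by eventually_elim (auto simp: rho_def indicator_def)
  have ae1: "AE x in LB N. indicator \<Omega> x *\<^sub>R (u x * \<phi> x) = rho x * U x"
    using uU by eventually_elim (auto simp: rho_def indicator_def)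
  have t2: "integrable (LB N) (\<lambda>x. rho x * (U x)\<^sup>2)"
    "(LINT x|completion (LB N). indicator \<Omega> x *\<^sub>R ((u x)\<^sup>2 * \<phi> x)) = (LINT x|LB N. rho x * (U x)\<^sup>2)"
    using completion_transfer[OF borel_measurable_integrable[OF i2] _ ae2] i2 by auto
  have U2: "integrable nu (\<lambda>x. (U x)\<^sup>2)" using t2(1) by (simp add: integral_nu)
  define Q where "Q = (LINT x|nu. (U x)\<^sup>2)"
  have norm_u: "L2_weighted_norm N \<Omega> \<phi> u = sqrt Q"
    using t2(2) by (simp add: L2_weighted_norm_def set_lebesgue_integral_def Rn_lebesgue_LB integral_nu Q_def)
  have mean: "(LINT x|nu. U x) = 0"
    using completion_transfer(2)[OF rhom _ ae1] mean0
    by (simp add: set_lebesgue_integral_def Rn_lebesgue_LB integral_nu)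
  have Qpos: "0 < Q"
  proof (rule ccontr)
    assume "\<not> 0 < Q"
    moreover have "0 \<le> Q" by (simp add: Q_def)
    ultimately have "Q = 0" by simp
    then have "AE x in nu. (U x)\<^sup>2 = 0"
      unfolding Q_def by (subst (asm) integral_nonneg_eq_0_iff_AE[OF U2]) auto
    then have "AE x in LB N. x \<in> \<Omega> \<longrightarrow> u x = 0"
      using uU unfolding AE_nu_iff by eventually_elim auto
    then have "AE x\<in>\<Omega> in Rn_lebesgue N. u x = 0" unfolding Rn_lebesgue_LB AE_completion_iff .
    then show False using nz by contradiction
  qed
  have "energy G / ennreal Q = ennreal \<mu>"
    using rayleigh_eq[OF H1 uU P] ray U2 by (simp add: Q_def nn_integral_eq_integral)
  moreover from this have "energy G \<noteq> top" using Qpos by (auto simp: ennreal_top_divide)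
  ultimately obtain e where e: "energy G = ennreal e" "0 \<le> e" "e / Q = \<mu>"
    using Qpos \<mu>(2) by (cases "energy G") (auto simp: divide_ennreal)
  have Gm: "(\<lambda>x. \<Sum>i<N. (G i x)\<^sup>2) \<in> borel_measurable nu"
    using G(1) by (intro borel_measurable_sum borel_measurable_power) auto
  have E: "integrable nu (\<lambda>x. \<Sum>i<N. (G i x)\<^sup>2)"
    using e(1) Gm by (intro integrableI_nonneg) (auto simp: energy_def intro!: AE_I2 sum_nonneg)
  have eigU: "(LINT x|nu. (\<Sum>i<N. (G i x)\<^sup>2)) = \<mu> * Q"
  proof -
    have "0 \<le> (LINT x|nu. (\<Sum>i<N. (G i x)\<^sup>2))" by (intro Bochner_Integration.integral_nonneg sum_nonneg) auto
    then have "(LINT x|nu. (\<Sum>i<N. (G i x)\<^sup>2)) = e" using energy_eq[OF E] e by simp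
    then show ?thesis using e(3) Qpos by (simp add: field_simps)
  qed
  define R where "R = sup_const hdim * \<mu> powr (real hdim / 2) * (diam ^ hdim / sqrt vol) * sqrt Q"
  have upper: "AE x in nu. U x \<le> R"
    using one_sided_bound[OF \<mu> P U2 E mean] eigU Qpos by (simp add: R_def Q_def)
  have lower: "AE x in nu. - U x \<le> R"
  proof -
    have d: "((\<lambda>s. - s) has_real_derivative - 1) (at s)" for s :: real by (auto intro!: derivative_eq_intros)
    have "sobolev_pair N \<Omega> (\<lambda>x. - U x) (\<lambda>i x. - 1 * G i x)"
      by (rule sobolev_chain_rule[OF open_dom convex_dom P d, of 1 0]) auto
    from one_sided_bound[OF \<mu> this] show ?thesis
      using U2 E mean eigU Qpos by (simp add: R_def Q_def)
  qed
  have \<phi>V: "(LINT x:\<Omega>|Rn_lebesgue N. \<phi> x) = vol"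
  proof -
    have "(LINT x:\<Omega>|Rn_lebesgue N. \<phi> x) = (LINT x|completion (LB N). rho x)"
      by (simp add: set_lebesgue_integral_def rho_def Rn_lebesgue_LB)
    then show ?thesis by (simp add: integral_completion vol_def)
  qed
  have "AE x in LB N. x \<in> \<Omega> \<longrightarrow> \<bar>u x\<bar> \<le> R"
    using upper lower uU unfolding AE_nu_iff by eventually_elim (auto simp: abs_le_iff)
  then have ae: "AE x in restrict_space (Rn_lebesgue N) \<Omega>. ereal \<bar>u x\<bar> \<le> ereal R"
    unfolding Rn_lebesgue_LB using dom_subset by (subst AE_restrict_space_iff) (auto simp: AE_completion_iff Int_absorb2)
  have "\<Omega> \<inter> space (completion (LB N)) \<in> sets (completion (LB N))"
    using dom_subset by (simp add: Int_absorb2)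
  then have "u \<in> borel_measurable (restrict_space (completion (LB N)) \<Omega>)"
    using um unfolding set_borel_measurable_def Rn_lebesgue_LB by (subst borel_measurable_restrict_space_iff) auto
  then have "Linf_norm N \<Omega> u \<le> ereal R"
    unfolding Linf_norm_def using ae by (intro esssup_I) (auto simp: Rn_lebesgue_LB)
  then show ?thesis unfolding R_def \<phi>V norm_u \<mu>_def .
qed

end

theorem proposition35:
  shows "\<exists>C :: nat \<Rightarrow> real. (\<forall>k. 0 < C k) \<and>
    (\<forall>N m :: nat. N \<ge> 1 \<longrightarrow> m \<ge> 1 \<longrightarrow>
      (\<forall>\<Omega> \<phi> u. bounded_convex_domain N \<Omega> \<longrightarrow> root_concave_weight N m \<Omega> \<phi> \<longrightarrow>
        first_eigenfunction N \<Omega> \<phi> u \<longrightarrow>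
        Linf_norm N \<Omega> u \<le>
          ereal (C (N + m) * enn2real (neumann_mu1 N \<Omega> \<phi>) powr (real (N + m) / 2)
            * (Rn_diameter N \<Omega> ^ (N + m) / sqrt (LINT x:\<Omega>|Rn_lebesgue N. \<phi> x))
            * L2_weighted_norm N \<Omega> \<phi> u)))"
proof (intro exI[of _ sup_const] conjI allI impI)
  show "0 < sup_const k" for k by (rule sup_const_pos)
  fix N m :: nat and \<Omega> \<phi> u
  assume "N \<ge> 1" "m \<ge> 1" "bounded_convex_domain N \<Omega>" "root_concave_weight N m \<Omega> \<phi>"
    and u: "first_eigenfunction N \<Omega> \<phi> u"
  then interpret weighted_domain N m \<Omega> \<phi> by unfold_locales
  show "Linf_norm N \<Omega> u \<le>
          ereal (sup_const (N + m) * enn2real (neumann_mu1 N \<Omega> \<phi>) powr (real (N + m) / 2)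
            * (Rn_diameter N \<Omega> ^ (N + m) / sqrt (LINT x:\<Omega>|Rn_lebesgue N. \<phi> x))
            * L2_weighted_norm N \<Omega> \<phi> u)"
    using eigenfunction_bound[OF u] by (simp only: hdim_def)
qed

end
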